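(* Let $\ell\ge 1$ and let $T_\ell$ be the tree obtained from the perfect binary tree of depth $3$ by subdividing every edge $2\ell+1$ times (so each edge becomes a path of length $2\ell+2$). Then $c_\ell(T_\ell)=2$ and $mc_\ell(T_\ell)=3$.
   Context: $\ell$-visibility Cops and Robber on a graph $G$: in round 0 a set of cops each choose a vertex, then a single robber chooses a vertex. In each subsequent round, every cop moves to a neighbouring vertex or stays put, and then the robber moves to a neighbouring vertex or stays put. The robber always knows the positions of all cops. The cops know the robber's position only at moments when some cop and the robber occupy vertices $x,y$ with $d(x,y)\le \ell$. The cops capture the robber if a cop occupies the robber's vertex. $c_\ell(G)$ is the minimum number of cops that can guarantee capture. The robber territory is the set of vertices that may, given the cops' information, contain the robber. Let $S_k$ be the robber territory immediately after the cops' $k$-th move and before the robber moves. The (weakly) monotonic $\ell$-visibility cop number $mc_\ell(G)$ is the minimum number of cops that can guarantee capture of the robber subject to the restriction $S_{k+1}\subseteq S_k$ for all moves after the initial placement.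
   Formalization: The restriction S_{k+1} ⊆ S_k is imposed only on moves before capture during which the robber is out of the cops' sight; imposed also while he is seen (S_k a single vertex), three cops would not suffice and mc_ℓ(T_ℓ)=3 would fail. *)

theory Defs
  imports "Graph_Theory.Graph_Theory"
begin

text \<open>
  Graphs are the pair digraphs of \<^theory>\<open>Graph_Theory.Pair_Digraph\<close>; a finite simple graph is a
  \<^locale>\<open>pair_graph\<close>, that is, each edge is represented by its two opposite arcs.
\<close>

section \<open>The subdivided perfect binary tree\<close>

text \<open>A node is the list of turns leading to it from the root \<^term>\<open>[]\<close>, the most recent turn
  first. Every edge occurs once, directed away from the root.\<close>

definition perfect_binary_tree :: "nat \<Rightarrow> bool list pair_pre_digraph" where
  "perfect_binary_tree d =
     \<lparr> pverts = {xs. length xs \<le> d}, parcs = {(xs, b # xs) | b xs. length xs < d} \<rparr>"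

datatype 'a sd_vertex = Original 'a | Inner "'a \<times> 'a" nat

text \<open>The points of the path that replaces the edge \<open>e = (u, v)\<close>, from \<open>u\<close> (index \<open>0\<close>) to \<open>v\<close>
  (index \<open>m + 1\<close>).\<close>

definition sd_point :: "nat \<Rightarrow> 'a \<times> 'a \<Rightarrow> nat \<Rightarrow> 'a sd_vertex" where
  "sd_point m e i =
     (if i = 0 then Original (fst e) else if i = Suc m then Original (snd e) else Inner e i)"

text \<open>The argument lists every edge of the graph in one direction only; the result is symmetric.\<close>

definition subdivide_edges :: "nat \<Rightarrow> 'a pair_pre_digraph \<Rightarrow> 'a sd_vertex pair_pre_digraph" where
  "subdivide_edges m G =
     (let A = {(sd_point m e i, sd_point m e (Suc i)) | e i. e \<in> parcs G \<and> i \<le> m}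
      in \<lparr> pverts = Original ` pverts G \<union> {Inner e i | e i. e \<in> parcs G \<and> 1 \<le> i \<and> i \<le> m},
           parcs = A \<union> A\<inverse> \<rparr>)"

definition subdivided_tree :: "nat \<Rightarrow> bool list sd_vertex pair_pre_digraph" where
  "subdivided_tree l = subdivide_edges (2 * l + 1) (perfect_binary_tree 3)"

lemma pair_graph_subdivided_tree: "pair_graph (subdivided_tree l)"
proof -
  let ?P = "perfect_binary_tree 3" and ?m = "2 * l + 1"
  let ?A = "{(sd_point ?m e i, sd_point ?m e (Suc i)) | e i. e \<in> parcs ?P \<and> i \<le> ?m}"
  have V: "pverts (subdivided_tree l) =
      Original ` pverts ?P \<union> {Inner e i | e i. e \<in> parcs ?P \<and> 1 \<le> i \<and> i \<le> ?m}"
    and E: "parcs (subdivided_tree l) = ?A \<union> ?A\<inverse>"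
    by (simp_all add: subdivided_tree_def subdivide_edges_def Let_def)
  have finV: "finite (pverts ?P)"
    using finite_lists_length_le[of "UNIV :: bool set" 3] by (simp add: perfect_binary_tree_def)
  have ends: "fst e \<in> pverts ?P \<and> snd e \<in> pverts ?P" if "e \<in> parcs ?P" for e
    using that by (auto simp: perfect_binary_tree_def)
  have "parcs ?P \<subseteq> pverts ?P \<times> pverts ?P"
    using ends by (auto simp: mem_Times_iff)
  then have finE: "finite (parcs ?P)"
    using finV finite_subset by blast
  have pt: "sd_point ?m e i \<in> pverts (subdivided_tree l)" if "e \<in> parcs ?P" "i \<le> Suc ?m" for e i
    using that ends[of e] unfolding V sd_point_def by (cases e) auto
  have A: "?A \<subseteq> pverts (subdivided_tree l) \<times> pverts (subdivided_tree l)"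
    using pt by fastforce
  have "{Inner e i | e i. e \<in> parcs ?P \<and> 1 \<le> i \<and> i \<le> ?m}
      = (\<lambda>(e, i). Inner e i) ` (parcs ?P \<times> {1..?m})"
    by auto
  then have "finite (pverts (subdivided_tree l))"
    unfolding V using finV finE by simp
  moreover have sub: "parcs (subdivided_tree l)
      \<subseteq> pverts (subdivided_tree l) \<times> pverts (subdivided_tree l)"
    unfolding E using A by blast
  moreover have "finite (parcs (subdivided_tree l))"
    using calculation finite_subset by blast
  moreover have "fst a \<noteq> snd a" if "a \<in> parcs (subdivided_tree l)" for a
    using that unfolding E sd_point_def by (auto split: if_splits)
  moreover have "symmetric (with_proj (subdivided_tree l))"
    unfolding symmetric_def E with_proj_simps by (rule symI) blast
  ultimately show ?thesis
    by unfold_locales auto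
qed


section \<open>The game\<close>

definition graph_dist :: "'a pair_pre_digraph \<Rightarrow> 'a \<Rightarrow> 'a \<Rightarrow> ereal" where
  "graph_dist G u v = wf_digraph.\<mu> (with_proj G) (\<lambda>_. 1) u v"

lemma graph_dist_le_iff:
  assumes "pair_wf_digraph G"
  shows "graph_dist G u v \<le> ereal (real l) \<longleftrightarrow>
    (\<exists>p. pre_digraph.awalk (with_proj G) u p v \<and> length p \<le> l)"
proof -
  interpret pair_wf_digraph G by fact
  have cost: "awalk_cost (\<lambda>_. 1) p = real (length p)" for p :: "('a \<times> 'a) list"
    by (induct p) auto
  show ?thesis
  proof
    assume le: "graph_dist G u v \<le> ereal (real l)"
    have "ereal (real l) < ereal (real l + 1)" by simp
    with le have "(INF p\<in>{p. awalk u p v}. ereal (awalk_cost (\<lambda>_. 1) p)) < ereal (real l + 1)"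
      unfolding graph_dist_def \<mu>_def by (rule le_less_trans)
    then obtain p where "awalk u p v" "ereal (real (length p)) < ereal (real l + 1)"
      unfolding INF_less_iff cost by blast
    then show "\<exists>p. awalk u p v \<and> length p \<le> l" by auto
  next
    assume "\<exists>p. awalk u p v \<and> length p \<le> l"
    then obtain p where p: "awalk u p v" "length p \<le> l" by blast
    have "graph_dist G u v \<le> ereal (real (length p))"
      using min_cost_le_walk_cost[OF p(1), of "\<lambda>_. 1"] unfolding graph_dist_def cost .
    also have "\<dots> \<le> ereal (real l)" using p(2) by simp
    finally show "graph_dist G u v \<le> ereal (real l)" .
  qed
qed

definition may_move :: "'a pair_pre_digraph \<Rightarrow> 'a \<Rightarrow> 'a \<Rightarrow> bool" where
  "may_move G u v \<longleftrightarrow> v = u \<or> (u, v) \<in> parcs G"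

definition visible :: "nat \<Rightarrow> 'a pair_pre_digraph \<Rightarrow> 'a list \<Rightarrow> 'a \<Rightarrow> bool" where
  "visible l G C v \<longleftrightarrow> (\<exists>c \<in> set C. graph_dist G c v \<le> ereal (real l))"

definition observe :: "nat \<Rightarrow> 'a pair_pre_digraph \<Rightarrow> 'a list \<Rightarrow> 'a \<Rightarrow> 'a option" where
  "observe l G C v = (if visible l G C v then Some v else None)"

text \<open>
  A cop strategy maps the observations made so far to the new positions of the cops (the \<open>i\<close>-th
  entry being the position of the \<open>i\<close>-th cop); on the empty list it gives the initial placement.
  The robber's behaviour is given by \<open>r\<close>, where \<open>r k\<close> is his position at the end of round \<open>k\<close>.
  An observation is made after the robber's placement, and from then on after every move of the cops
  and after every move of the robber.
\<close>

type_synonym 'a strategy = "'a option list \<Rightarrow> 'a list"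

definition robber_walk :: "'a pair_pre_digraph \<Rightarrow> (nat \<Rightarrow> 'a) \<Rightarrow> bool" where
  "robber_walk G r \<longleftrightarrow> r 0 \<in> pverts G \<and> (\<forall>k. may_move G (r k) (r (Suc k)))"

text \<open>The observations made up to the end of round \<open>k\<close>.\<close>

primrec history ::
  "nat \<Rightarrow> 'a pair_pre_digraph \<Rightarrow> 'a strategy \<Rightarrow> (nat \<Rightarrow> 'a) \<Rightarrow> nat \<Rightarrow> 'a option list" where
  "history l G \<sigma> r 0 = [observe l G (\<sigma> []) (r 0)]"
| "history l G \<sigma> r (Suc k) =
     (let h = history l G \<sigma> r k
      in h @ [observe l G (\<sigma> h) (r k), observe l G (\<sigma> h) (r (Suc k))])"

primrec cops ::
  "nat \<Rightarrow> 'a pair_pre_digraph \<Rightarrow> 'a strategy \<Rightarrow> (nat \<Rightarrow> 'a) \<Rightarrow> nat \<Rightarrow> 'a list" where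
  "cops l G \<sigma> r 0 = \<sigma> []"
| "cops l G \<sigma> r (Suc k) = \<sigma> (history l G \<sigma> r k)"

definition legal_strategy :: "nat \<Rightarrow> 'a pair_pre_digraph \<Rightarrow> nat \<Rightarrow> 'a strategy \<Rightarrow> bool" where
  "legal_strategy l G n \<sigma> \<longleftrightarrow>
     length (\<sigma> []) = n \<and> set (\<sigma> []) \<subseteq> pverts G \<and>
     (\<forall>r. robber_walk G r \<longrightarrow>
       (\<forall>k. list_all2 (may_move G) (cops l G \<sigma> r k) (cops l G \<sigma> r (Suc k))))"

text \<open>The robber has been captured by the end of the cops' \<open>k\<close>-th move, either by the robber's
  own move onto a cop or by a move of a cop onto him.\<close>

definition captured_by ::
  "nat \<Rightarrow> 'a pair_pre_digraph \<Rightarrow> 'a strategy \<Rightarrow> (nat \<Rightarrow> 'a) \<Rightarrow> nat \<Rightarrow> bool" where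
  "captured_by l G \<sigma> r k \<longleftrightarrow>
     (\<exists>j<k. r j \<in> set (cops l G \<sigma> r j) \<or> r j \<in> set (cops l G \<sigma> r (Suc j)))"

text \<open>The robber sees the cops, so capture is guaranteed only if it happens against every robber
  walk.\<close>

definition winning_strategy :: "nat \<Rightarrow> 'a pair_pre_digraph \<Rightarrow> nat \<Rightarrow> 'a strategy \<Rightarrow> bool" where
  "winning_strategy l G n \<sigma> \<longleftrightarrow>
     legal_strategy l G n \<sigma> \<and> (\<forall>r. robber_walk G r \<longrightarrow> (\<exists>k. captured_by l G \<sigma> r k))"

definition cop_number :: "nat \<Rightarrow> 'a pair_pre_digraph \<Rightarrow> nat" where
  "cop_number l G = (LEAST n. \<exists>\<sigma>. winning_strategy l G n \<sigma>)"


section \<open>Monotonicity\<close>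

text \<open>In the rest \<open>k \<ge> 1\<close>: the robber makes no move between the end of round \<open>k - 1\<close> and the
  cops' \<open>k\<close>-th move, so he is at \<open>r (k - 1)\<close> at the latter moment.\<close>

definition cop_information ::
  "nat \<Rightarrow> 'a pair_pre_digraph \<Rightarrow> 'a strategy \<Rightarrow> (nat \<Rightarrow> 'a) \<Rightarrow> nat \<Rightarrow> 'a option list" where
  "cop_information l G \<sigma> r k =
     history l G \<sigma> r (k - 1) @ [observe l G (cops l G \<sigma> r k) (r (k - 1))]"

definition territory ::
  "nat \<Rightarrow> 'a pair_pre_digraph \<Rightarrow> 'a strategy \<Rightarrow> (nat \<Rightarrow> 'a) \<Rightarrow> nat \<Rightarrow> 'a set" where
  "territory l G \<sigma> r k =
     {r' (k - 1) | r'. robber_walk G r' \<and> cop_information l G \<sigma> r' k = cop_information l G \<sigma> r k}"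

text \<open>The robber is out of sight at every moment from the cops' \<open>k\<close>-th to their \<open>(k + 1)\<close>-st move.\<close>

definition out_of_sight ::
  "nat \<Rightarrow> 'a pair_pre_digraph \<Rightarrow> 'a strategy \<Rightarrow> (nat \<Rightarrow> 'a) \<Rightarrow> nat \<Rightarrow> bool" where
  "out_of_sight l G \<sigma> r k \<longleftrightarrow>
     \<not> visible l G (cops l G \<sigma> r k) (r (k - 1)) \<and>
     \<not> visible l G (cops l G \<sigma> r k) (r k) \<and>
     \<not> visible l G (cops l G \<sigma> r (Suc k)) (r k)"

text \<open>
  While the cops see the robber, the territory is just his current position and changes whenever
  he moves. Monotonicity is a condition on the search for the unseen robber and is therefore
  required of the moves during which he is out of sight. In particular, as in the weakly monotonic
  zero-visibility game, a vertex that the robber could re-enter may be brought back into view by the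
  very next move of the cops. The inclusion of the first territory in that of the initial placement
  is automatic, as the robber does not move in between.
\<close>

definition monotonic_strategy :: "nat \<Rightarrow> 'a pair_pre_digraph \<Rightarrow> 'a strategy \<Rightarrow> bool" where
  "monotonic_strategy l G \<sigma> \<longleftrightarrow>
     (\<forall>r k. robber_walk G r \<and> 1 \<le> k \<and> \<not> captured_by l G \<sigma> r (Suc k) \<and> out_of_sight l G \<sigma> r k
        \<longrightarrow> territory l G \<sigma> r (Suc k) \<subseteq> territory l G \<sigma> r k)"

definition mono_cop_number :: "nat \<Rightarrow> 'a pair_pre_digraph \<Rightarrow> nat" where
  "mono_cop_number l G = (LEAST n. \<exists>\<sigma>. winning_strategy l G n \<sigma> \<and> monotonic_strategy l G \<sigma>)"

end

theory Submission
  imports Defs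
begin

text \<open>
  In a tree, a robber who is seen once is caught: a cop who keeps stepping towards the last known
  position of the robber never loses sight of him again. Hence only the moves that the cops make
  while they see nothing matter, and the game becomes a search by balls of radius \<open>l\<close>.

  One cop loses already on a spider with three legs of length \<open>2 * l + 2\<close>: to see the end of a leg he
  has to give up the centre for two moves. Two cops win: one guards a child of the root, and the
  other one clears the spiders below it; what escapes from a spider while its centre is out of sight is
  trapped between the two.

  In a monotonic search, the vertices that have been in sight stay clear, so whatever separates them
  from the others is guarded at every move. If two cops search monotonically, consider the first of the
  four spiders at depth 2 to be cleared. From then on, one cop guards its separation from the others and
  is too far away to guard the centre of another spider. So the other cop can see the end of a leg there
  only if he has been in that leg from the start, and then he did not help with the first spider.
  Three cops sweep the tree depth first.

  Distances are bounded from below by functions that are linear on each subdivided edge and change by at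
  most 1 along an arc.
\<close>

section \<open>Walks of bounded length\<close>

text \<open>The edge length \<open>2 * l + 2\<close> shapes everything. A cop inside a leg sees its
  centre only from depth at most \<open>l\<close> and its end only from depth at least
  \<open>l + 2\<close>; depth \<open>l + 1\<close>, which has to be crossed, shows neither. Cops at
  the two ends of a subdivided edge overlook exactly one vertex of it, the midpoint, and one step of
  either reveals it; this is how the escaped robber is trapped. The same gap of 2 keeps one cop from
  guarding, before and after a single move, two vertices that are a whole edge apart. The lower
  bounds face a circularity: the cops' moves depend on their observations, and these on the cops.
  Against a robber who is never seen, the cops run through one fixed sequence of positions. However,
  a strategy has to be legal only along actual robber walks, so a move of that sequence may be used
  only after exhibiting a robber who has stayed out of sight up to then.\<close>

definition near :: "'a pair_pre_digraph \<Rightarrow> nat \<Rightarrow> 'a \<Rightarrow> 'a \<Rightarrow> bool" where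
  "near G n = may_move G ^^ n"

lemma near_0 [simp]: "near G 0 u v \<longleftrightarrow> u = v"
  by (simp add: near_def)

lemma near_Suc: "near G (Suc n) u v \<longleftrightarrow> (\<exists>w. may_move G u w \<and> near G n w v)"
  unfolding near_def by (metis relpowp_Suc_D2 relpowp_Suc_I2)

lemma may_move_refl [simp]: "may_move G u u"
  by (simp add: may_move_def)

lemma near_refl [simp]: "near G n u u"
  by (induction n) (auto simp: near_Suc intro: exI[of _ u])

lemma near_step_right: "near G n u v \<Longrightarrow> may_move G v w \<Longrightarrow> near G (Suc n) u w"
  unfolding near_def by (rule relpowp_Suc_I)

lemma near_trans: "near G m u v \<Longrightarrow> near G n v w \<Longrightarrow> near G (m + n) u w"
  unfolding near_def by (rule relpowp_trans)

lemma near_mono: "near G n u v \<Longrightarrow> n \<le> m \<Longrightarrow> near G m u v"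
proof (induction m)
  case (Suc m)
  then show ?case
    by (metis le_Suc_eq may_move_refl near_step_right)
qed simp

lemma near_walk:
  assumes "\<And>i. i < n \<Longrightarrow> may_move G (p i) (p (Suc i))"
  shows "near G n (p 0) (p n)"
  using assms
proof (induction n)
  case (Suc n)
  then show ?case using near_step_right by fastforce
qed simp

lemma near_lipschitz:
  fixes f :: "'a \<Rightarrow> int"
  assumes "near G n u v"
    and "\<And>u v. (u, v) \<in> parcs G \<Longrightarrow> \<bar>f u - f v\<bar> \<le> 1"
  shows "\<bar>f u - f v\<bar> \<le> int n"
  using assms(1)
proof (induction n arbitrary: u)
  case (Suc n)
  then obtain w where w: "may_move G u w" "near G n w v" by (auto simp: near_Suc)
  have "\<bar>f u - f w\<bar> \<le> 1" using w(1) assms(2) by (auto simp: may_move_def)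
  with Suc.IH[OF w(2)] show ?case by linarith
qed simp

context pair_wf_digraph
begin

lemma may_move_in_verts: "may_move G u v \<Longrightarrow> u \<in> pverts G \<Longrightarrow> v \<in> pverts G"
  by (auto simp: may_move_def dest: in_arcsD2)

lemma list_all2_may_move_in_verts:
  "list_all2 (may_move G) C C' \<Longrightarrow> set C \<subseteq> pverts G \<Longrightarrow> set C' \<subseteq> pverts G"
  by (induction rule: list_all2_induct) (auto intro: may_move_in_verts)

lemma near_iff_awalk:
  assumes "u \<in> pverts G"
  shows "near G n u v \<longleftrightarrow> (\<exists>p. awalk u p v \<and> length p \<le> n)"
  using assms
proof (induction n arbitrary: u)
  case 0
  then show ?case by (auto simp: awalk_Nil_iff)
next
  case (Suc n)
  show ?case
  proof
    assume "near G (Suc n) u v"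
    then obtain w where w: "may_move G u w" "near G n w v" by (auto simp: near_Suc)
    with Suc obtain p where p: "awalk w p v" "length p \<le> n"
      using may_move_in_verts by blast
    show "\<exists>p. awalk u p v \<and> length p \<le> Suc n"
    proof (cases "w = u")
      case False
      with w have "(u, w) \<in> parcs G" by (simp add: may_move_def)
      with p have "awalk u ((u, w) # p) v" by (auto simp: awalk_Cons_iff)
      with p(2) show ?thesis by (intro exI[of _ "(u, w) # p"]) simp
    qed (use p in auto)
  next
    assume "\<exists>p. awalk u p v \<and> length p \<le> Suc n"
    then obtain p where p: "awalk u p v" "length p \<le> Suc n" by blast
    show "near G (Suc n) u v"
    proof (cases p)
      case Nil
      with p show ?thesis by (auto simp: awalk_Nil_iff)
    next
      case (Cons e p')
      with p have "e \<in> parcs G" "fst e = u" "awalk (snd e) p' v" "length p' \<le> n"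
        by (auto simp: awalk_Cons_iff)
      then have "may_move G u (snd e)" "near G n (snd e) v"
        using Suc.IH[of "snd e"] by (auto simp: may_move_def intro: arc_snd_in_verts)
      then show ?thesis by (auto simp: near_Suc)
    qed
  qed
qed

lemma visible_iff_near:
  assumes "set C \<subseteq> pverts G"
  shows "visible l G C v \<longleftrightarrow> (\<exists>c \<in> set C. near G l c v)"
  using assms graph_dist_le_iff[OF pair_wf_digraph_axioms] near_iff_awalk
  unfolding visible_def by (meson subsetD)

lemma robber_walk_in_verts: "robber_walk G r \<Longrightarrow> r k \<in> pverts G"
  by (induction k) (auto simp: robber_walk_def intro: may_move_in_verts)

lemma robber_walk_const: "v \<in> pverts G \<Longrightarrow> robber_walk G (\<lambda>_. v)"
  by (simp add: robber_walk_def)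

end

lemma (in pair_sym_digraph) may_move_sym: "may_move G u v \<longleftrightarrow> may_move G v u"
  using pair_sym_arcs by (auto simp: may_move_def symmetric_def dest: symD)

lemma (in pair_sym_digraph) near_sym: "near G n u v \<Longrightarrow> near G n v u"
proof (induction n arbitrary: u)
  case (Suc n)
  then show ?case by (metis near_Suc may_move_sym near_step_right)
qed simp


section \<open>Rooted trees\<close>

locale rooted_tree = pair_graph G for G :: "'a pair_pre_digraph" +
  fixes par :: "'a \<Rightarrow> 'a" and height :: "'a \<Rightarrow> nat" and root :: 'a
  assumes root_in_verts: "root \<in> pverts G"
    and par_in_verts: "v \<in> pverts G \<Longrightarrow> par v \<in> pverts G"
    and height_root: "height root = 0"
    and height_par: "v \<in> pverts G \<Longrightarrow> v \<noteq> root \<Longrightarrow> Suc (height (par v)) = height v"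
    and arc_iff: "(u, v) \<in> parcs G \<longleftrightarrow> u \<in> pverts G \<and> v \<in> pverts G \<and>
      (v \<noteq> root \<and> u = par v \<or> u \<noteq> root \<and> v = par u)"
begin

text \<open>The locale says of \<open>par root\<close> only that it is a vertex; the bound
  \<open>n \<le> height x\<close> ends the iteration at the root.\<close>

definition anc :: "'a \<Rightarrow> 'a \<Rightarrow> bool" where
  "anc c x \<longleftrightarrow> (\<exists>n \<le> height x. (par ^^ n) x = c)"

lemma par_pow:
  assumes "x \<in> pverts G" "n \<le> height x"
  shows "(par ^^ n) x \<in> pverts G \<and> height ((par ^^ n) x) = height x - n"
  using assms(2)
proof (induction n)
  case (Suc n)
  then have *: "(par ^^ n) x \<in> pverts G" "height ((par ^^ n) x) = height x - n" by auto
  then have "(par ^^ n) x \<noteq> root" using Suc.prems height_root by auto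
  with * height_par[of "(par ^^ n) x"] par_in_verts show ?case by auto
qed (use assms in auto)

lemma height_0_iff: "x \<in> pverts G \<Longrightarrow> height x = 0 \<longleftrightarrow> x = root"
  using height_par height_root by fastforce

lemma anc_refl [simp]: "anc x x"
  by (auto simp: anc_def intro: exI[of _ 0])

lemma anc_root: "x \<in> pverts G \<Longrightarrow> anc root x"
  using par_pow[of x "height x"] height_0_iff by (auto simp: anc_def)

lemma anc_in_verts: "anc c x \<Longrightarrow> x \<in> pverts G \<Longrightarrow> c \<in> pverts G"
  using par_pow by (auto simp: anc_def)

lemma anc_height: "anc c x \<Longrightarrow> x \<in> pverts G \<Longrightarrow> height c \<le> height x"
  using par_pow by (auto simp: anc_def)

lemma anc_par_iff:
  assumes "x \<in> pverts G" "x \<noteq> root"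
  shows "anc c x \<longleftrightarrow> c = x \<or> anc c (par x)"
proof
  assume "anc c x"
  then obtain n where n: "n \<le> height x" "(par ^^ n) x = c" by (auto simp: anc_def)
  show "c = x \<or> anc c (par x)"
  proof (cases n)
    case (Suc m)
    then have "(par ^^ m) (par x) = c" using n by (simp add: funpow_swap1)
    moreover have "m \<le> height (par x)" using Suc n height_par[OF assms] by linarith
    ultimately show ?thesis by (auto simp: anc_def)
  qed (use n in auto)
next
  assume "c = x \<or> anc c (par x)"
  then show "anc c x"
  proof
    assume "anc c (par x)"
    then obtain n where n: "n \<le> height (par x)" "(par ^^ n) (par x) = c" by (auto simp: anc_def)
    then have "(par ^^ Suc n) x = c" by (simp add: funpow_swap1)
    moreover have "Suc n \<le> height x" using n(1) height_par[OF assms] by linarith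
    ultimately show ?thesis unfolding anc_def by blast
  qed auto
qed

lemma anc_root_iff: "anc c root \<longleftrightarrow> c = root"
  by (auto simp: anc_def height_root)

lemma anc_trans: "anc b c \<Longrightarrow> anc c x \<Longrightarrow> x \<in> pverts G \<Longrightarrow> anc b x"
proof (induction "height x" arbitrary: x)
  case 0
  then show ?case by (metis height_0_iff anc_root_iff)
next
  case (Suc n)
  then have "x \<noteq> root" using height_root by auto
  then show ?case
    using Suc anc_par_iff[of x] height_par[of x] par_in_verts[of x] by force
qed

lemma anc_arc:
  assumes "may_move G x y" "x \<in> pverts G" "anc c x"
  shows "anc c y \<or> x = c \<and> c \<noteq> root \<and> y = par c"
proof (cases "y = x")
  case False
  with assms(1) have "(x, y) \<in> parcs G" by (simp add: may_move_def)
  then have "x \<in> pverts G" "y \<in> pverts G" and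
    "y \<noteq> root \<and> x = par y \<or> x \<noteq> root \<and> y = par x"
    by (auto simp: arc_iff)
  then show ?thesis using assms(3) anc_par_iff[of x c] anc_par_iff[of y c] by auto
qed (use assms in auto)

lemma child_towards:
  assumes "anc c x" "c \<noteq> x" "x \<in> pverts G"
  shows "\<exists>c'. c' \<in> pverts G \<and> c' \<noteq> root \<and> par c' = c \<and> anc c' x"
proof -
  obtain n where n: "n \<le> height x" "(par ^^ n) x = c" using assms by (auto simp: anc_def)
  then obtain m where m: "n = Suc m" using assms by (cases n) auto
  have "(par ^^ m) x \<in> pverts G" "height ((par ^^ m) x) = height x - m"
    using par_pow[of x m] assms m n by auto
  moreover have "height x - m \<noteq> 0" using m n by auto
  moreover have "par ((par ^^ m) x) = c" using m n by simp
  moreover have "anc ((par ^^ m) x) x" unfolding anc_def using m n by (auto intro!: exI[of _ m])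
  ultimately show ?thesis using height_root by metis
qed

text \<open>The only arc out of the subtree below \<open>g\<close> leads from \<open>g\<close> to
  \<open>par g\<close>, so a walk that leaves has spent at least one step when it reaches
  \<open>par g\<close>.\<close>

lemma near_leave_subtree:
  assumes "near G (Suc n) p v" "p \<in> pverts G" "anc g p" "\<not> anc g v"
  shows "g \<noteq> root \<and> near G n (par g) v"
  using assms
proof (induction n arbitrary: p)
  case 0
  then show ?case using anc_arc by (auto simp: near_Suc)
next
  case (Suc n)
  then obtain y where y: "may_move G p y" "near G (Suc n) y v" using near_Suc by metis
  show ?case
  proof (cases "anc g y")
    case True
    then have "g \<noteq> root \<and> near G n (par g) v"
      using Suc.IH[of y] Suc.prems y may_move_in_verts by blast
    then show ?thesis using near_mono by fastforce
  next
    case False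
    then show ?thesis using anc_arc[OF y(1)] Suc.prems y by blast
  qed
qed

text \<open>A walk can enter the subtree only at \<open>g\<close>, and starting outside it has spent
  at least one step by then.\<close>

lemma near_enter_subtree:
  assumes "near G (Suc n) p v" "p \<in> pverts G" "\<not> anc g p" "anc g v"
  shows "near G n g v"
  using assms
proof (induction n arbitrary: p)
  case 0
  then have "may_move G v p" using may_move_sym[of v p] by (auto simp: near_Suc)
  then show ?case using anc_arc[of v p g] 0 may_move_in_verts may_move_sym by fastforce
next
  case (Suc n)
  then obtain y where y: "may_move G p y" "near G (Suc n) y v" using near_Suc by metis
  have yV: "y \<in> pverts G" using y(1) Suc.prems may_move_in_verts by blast
  show ?case
  proof (cases "anc g y")
    case False
    then have "near G n g v" using Suc.IH[of y] Suc.prems y yV by blast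
    then show ?thesis using near_mono by fastforce
  next
    case True
    then have "y = g" using anc_arc[of y p g] y yV Suc.prems may_move_sym by blast
    then show ?thesis using y by blast
  qed
qed

definition towards :: "'a \<Rightarrow> 'a \<Rightarrow> 'a" where
  "towards c x =
     (if c = x then c
      else if anc c x then SOME c'. c' \<in> pverts G \<and> c' \<noteq> root \<and> par c' = c \<and> anc c' x
      else par c)"

lemma towards_down:
  assumes "anc c x" "c \<noteq> x" "x \<in> pverts G"
  shows "towards c x \<in> pverts G" "towards c x \<noteq> root" "par (towards c x) = c"
    "anc (towards c x) x"
  using someI_ex[OF child_towards[OF assms]] assms unfolding towards_def by simp_all

lemma towards_up: "\<not> anc c x \<Longrightarrow> towards c x = par c"
  by (auto simp: towards_def)

lemma towards_may_move:
  assumes "c \<in> pverts G" "x \<in> pverts G"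
  shows "may_move G c (towards c x)"
proof (cases "c = x")
  case False
  show ?thesis
  proof (cases "anc c x")
    case True
    then have "(c, towards c x) \<in> parcs G"
      unfolding arc_iff using towards_down[OF True False] assms by simp
    then show ?thesis by (simp add: may_move_def)
  next
    case up: False
    then have "c \<noteq> root" using anc_root assms by blast
    then have "(c, par c) \<in> parcs G" unfolding arc_iff using assms par_in_verts by simp
    then show ?thesis using towards_up[OF up] by (simp add: may_move_def)
  qed
qed (simp add: towards_def)

text \<open>If \<open>c\<close> is not \<open>x\<close>, every walk to \<open>x\<close> passes the
  vertex chosen by \<open>towards\<close>: a descending step enters the subtree of that vertex, an
  ascending one leaves the subtree of \<open>c\<close>.\<close>

lemma near_towards:
  assumes "near G (Suc n) c x" "c \<in> pverts G" "x \<in> pverts G"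
  shows "near G n (towards c x) x"
proof (cases "c = x")
  case False
  show ?thesis
  proof (cases "anc c x")
    case True
    note t = towards_down[OF True False assms(3)]
    have "\<not> anc (towards c x) c"
      using anc_height[of "towards c x" c] height_par[OF t(1,2)] t(3) assms(2) by auto
    then show ?thesis using near_enter_subtree[OF assms(1,2)] t(4) by blast
  next
    case up: False
    then show ?thesis using near_leave_subtree[OF assms(1,2)] towards_up by auto
  qed
qed (simp add: towards_def)

end

section \<open>Pursuit of a robber that has been seen\<close>

definition last_seen :: "'a option list \<Rightarrow> 'a" where
  "last_seen h = the (last (filter (\<lambda>x. x \<noteq> None) h))"

abbreviation quiet :: "'a option list \<Rightarrow> bool" where
  "quiet h \<equiv> set h \<subseteq> {None}"

text \<open>The schedule \<open>C\<close> is followed until the first sighting. After round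
  \<open>k\<close> the history has length \<open>2 * k + 1\<close>, so the next index is
  \<open>k + 1\<close>; the empty history gives index 0. The history is the only memory of a
  strategy, so after a sighting the present positions are recomputed from the history without the
  two observations of the last round.\<close>

function pursue :: "('a \<Rightarrow> 'a \<Rightarrow> 'a) \<Rightarrow> (nat \<Rightarrow> 'a list) \<Rightarrow> 'a strategy" where
  "pursue f C h =
     (if quiet h then C ((length h + 1) div 2)
      else map (\<lambda>c. f c (last_seen h)) (pursue f C (butlast (butlast h))))"
  by auto
termination
proof (relation "measure (\<lambda>(f, C, h). length h)")
  fix f :: "'a \<Rightarrow> 'a \<Rightarrow> 'a" and C :: "nat \<Rightarrow> 'a list" and h :: "'a option list"
  assume "\<not> quiet h"
  then show "((f, C, butlast (butlast h)), f, C, h) \<in> measure (\<lambda>(f, C, h). length h)"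
    by (cases h) auto
qed simp

declare pursue.simps [simp del]

lemma pursue_quiet: "quiet h \<Longrightarrow> pursue f C h = C ((length h + 1) div 2)"
  by (subst pursue.simps) (simp only: if_True)

lemma pursue_alert: "\<not> quiet h \<Longrightarrow>
    pursue f C h = map (\<lambda>c. f c (last_seen h)) (pursue f C (butlast (butlast h)))"
  by (subst pursue.simps) (simp only: if_False)

lemma pursue_Nil [simp]: "pursue f C [] = C 0"
  by (simp add: pursue_quiet)

lemma quiet_replicate: "quiet h \<Longrightarrow> replicate (length h) None = h"
  by (rule replicate_length_same) auto

lemma length_history [simp]: "length (history l G \<sigma> r k) = 2 * k + 1"
  by (induction k) (auto simp: Let_def)

lemma history_Suc:
  "history l G \<sigma> r (Suc k) = history l G \<sigma> r k @
     [observe l G (cops l G \<sigma> r (Suc k)) (r k), observe l G (cops l G \<sigma> r (Suc k)) (r (Suc k))]"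
  by (simp add: Let_def)

declare history.simps(2) [simp del]

lemma quiet_history_iff:
  "quiet (history l G \<sigma> r k) \<longleftrightarrow>
     (\<forall>j\<le>k. \<not> visible l G (cops l G \<sigma> r j) (r j)) \<and>
     (\<forall>j<k. \<not> visible l G (cops l G \<sigma> r (Suc j)) (r j))"
proof (induction k)
  case 0
  then show ?case by (simp add: observe_def)
next
  case (Suc k)
  have "quiet (history l G \<sigma> r (Suc k)) \<longleftrightarrow> quiet (history l G \<sigma> r k) \<and>
      \<not> visible l G (cops l G \<sigma> r (Suc k)) (r k) \<and>
      \<not> visible l G (cops l G \<sigma> r (Suc k)) (r (Suc k))"
    unfolding history_Suc by (auto simp: observe_def)
  with Suc show ?case by (auto simp: le_Suc_eq less_Suc_eq)
qed

lemma cops_of_quiet_history: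
  assumes "quiet (history l G \<sigma> r k)"
  shows "cops l G \<sigma> r (Suc k) = \<sigma> (replicate (2 * k + 1) None)"
  using quiet_replicate[OF assms] by (simp del: replicate.simps)

locale sighted_tree = rooted_tree +
  fixes l :: nat
  assumes l_pos: "1 \<le> l"
begin

definition seen :: "'a list \<Rightarrow> 'a set" where
  "seen C = {v. \<exists>c \<in> set C. near G l c v}"

lemma visible_iff_seen: "set C \<subseteq> pverts G \<Longrightarrow> visible l G C v \<longleftrightarrow> v \<in> seen C"
  by (auto simp: seen_def visible_iff_near)

lemma in_seen: "c \<in> set C \<Longrightarrow> c \<in> seen C"
  by (auto simp: seen_def intro: bexI[of _ c])

text \<open>The cop's step towards \<open>x\<close> gains the one step that the robber's move away
  from \<open>x\<close> can cost.\<close>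

lemma near_after_step:
  assumes "near G l c x" "c \<in> pverts G" "x \<in> pverts G" "may_move G x y"
  shows "near G l (towards c x) y"
proof -
  obtain n where n: "l = Suc n" using l_pos by (cases l) auto
  have "near G n (towards c x) x" using near_towards assms n by blast
  from near_step_right[OF this assms(4)] show ?thesis by (simp add: n)
qed

section \<open>The cops' positions under a schedule that turns into a pursuit\<close>

context
  fixes C :: "nat \<Rightarrow> 'a list" and r :: "nat \<Rightarrow> 'a"
  assumes C0: "set (C 0) \<subseteq> pverts G"
    and legal: "\<And>k. list_all2 (may_move G) (C k) (C (Suc k))"
    and walk: "robber_walk G r"
begin

abbreviation "hist k \<equiv> history l G (pursue towards C) r k"
abbreviation "cop k \<equiv> cops l G (pursue towards C) r k"

lemma cop_0: "cop 0 = C 0"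
  by simp

lemma cop_quiet: "quiet (hist k) \<Longrightarrow> cop (Suc k) = C (Suc k)"
  by (simp add: pursue_quiet)

lemma cop_alert: "\<not> quiet (hist k) \<Longrightarrow>
    cop (Suc k) = map (\<lambda>c. towards c (last_seen (hist k))) (cop k)"
proof -
  assume a: "\<not> quiet (hist k)"
  have "pursue towards C (butlast (butlast (hist k))) = cop k"
    by (cases k) (simp_all add: history_Suc butlast_append)
  then show ?thesis using pursue_alert[OF a, of towards C] by simp
qed

lemma quiet_Suc: "quiet (hist (Suc k)) \<Longrightarrow> quiet (hist k)"
  by (simp add: history_Suc)

lemma cop_quiet': "quiet (hist k) \<Longrightarrow> j \<le> Suc k \<Longrightarrow> cop j = C j"
proof (induction k arbitrary: j)
  case 0
  then show ?case by (cases j) (auto simp: cop_0 cop_quiet simp del: cops.simps)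
next
  case (Suc k)
  show ?case
  proof (cases "j = Suc (Suc k)")
    case True
    then show ?thesis using cop_quiet[OF Suc.prems(1)] by blast
  next
    case False
    then have "j \<le> Suc k" using Suc.prems(2) by simp
    then show ?thesis using Suc.IH[OF quiet_Suc[OF Suc.prems(1)]] by blast
  qed
qed

lemma last_seen_in_verts: "\<not> quiet (hist k) \<Longrightarrow> last_seen (hist k) \<in> pverts G"
proof -
  assume "\<not> quiet (hist k)"
  then have "filter (\<lambda>x. x \<noteq> None) (hist k) \<noteq> []" by (auto simp: filter_empty_conv)
  from last_in_set[OF this]
  have "last (filter (\<lambda>x. x \<noteq> None) (hist k)) \<in> set (hist k) - {None}" by auto
  moreover have "set (hist k) - {None} \<subseteq> Some ` pverts G"
    using robber_walk_in_verts[OF walk]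
    by (induction k) (auto simp: history_Suc observe_def split: if_splits)
  ultimately show ?thesis unfolding last_seen_def by force
qed

lemma cop_legal: "set (cop k) \<subseteq> pverts G \<and> list_all2 (may_move G) (cop k) (cop (Suc k))"
proof (induction k)
  case 0
  show ?case
  proof (cases "quiet (hist 0)")
    case True
    then show ?thesis using cop_0 cop_quiet[of 0] C0 legal[of 0] by simp
  next
    case False
    then show ?thesis using cop_0 cop_alert[of 0] C0 last_seen_in_verts[of 0]
      by (auto simp: list_all2_conv_all_nth simp del: cops.simps intro!: towards_may_move)
  qed
next
  case (Suc k)
  then have V: "set (cop (Suc k)) \<subseteq> pverts G" using list_all2_may_move_in_verts by blast
  show ?case
  proof (cases "quiet (hist (Suc k))")
    case True
    then show ?thesis using V cop_quiet quiet_Suc legal[of "Suc k"] by (simp del: cops.simps)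
  next
    case False
    then show ?thesis using V cop_alert[of "Suc k"] last_seen_in_verts[of "Suc k"]
      by (auto simp: list_all2_conv_all_nth simp del: cops.simps intro!: towards_may_move)
  qed
qed

lemma visible_cop_iff: "visible l G (cop k) v \<longleftrightarrow> v \<in> seen (cop k)"
  using visible_iff_seen cop_legal by blast

lemma last_seen_Suc:
  "r (Suc k) \<in> seen (cop (Suc k)) \<Longrightarrow> last_seen (hist (Suc k)) = r (Suc k)"
  "r (Suc k) \<notin> seen (cop (Suc k)) \<Longrightarrow> r k \<in> seen (cop (Suc k)) \<Longrightarrow>
    last_seen (hist (Suc k)) = r k"
  by (auto simp: last_seen_def history_Suc observe_def visible_cop_iff simp del: cops.simps)

text \<open>The last seen position is within \<open>l\<close> of some cop, and the robber is at most
  one move away from it, so the cops' step towards it brings him into view again by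
  \<open>near_after_step\<close>. A sighting is thus renewed in every round, and the cops' knowledge
  is never more than one move old.\<close>

lemma seen_again: "\<not> quiet (hist k) \<Longrightarrow> r k \<in> seen (cop (Suc k))"
proof (induction k)
  case 0
  then have "r 0 \<in> seen (cop 0)" and ls: "last_seen (hist 0) = r 0"
    using visible_cop_iff[of 0 "r 0"] by (auto simp: observe_def last_seen_def split: if_splits)
  then obtain c where c: "c \<in> set (cop 0)" "near G l c (r 0)" by (auto simp: seen_def)
  then have "near G l (towards c (r 0)) (r 0)"
    using near_after_step[of c "r 0" "r 0"] cop_legal[of 0] robber_walk_in_verts[OF walk] by auto
  then show ?case using c cop_alert[OF 0] ls by (auto simp: seen_def simp del: cops.simps)
next
  case (Suc k)
  have or: "r k \<in> seen (cop (Suc k)) \<or> r (Suc k) \<in> seen (cop (Suc k))"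
  proof (cases "quiet (hist k)")
    case True
    with Suc.prems show ?thesis
      by (auto simp: history_Suc observe_def visible_cop_iff simp del: cops.simps split: if_splits)
  qed (use Suc.IH in blast)
  define x where "x = last_seen (hist (Suc k))"
  have "x \<in> seen (cop (Suc k)) \<and> may_move G x (r (Suc k))"
    using or last_seen_Suc[of k] walk unfolding x_def robber_walk_def by (metis may_move_refl)
  then obtain c where c: "c \<in> set (cop (Suc k))" "near G l c x" and x: "may_move G x (r (Suc k))"
    by (auto simp: seen_def)
  moreover have "x \<in> pverts G" using last_seen_in_verts[OF Suc.prems] by (simp add: x_def)
  ultimately have "near G l (towards c x) (r (Suc k))"
    using near_after_step cop_legal by blast
  then show ?case using c(1) cop_alert[OF Suc.prems] unfolding x_def[symmetric]
    by (auto simp: seen_def simp del: cops.simps)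
qed

lemma alert_mono: "\<not> quiet (hist k) \<Longrightarrow> k \<le> j \<Longrightarrow> \<not> quiet (hist j)"
proof (induction j)
  case (Suc j)
  then show ?case using quiet_Suc[of j] by (cases "k = Suc j") (auto simp del: history.simps)
qed simp

text \<open>A single cop suffices: he climbs until he is an ancestor of the robber and then descends
  after him, so that his height is first decreasing and then increasing.\<close>

lemma alert_capture:
  assumes alert: "\<not> quiet (hist k0)" and "C 0 \<noteq> []"
  shows "\<exists>k. captured_by l G (pursue towards C) r k"
proof (rule ccontr)
  assume "\<not> ?thesis"
  then have free: "r j \<notin> set (cop j)" "r j \<notin> set (cop (Suc j))" for j
    unfolding captured_by_def by blast+
  have len: "length (cop j) = length (C 0)" for j
  proof (induction j)
    case (Suc j)
    have "list_all2 (may_move G) (cop j) (cop (Suc j))" using cop_legal by blast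
    with Suc show ?case by (metis list_all2_lengthD)
  qed simp
  define c where "c j = cop j ! 0" for j
  have c_in: "c j \<in> set (cop j)" for j
    unfolding c_def using len assms(2) by (simp del: cops.simps)
  then have cV: "c j \<in> pverts G" for j using cop_legal by blast
  have rV: "r j \<in> pverts G" for j using robber_walk_in_verts[OF walk] .
  have mv: "may_move G (r j) (r (Suc j))" for j using walk by (simp add: robber_walk_def)
  have ne: "c j \<noteq> r j" "c (Suc j) \<noteq> r j" for j using free[of j] c_in by metis+
  \<comment> \<open>The latest sighting may stem from before the robber's last move, so the target
    is either his present or his previous position.\<close>
  have step: "\<exists>x \<in> {r j, r (Suc j)}. c (Suc (Suc j)) = towards (c (Suc j)) x" if "j \<ge> k0" for j
  proof -
    have "\<not> quiet (hist j)" "\<not> quiet (hist (Suc j))"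
      using alert alert_mono[OF alert] that by auto
    moreover from this have "last_seen (hist (Suc j)) \<in> {r j, r (Suc j)}"
      using seen_again[of j] last_seen_Suc[of j] by blast
    ultimately show ?thesis
      using cop_alert[of "Suc j"] len assms(2) by (auto simp: c_def simp del: cops.simps)
  qed
  \<comment> \<open>A cop above the robber stays above him: the robber can leave the subtree only by
    meeting the cop, which would be a capture.\<close>
  have down: "anc (c (Suc (Suc j))) (r (Suc j)) \<and> height (c (Suc (Suc j))) = Suc (height (c (Suc j)))"
    if j: "j \<ge> k0" and a: "anc (c (Suc j)) (r j)" for j
  proof -
    obtain x where x: "x \<in> {r j, r (Suc j)}" "c (Suc (Suc j)) = towards (c (Suc j)) x"
      using step[OF j] by blast
    have "anc (c (Suc j)) (r (Suc j))" using anc_arc[OF mv rV a] ne(2)[of j] by metis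
    then have "anc (c (Suc j)) x" "c (Suc j) \<noteq> x" "x \<in> pverts G"
      using x(1) a ne(1)[of "Suc j"] ne(2)[of j] rV by auto
    note t = towards_down[OF this, folded x(2)]
    have "anc (c (Suc (Suc j))) (r (Suc j))"
    proof (cases "x = r j")
      case True
      then show ?thesis using anc_arc[OF mv rV, of "c (Suc (Suc j))" j] t ne(1)[of "Suc j"] by auto
    qed (use x t in auto)
    then show ?thesis using t height_par[OF t(1,2)] by simp
  qed
  \<comment> \<open>A cop above the robber would descend forever, but heights are bounded in a
    finite tree.\<close>
  have never: "\<not> anc (c (Suc j)) (r j)" if "j \<ge> k0" for j
  proof
    assume a: "anc (c (Suc j)) (r j)"
    have *: "anc (c (Suc (j + i))) (r (j + i)) \<and> height (c (Suc (j + i))) \<ge> i" for i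
    proof (induction i)
      case (Suc i)
      then show ?case using down[of "j + i"] that by auto
    qed (use a in auto)
    obtain H where H: "\<And>v. v \<in> pverts G \<Longrightarrow> height v \<le> H"
      using finite_imageI[OF pair_finite_verts, of height]
      by (meson finite_nat_set_iff_bounded_le image_eqI)
    show False using *[of "Suc H"] H[OF cV] by (metis not_less_eq_eq)
  qed
  \<comment> \<open>What remains is a cop who climbs in every round, and his height is
    finite.\<close>
  have up: "Suc (height (c (Suc (Suc j)))) = height (c (Suc j))" if j: "j \<ge> k0" for j
  proof -
    have "\<not> anc (c (Suc j)) (r (Suc j))"
    proof
      assume "anc (c (Suc j)) (r (Suc j))"
      then have "anc (c (Suc j)) (r j) \<or> r (Suc j) = c (Suc j)"
        using anc_arc[of "r (Suc j)" "r j"] mv[of j] rV may_move_sym by blast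
      then show False using never[OF j] ne by metis
    qed
    then have "c (Suc (Suc j)) = par (c (Suc j))"
      using step[OF j] never[OF j] towards_up by auto
    moreover have "c (Suc j) \<noteq> root" using never[OF j] anc_root rV by metis
    ultimately show ?thesis using height_par cV by metis
  qed
  have "height (c (Suc (k0 + i))) + i = height (c (Suc k0))" for i
  proof (induction i)
    case (Suc i)
    then show ?case using up[of "k0 + i"] by auto
  qed auto
  from this[of "Suc (height (c (Suc k0)))"] show False by simp
qed

end

text \<open>\<open>D k\<close> bounds the positions that a robber who has never been seen can occupy at the end of
  round \<open>k\<close>.\<close>

lemma pursue_wins:
  assumes C0: "set (C 0) \<subseteq> pverts G" "length (C 0) = n" "n \<noteq> 0"
    and legal: "\<And>k. list_all2 (may_move G) (C k) (C (Suc k))"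
    and D0: "pverts G - seen (C 0) \<subseteq> D 0"
    and DS: "\<And>k v w. v \<in> D k \<Longrightarrow> v \<notin> seen (C (Suc k)) \<Longrightarrow> may_move G v w \<Longrightarrow>
      w \<notin> seen (C (Suc k)) \<Longrightarrow> w \<in> D (Suc k)"
    and final: "D N = {}"
  shows "winning_strategy l G n (pursue towards C)"
  unfolding winning_strategy_def legal_strategy_def
proof (intro conjI allI impI)
  show "length (pursue towards C []) = n" "set (pursue towards C []) \<subseteq> pverts G"
    using C0(1,2) by simp_all
next
  fix r k assume "robber_walk G r"
  then show "list_all2 (may_move G) (cops l G (pursue towards C) r k)
      (cops l G (pursue towards C) r (Suc k))"
    using cop_legal[where C=C and r=r and k=k, OF C0(1) legal] by blast
next
  fix r assume r: "robber_walk G r"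
  note ctxt = C0(1) legal r
  show "\<exists>k. captured_by l G (pursue towards C) r k"
  proof (cases "\<forall>k. quiet (history l G (pursue towards C) r k)")
    case False
    then obtain k where "\<not> quiet (history l G (pursue towards C) r k)" by blast
    moreover have "C 0 \<noteq> []" using C0 by auto
    ultimately show ?thesis by (rule alert_capture[where C=C and r=r, OF ctxt])
  next
    case True
    have C: "cops l G (pursue towards C) r k = C k" for k
      by (rule cop_quiet'[where C=C and r=r and k=k, OF ctxt]) (use True in \<open>blast, simp\<close>)
    have vis: "visible l G (C k) v \<longleftrightarrow> v \<in> seen (C k)" for k v
      using visible_cop_iff[where C=C and r=r and k=k and v=v, OF ctxt] unfolding C .
    have unseen: "r k \<notin> seen (C k)" "r k \<notin> seen (C (Suc k))" for k
      using True[rule_format, of "Suc k"] unfolding quiet_history_iff C vis by simp_all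
    have "r k \<in> D k" for k
    proof (induction k)
      case 0
      then show ?case using D0 unseen(1)[of 0] robber_walk_in_verts[OF r] by blast
    next
      case (Suc k)
      show ?case
        by (rule DS[OF Suc unseen(2) _ unseen(1)]) (use r in \<open>simp add: robber_walk_def\<close>)
    qed
    with final show ?thesis by blast
  qed
qed

text \<open>By \<open>closed\<close>, the vertices never in sight are separated from those once seen
  by vertices now in sight. So a robber who is consistent with quiet observations stands on a vertex
  that has never been in sight. Conversely, a robber who has stood on such a vertex from the start
  produces the same quiet observations. The two facts together give the inclusion of
  territories.\<close>

lemma pursue_monotonic:
  assumes C0: "set (C 0) \<subseteq> pverts G"
    and legal: "\<And>k. list_all2 (may_move G) (C k) (C (Suc k))"
    and closed: "\<And>k v w. v \<in> pverts G - (\<Union>j\<le>k. seen (C j)) \<Longrightarrow> may_move G v w \<Longrightarrow>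
      w \<notin> seen (C k) \<Longrightarrow> w \<notin> (\<Union>j\<le>k. seen (C j))"
  shows "monotonic_strategy l G (pursue towards C)"
  unfolding monotonic_strategy_def
proof (intro allI impI subsetI; elim conjE)
  fix r k y
  let ?\<sigma> = "pursue towards C"
  assume r: "robber_walk G r" and k: "1 \<le> k" and oos: "out_of_sight l G ?\<sigma> r k"
    and "y \<in> territory l G ?\<sigma> r (Suc k)"
  then obtain r' where r': "robber_walk G r'" and y: "y = r' k"
    and info: "cop_information l G ?\<sigma> r' (Suc k) = cop_information l G ?\<sigma> r (Suc k)"
    by (auto simp: territory_def)
  note ctxt = C0 legal
  \<comment> \<open>By \<open>seen_again\<close>, a robber who had ever been seen would be in sight
    after the next move of the cops, contrary to \<open>out_of_sight\<close>.\<close>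
  have "quiet (history l G ?\<sigma> r k)"
    using seen_again[where C=C and r=r, OF ctxt r, of k] oos
      visible_cop_iff[where C=C and r=r, OF ctxt r] unfolding out_of_sight_def by blast
  moreover have "observe l G (cops l G ?\<sigma> r (Suc k)) (r k) = None"
    using oos by (simp add: out_of_sight_def observe_def)
  ultimately have quiet_info: "quiet (cop_information l G ?\<sigma> r (Suc k))"
    by (simp add: cop_information_def del: cops.simps)
  then have q': "quiet (history l G ?\<sigma> r' k)"
    unfolding info[symmetric] by (simp add: cop_information_def)
  have "cops l G ?\<sigma> r' j = C j" if "j \<le> Suc k" for j
    using cop_quiet'[where C=C and r=r', OF ctxt r' q' that] .
  moreover have "visible l G (cops l G ?\<sigma> r' j) v \<longleftrightarrow> v \<in> seen (cops l G ?\<sigma> r' j)" for j v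
    using visible_cop_iff[where C=C and r=r', OF ctxt r'] .
  ultimately have vis: "visible l G (cops l G ?\<sigma> r' j) v \<longleftrightarrow> v \<in> seen (C j)" if "j \<le> Suc k" for j v
    using that by metis
  have unseen: "r' j \<notin> seen (C j)" if "j \<le> k" for j
    using q' that vis[of j] unfolding quiet_history_iff by (metis le_SucI)
  have unseen': "r' j \<notin> seen (C (Suc j))" if "j < k" for j
    using q' that vis[of "Suc j"] unfolding quiet_history_iff by (metis Suc_leI le_SucI)
  have clean: "r' i \<in> pverts G - (\<Union>j\<le>i. seen (C j))" if "i \<le> k" for i
    using that
  proof (induction i)
    case 0
    then show ?case using unseen[of 0] robber_walk_in_verts[OF r'] by auto
  next
    case (Suc i)
    then have a: "r' i \<in> pverts G - (\<Union>j\<le>i. seen (C j))" by simp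
    have mv: "may_move G (r' i) (r' (Suc i))" using r' by (simp add: robber_walk_def)
    have "r' i \<notin> seen (C (Suc i))" "r' (Suc i) \<notin> seen (C (Suc i))"
      using unseen unseen' Suc.prems by auto
    with a have "r' i \<in> pverts G - (\<Union>j\<le>Suc i. seen (C j))" by (auto simp: le_Suc_eq)
    from closed[OF this mv] \<open>r' (Suc i) \<notin> seen (C (Suc i))\<close>
    show ?case using robber_walk_in_verts[OF r'] by blast
  qed
  txt \<open>Every vertex of the territory has never been seen, so a robber who waits there accounts
    for it.\<close>
  define s where "s = (\<lambda>_::nat. y)"
  have yV: "y \<in> pverts G" and yun: "y \<notin> seen (C j)" if "j \<le> k" for j
    using clean[of k] that y by auto
  have s: "robber_walk G s" using robber_walk_const yV[of 0] by (simp add: s_def)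
  have qs: "quiet (history l G ?\<sigma> s j)" if "j < k" for j
    using that
  proof (induction j)
    case 0
    then show ?case
      using yun[of 0] visible_cop_iff[where C=C and r=s, OF ctxt s, of 0 y]
      by (simp add: observe_def s_def)
  next
    case (Suc j)
    then have "cops l G ?\<sigma> s (Suc j) = C (Suc j)"
      using cop_quiet[where C=C and r=s, OF ctxt s] by simp
    with Suc show ?case
      using yun[of "Suc j"] visible_cop_iff[where C=C and r=s, OF ctxt s, of "Suc j" y]
      by (simp add: history_Suc observe_def s_def del: cops.simps)
  qed
  then have "cops l G ?\<sigma> s k = C k" "quiet (history l G ?\<sigma> s (k - 1))"
    using cop_quiet[where C=C and r=s, OF ctxt s, of "k - 1"] k by auto
  then have "quiet (cop_information l G ?\<sigma> s k)"
    using yun[of k] visible_cop_iff[where C=C and r=s, OF ctxt s, of k y]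
    by (simp add: cop_information_def observe_def s_def del: cops.simps)
  moreover have "quiet (cop_information l G ?\<sigma> r k)"
  proof -
    have "quiet (history l G ?\<sigma> r (Suc (k - 1)))"
      using quiet_info k by (simp add: cop_information_def)
    then show ?thesis
      using k unfolding history_Suc cop_information_def by (auto simp del: cops.simps)
  qed
  moreover have "length (cop_information l G ?\<sigma> s k) = length (cop_information l G ?\<sigma> r k)"
    by (simp add: cop_information_def)
  ultimately have "cop_information l G ?\<sigma> s k = cop_information l G ?\<sigma> r k"
    using quiet_replicate by metis
  then show "y \<in> territory l G ?\<sigma> r k"
    unfolding territory_def using s by (auto simp: s_def)
qed

end

section \<open>The cops' moves as long as they see nothing\<close>

fun quiet_cops :: "'a strategy \<Rightarrow> nat \<Rightarrow> 'a list" where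
  "quiet_cops \<sigma> 0 = \<sigma> []"
| "quiet_cops \<sigma> (Suc k) = \<sigma> (replicate (2 * k + 1) None)"

lemma quiet_history_mono:
  "quiet (history l G \<sigma> r k) \<Longrightarrow> j \<le> k \<Longrightarrow> quiet (history l G \<sigma> r j)"
  unfolding quiet_history_iff by simp

lemma cops_eq_quiet_cops:
  assumes "quiet (history l G \<sigma> r k)" "j \<le> Suc k"
  shows "cops l G \<sigma> r j = quiet_cops \<sigma> j"
proof (cases j)
  case (Suc i)
  then have "quiet (history l G \<sigma> r i)" using assms quiet_history_mono by simp
  from cops_of_quiet_history[OF this] Suc show ?thesis by (simp del: cops.simps replicate.simps)
qed simp

text \<open>This breaks the circle between moves and observations: the right-hand side mentions only
  the fixed sequence \<open>quiet_cops\<close>, against which a robber can be designed. A history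
  that is quiet so far makes \<open>cops\<close> and \<open>quiet_cops\<close> agree up to the next
  move.\<close>

lemma quiet_history_iff_unseen:
  "quiet (history l G \<sigma> r k) \<longleftrightarrow>
     (\<forall>j\<le>k. \<not> visible l G (quiet_cops \<sigma> j) (r j)) \<and>
     (\<forall>j<k. \<not> visible l G (quiet_cops \<sigma> (Suc j)) (r j))" (is "_ \<longleftrightarrow> ?unseen k")
proof (induction k)
  case 0
  then show ?case by (simp add: observe_def)
next
  case (Suc k)
  have "quiet (history l G \<sigma> r (Suc k)) \<longleftrightarrow> quiet (history l G \<sigma> r k) \<and>
      \<not> visible l G (cops l G \<sigma> r (Suc k)) (r k) \<and>
      \<not> visible l G (cops l G \<sigma> r (Suc k)) (r (Suc k))"
    unfolding history_Suc by (auto simp: observe_def simp del: cops.simps)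
  also have "\<dots> \<longleftrightarrow> quiet (history l G \<sigma> r k) \<and>
      \<not> visible l G (quiet_cops \<sigma> (Suc k)) (r k) \<and>
      \<not> visible l G (quiet_cops \<sigma> (Suc k)) (r (Suc k))"
    using cops_eq_quiet_cops[of l G \<sigma> r k "Suc k"] by (auto simp del: cops.simps quiet_cops.simps)
  also have "\<dots> \<longleftrightarrow> ?unseen (Suc k)"
    unfolding Suc.IH by (auto simp: le_Suc_eq less_Suc_eq simp del: quiet_cops.simps)
  finally show ?case .
qed

declare cops.simps(2) [simp del] quiet_cops.simps(2) [simp del]

context pair_wf_digraph
begin

lemma legal_cops:
  assumes "legal_strategy l G n \<sigma>" "robber_walk G r"
  shows "set (cops l G \<sigma> r k) \<subseteq> pverts G" "length (cops l G \<sigma> r k) = n"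
proof (induction k)
  case 0
  { case 1 show ?case using assms by (simp add: legal_strategy_def) }
  { case 2 show ?case using assms by (simp add: legal_strategy_def) }
next
  case (Suc k)
  have *: "list_all2 (may_move G) (cops l G \<sigma> r k) (cops l G \<sigma> r (Suc k))"
    using assms by (auto simp: legal_strategy_def)
  { case 1 show ?case
      using list_all2_may_move_in_verts[OF *] Suc(1) by blast }
  { case 2 show ?case using * Suc(2) by (auto dest: list_all2_lengthD) }
qed

lemma visible_self: "set C \<subseteq> pverts G \<Longrightarrow> c \<in> set C \<Longrightarrow> visible l G C c"
  by (auto simp: visible_iff_near intro: bexI[of _ c])

lemma not_captured_by_quiet:
  assumes "legal_strategy l G n \<sigma>" "robber_walk G r" "quiet (history l G \<sigma> r k)"
    and "\<not> visible l G (quiet_cops \<sigma> (Suc k)) (r k)"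
  shows "\<not> captured_by l G \<sigma> r (Suc k)"
proof
  assume "captured_by l G \<sigma> r (Suc k)"
  then obtain j where j: "j \<le> k" "r j \<in> set (cops l G \<sigma> r j) \<or> r j \<in> set (cops l G \<sigma> r (Suc j))"
    by (auto simp: captured_by_def less_Suc_eq_le)
  then have "visible l G (cops l G \<sigma> r j) (r j) \<or> visible l G (cops l G \<sigma> r (Suc j)) (r j)"
    using visible_self legal_cops(1)[OF assms(1,2)] by blast
  then have "visible l G (quiet_cops \<sigma> j) (r j) \<or> visible l G (quiet_cops \<sigma> (Suc j)) (r j)"
    using cops_eq_quiet_cops[OF assms(3)] j(1) by simp
  then show False
    using assms(3,4) j(1) unfolding quiet_history_iff_unseen by (metis le_neq_implies_less)
qed

text \<open>A robber who stays out of sight of the fixed sequence keeps every history quiet, and he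
  is never captured because a cop sees his own vertex.\<close>

lemma winning_sees:
  assumes "winning_strategy l G n \<sigma>" "robber_walk G r"
  shows "\<exists>k. visible l G (quiet_cops \<sigma> k) (r k) \<or> visible l G (quiet_cops \<sigma> (Suc k)) (r k)"
proof (rule ccontr)
  assume *: "\<not> ?thesis"
  then have "quiet (history l G \<sigma> r k)" for k unfolding quiet_history_iff_unseen by blast
  then have "\<not> captured_by l G \<sigma> r (Suc k)" for k
    using not_captured_by_quiet assms * unfolding winning_strategy_def by blast
  then have "\<not> captured_by l G \<sigma> r k" for k
    by (cases k) (auto simp: captured_by_def)
  then show False using assms unfolding winning_strategy_def by blast
qed

lemma legal_quiet_cops:
  assumes "legal_strategy l G n \<sigma>" "robber_walk G r" "quiet (history l G \<sigma> r k)"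
  shows "list_all2 (may_move G) (quiet_cops \<sigma> k) (quiet_cops \<sigma> (Suc k))"
  using assms cops_eq_quiet_cops[OF assms(3)] unfolding legal_strategy_def
  by (metis le_SucI order_refl)

lemma not_winning_0:
  assumes "v \<in> pverts G"
  shows "\<not> winning_strategy l G 0 \<sigma>"
proof
  assume w: "winning_strategy l G 0 \<sigma>"
  have r: "robber_walk G (\<lambda>_. v)" using assms by (rule robber_walk_const)
  have "cops l G \<sigma> (\<lambda>_. v) k = []" for k
    using legal_cops(2)[OF _ r, of l 0 \<sigma>] w by (simp add: winning_strategy_def)
  then show False using w r by (auto simp: winning_strategy_def captured_by_def)
qed

text \<open>The assumption \<open>evade\<close> speaks of infinite walks of the cop, while his moves
  are known to be legal only after histories that some robber produces. Legality is therefore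
  established move by move, each time with a robber who evades a truncated walk.\<close>

lemma not_winning_1:
  assumes evade: "\<And>c. (\<And>k. c k \<in> pverts G) \<Longrightarrow> (\<And>k. may_move G (c k) (c (Suc k))) \<Longrightarrow>
      \<exists>r. robber_walk G r \<and> (\<forall>k. \<not> near G l (c k) (r k) \<and> \<not> near G l (c (Suc k)) (r k))"
  shows "\<not> winning_strategy l G 1 \<sigma>"
proof
  assume w: "winning_strategy l G 1 \<sigma>"
  then have legal: "legal_strategy l G 1 \<sigma>" by (simp add: winning_strategy_def)
  define q where "q k = hd (quiet_cops \<sigma> k)" for k
  have q: "quiet_cops \<sigma> j = [q j] \<and> q j \<in> pverts G"
    if "\<And>j. j < k \<Longrightarrow> list_all2 (may_move G) (quiet_cops \<sigma> j) (quiet_cops \<sigma> (Suc j))" "j \<le> k"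
    for j k
    using that(2)
  proof (induction j)
    case 0
    have "length (\<sigma> []) = 1" "set (\<sigma> []) \<subseteq> pverts G" using legal by (auto simp: legal_strategy_def)
    then show ?case by (cases "\<sigma> []") (auto simp: q_def)
  next
    case (Suc j)
    then have "list_all2 (may_move G) [q j] (quiet_cops \<sigma> (Suc j))" "q j \<in> pverts G"
      using that(1)[of j] by auto
    then show ?case by (auto simp: q_def list_all2_Cons1 intro: may_move_in_verts)
  qed
  have vis: "visible l G [c] v \<longleftrightarrow> near G l c v" if "c \<in> pverts G" for c v
    using visible_iff_near[of "[c]"] that by simp
  have lg: "\<forall>j<k. list_all2 (may_move G) (quiet_cops \<sigma> j) (quiet_cops \<sigma> (Suc j))" for k
  proof (induction k)
    case (Suc k)
    then have qk: "quiet_cops \<sigma> j = [q j]" "q j \<in> pverts G" if "j \<le> k" for j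
      using q[of k j] that by blast+
    \<comment> \<open>The cop is frozen after move \<open>k\<close>. The robber who evades this walk
      keeps the history quiet up to round \<open>k\<close> and thereby certifies move
      \<open>k + 1\<close>.\<close>
    define c where "c j = q (min j k)" for j
    have "c j \<in> pverts G" for j using qk by (simp add: c_def)
    moreover have "may_move G (c j) (c (Suc j))" for j
    proof (cases "j < k")
      case True
      with Suc have "list_all2 (may_move G) (quiet_cops \<sigma> j) (quiet_cops \<sigma> (Suc j))" by blast
      with True show ?thesis using qk(1)[of j] qk(1)[of "Suc j"] by (simp add: c_def)
    qed (simp add: c_def)
    ultimately obtain r where r: "robber_walk G r"
      "\<And>j. \<not> near G l (c j) (r j) \<and> \<not> near G l (c (Suc j)) (r j)"
      using evade[of c] by blast
    have "quiet (history l G \<sigma> r k)"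
      unfolding quiet_history_iff_unseen
    proof (intro conjI allI impI)
      fix j assume "j \<le> k"
      then show "\<not> visible l G (quiet_cops \<sigma> j) (r j)"
        using r(2)[of j] qk[of j] vis by (simp add: c_def min_def)
    next
      fix j assume "j < k"
      then show "\<not> visible l G (quiet_cops \<sigma> (Suc j)) (r j)"
        using r(2)[of j] qk[of "Suc j"] vis by (simp add: c_def min_def)
    qed
    from legal_quiet_cops[OF legal r(1) this] Suc show ?case by (auto simp: less_Suc_eq)
  qed simp
  have qk: "quiet_cops \<sigma> k = [q k]" "q k \<in> pverts G" for k using q[of k k] lg by blast+
  have "may_move G (q k) (q (Suc k))" for k using lg[of "Suc k"] qk by auto
  then obtain r where r: "robber_walk G r"
      "\<And>j. \<not> near G l (q j) (r j) \<and> \<not> near G l (q (Suc j)) (r j)"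
    using evade[of q] qk by blast
  then show False using winning_sees[OF w r(1)] qk vis by auto
qed

section \<open>Winning monotonic strategies as long as nothing is seen\<close>

context
  fixes l n :: nat and \<sigma> :: "'a strategy"
  assumes win: "winning_strategy l G n \<sigma>" and mono: "monotonic_strategy l G \<sigma>"
begin

lemma eventually_visible:
  assumes "v \<in> pverts G"
  shows "\<exists>k. visible l G (quiet_cops \<sigma> k) v"
  using winning_sees[OF win robber_walk_const[OF assms]] by blast

lemma legal_while_unseen:
  assumes "v \<in> pverts G" "\<And>j. j \<le> k \<Longrightarrow> \<not> visible l G (quiet_cops \<sigma> j) v"
  shows "list_all2 (may_move G) (quiet_cops \<sigma> k) (quiet_cops \<sigma> (Suc k))"
proof (rule legal_quiet_cops[OF _ robber_walk_const[OF assms(1)]])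
  show "legal_strategy l G n \<sigma>" using win by (simp add: winning_strategy_def)
  show "quiet (history l G \<sigma> (\<lambda>_. v) k)" using assms(2) unfolding quiet_history_iff_unseen by simp
qed

text \<open>Monotonicity puts \<open>r (Suc k)\<close> into the preceding territory, so some other
  walk with equally quiet observations was there one round earlier. The induction hypothesis is
  applied to that walk, as \<open>r\<close> itself may only just have arrived.\<close>

lemma monotonic_unseen:
  assumes "robber_walk G r" "quiet (history l G \<sigma> r k)"
    and "\<not> visible l G (quiet_cops \<sigma> (Suc k)) (r k)"
    and "j \<le> Suc k"
  shows "\<not> visible l G (quiet_cops \<sigma> j) (r k)"
  using assms
proof (induction k arbitrary: r j)
  case 0
  then show ?case by (cases "j = 0") (auto simp: observe_def le_Suc_eq split: if_splits)
next
  case (Suc k)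
  note cq = cops_eq_quiet_cops[OF Suc.prems(2)]
  have legal: "legal_strategy l G n \<sigma>" using win by (simp add: winning_strategy_def)
  have "out_of_sight l G \<sigma> r (Suc k)"
    using Suc.prems(2,3) unfolding out_of_sight_def quiet_history_iff_unseen by (simp add: cq)
  then have "territory l G \<sigma> r (Suc (Suc k)) \<subseteq> territory l G \<sigma> r (Suc k)"
    using mono not_captured_by_quiet[OF legal Suc.prems(1-3)] Suc.prems(1)
    unfolding monotonic_strategy_def by simp
  moreover have "r (Suc k) \<in> territory l G \<sigma> r (Suc (Suc k))"
    unfolding territory_def using Suc.prems(1) by force
  ultimately obtain r' where r': "robber_walk G r'" "r' k = r (Suc k)"
    "cop_information l G \<sigma> r' (Suc k) = cop_information l G \<sigma> r (Suc k)"
    by (auto simp: territory_def)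
  have "quiet (history l G \<sigma> r (Suc k))" by fact
  then have "quiet (cop_information l G \<sigma> r (Suc k))"
    unfolding cop_information_def history_Suc by auto
  then have "quiet (cop_information l G \<sigma> r' (Suc k))" by (simp add: r'(3))
  then have q: "quiet (history l G \<sigma> r' k)" and "\<not> visible l G (cops l G \<sigma> r' (Suc k)) (r' k)"
    by (auto simp: cop_information_def observe_def split: if_splits)
  then have "\<not> visible l G (quiet_cops \<sigma> (Suc k)) (r' k)"
    using cops_eq_quiet_cops[OF q, of "Suc k"] by simp
  then show ?case
    using Suc.IH[OF r'(1) q] Suc.prems(3,4) r'(2) by (metis le_Suc_eq)
qed

text \<open>A robber waits at the unseen \<open>w\<close> and steps to \<open>v\<close> in round
  \<open>k\<close>. If neither of the two cop positions saw him at \<open>v\<close>, he would still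
  be unseen, and \<open>monotonic_unseen\<close> would contradict the sighting of \<open>v\<close>
  at time \<open>i\<close>. The second alternative reflects that a vertex may be brought back into
  view by the very next move.\<close>

lemma boundary_visible:
  assumes "(w, v) \<in> parcs G" "\<And>j. j \<le> k \<Longrightarrow> \<not> visible l G (quiet_cops \<sigma> j) w"
    and "i \<le> k" "visible l G (quiet_cops \<sigma> i) v"
  shows "visible l G (quiet_cops \<sigma> k) v \<or> visible l G (quiet_cops \<sigma> (Suc k)) v"
proof (rule ccontr)
  assume *: "\<not> ?thesis"
  define r where "r i = (if i < k then w else v)" for i
  have "robber_walk G r"
    using assms(1) by (auto simp: robber_walk_def r_def may_move_def dest: in_arcsD1 in_arcsD2)
  moreover have "quiet (history l G \<sigma> r k)"
    unfolding quiet_history_iff_unseen using * assms(2) by (auto simp: r_def)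
  moreover have "r k = v" by (simp add: r_def)
  ultimately show False using monotonic_unseen[of r k i] * assms(3,4) by simp
qed

end

end

section \<open>The subdivided tree\<close>

locale subdivided =
  fixes l :: nat
  assumes l_ge_1: "1 \<le> l"
begin

abbreviation T :: "bool list sd_vertex pair_pre_digraph" where "T \<equiv> subdivided_tree l"
definition L :: nat where "L = 2 * l + 2"
definition pt :: "bool \<Rightarrow> bool list \<Rightarrow> nat \<Rightarrow> bool list sd_vertex" where
  "pt b xs i = sd_point (2 * l + 1) (xs, b # xs) i"

lemma pt_conv:
  "pt b xs i = (if i = 0 then Original xs else if i = L then Original (b # xs)
     else Inner (xs, b # xs) i)"
  by (simp add: pt_def sd_point_def L_def)

lemma L_gt: "2 * l + 1 < L"
  by (simp add: L_def)

fun parent :: "bool list sd_vertex \<Rightarrow> bool list sd_vertex" where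
  "parent (Original []) = Original []"
| "parent (Original (b # xs)) = Inner (xs, b # xs) (L - 1)"
| "parent (Inner e i) = (if i = 1 then Original (fst e) else Inner e (i - 1))"

fun level :: "bool list sd_vertex \<Rightarrow> nat" where
  "level (Original xs) = L * length xs"
| "level (Inner e i) = L * length (fst e) + i"

lemma pt_0 [simp]: "pt b xs 0 = Original xs"
  and pt_L [simp]: "pt b xs L = Original (b # xs)"
  by (simp_all add: pt_conv L_def)

lemma parent_pt: "i < L \<Longrightarrow> parent (pt b xs (Suc i)) = pt b xs i"
  using L_gt by (auto simp: pt_conv)

lemma level_pt: "i \<le> L \<Longrightarrow> level (pt b xs i) = L * length xs + i"
  by (auto simp: pt_conv)

lemma Original_in_verts: "Original xs \<in> pverts T \<longleftrightarrow> length xs \<le> 3"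
  by (auto simp: subdivided_tree_def subdivide_edges_def perfect_binary_tree_def Let_def)

lemma Inner_in_verts:
  "Inner e i \<in> pverts T \<longleftrightarrow> (\<exists>b xs. e = (xs, b # xs) \<and> length xs < 3 \<and> 1 \<le> i \<and> i < L)"
  unfolding subdivided_tree_def subdivide_edges_def perfect_binary_tree_def Let_def L_def
  by force

lemma pt_in_verts: "length xs < 3 \<Longrightarrow> i \<le> L \<Longrightarrow> pt b xs i \<in> pverts T"
  by (simp add: pt_conv Original_in_verts Inner_in_verts)

lemma verts_cases:
  assumes "v \<in> pverts T" "v \<noteq> Original []"
  obtains b xs i where "length xs < 3" "i < L" "v = pt b xs (Suc i)"
proof (cases v)
  case (Original xs)
  with assms obtain b ys where "xs = b # ys" by (cases xs) auto
  with Original assms that[of ys "L - 1" b] show ?thesis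
    by (auto simp: pt_conv Original_in_verts L_def)
next
  case (Inner e i)
  with assms obtain b xs where "e = (xs, b # xs)" "length xs < 3" "1 \<le> i" "i < L"
    by (auto simp: Inner_in_verts)
  with Inner that[of xs "i - 1" b] show ?thesis by (simp add: pt_conv)
qed

lemma arcs_iff:
  "(u, v) \<in> parcs T \<longleftrightarrow> (\<exists>b xs i. length xs < 3 \<and> i < L \<and>
     (u = pt b xs i \<and> v = pt b xs (Suc i) \<or> v = pt b xs i \<and> u = pt b xs (Suc i)))"
proof -
  let ?A = "{(sd_point (2 * l + 1) e i, sd_point (2 * l + 1) e (Suc i)) | e i.
      e \<in> parcs (perfect_binary_tree 3) \<and> i \<le> 2 * l + 1}"
  have A: "p \<in> ?A \<longleftrightarrow> (\<exists>b xs i. length xs < 3 \<and> i < L \<and> p = (pt b xs i, pt b xs (Suc i)))" for p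
  proof
    assume "p \<in> ?A"
    then obtain b xs i where "p = (pt b xs i, pt b xs (Suc i))" "length xs < 3" "i \<le> 2 * l + 1"
      unfolding pt_def perfect_binary_tree_def by auto
    moreover from this have "i < L" by (simp add: L_def)
    ultimately show "\<exists>b xs i. length xs < 3 \<and> i < L \<and> p = (pt b xs i, pt b xs (Suc i))" by blast
  next
    assume "\<exists>b xs i. length xs < 3 \<and> i < L \<and> p = (pt b xs i, pt b xs (Suc i))"
    then obtain b xs i where "p = (pt b xs i, pt b xs (Suc i))" "length xs < 3" "i < L" by blast
    moreover from this have "(xs, b # xs) \<in> parcs (perfect_binary_tree 3)" "i \<le> 2 * l + 1"
      by (auto simp: perfect_binary_tree_def L_def)
    ultimately show "p \<in> ?A" unfolding pt_def by blast
  qed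
  have "(u, v) \<in> parcs T \<longleftrightarrow> (u, v) \<in> ?A \<or> (v, u) \<in> ?A"
    unfolding subdivided_tree_def subdivide_edges_def Let_def by simp
  then show ?thesis unfolding A Pair_inject by blast
qed

lemma pt_Suc_neq_root: "pt b xs (Suc i) \<noteq> Original []"
  by (simp add: pt_conv)

lemma rooted_tree: "rooted_tree T parent level (Original [])"
proof -
  interpret pair_graph T by (rule pair_graph_subdivided_tree)
  show ?thesis
  proof
    fix v assume v: "v \<in> pverts T"
    { assume "v \<noteq> Original []"
      with v obtain b xs i where v: "length xs < 3" "i < L" "v = pt b xs (Suc i)"
        by (elim verts_cases)
      then show "Suc (level (parent v)) = level v" by (simp add: parent_pt level_pt) }
    show "parent v \<in> pverts T"
      using v by (cases "v = Original []")
        (auto simp: Original_in_verts parent_pt pt_in_verts elim!: verts_cases)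
  next
    fix u v
    show "(u, v) \<in> parcs T \<longleftrightarrow> u \<in> pverts T \<and> v \<in> pverts T \<and>
      (v \<noteq> Original [] \<and> u = parent v \<or> u \<noteq> Original [] \<and> v = parent u)" (is "_ \<longleftrightarrow> ?R")
    proof
      assume a: "(u, v) \<in> parcs T"
      then show ?R using arcs_iff[of u v] in_arcsD1[OF a] in_arcsD2[OF a] pt_Suc_neq_root
        by (auto simp: parent_pt)
    next
      assume ?R
      then show "(u, v) \<in> parcs T" unfolding arcs_iff by (metis parent_pt verts_cases)
    qed
  qed (auto simp: Original_in_verts)
qed

sublocale sighted_tree T parent level "Original []" l
proof -
  interpret rooted_tree T parent level "Original []" by (rule rooted_tree)
  show "sighted_tree T parent level (Original []) l"
    by unfold_locales (rule l_ge_1)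
qed

lemma may_move_pt_Suc:
  "length xs < 3 \<Longrightarrow> i < L \<Longrightarrow> may_move T (pt b xs i) (pt b xs (Suc i))"
  unfolding may_move_def arcs_iff by blast

lemma near_pt_le:
  assumes "length xs < 3" "i \<le> j" "j \<le> L" "j - i \<le> n"
  shows "near T n (pt b xs i) (pt b xs j)"
proof -
  have "near T (j - i) (pt b xs (i + 0)) (pt b xs (i + (j - i)))"
    by (rule near_walk[where p = "\<lambda>d. pt b xs (i + d)"]) (use assms may_move_pt_Suc in auto)
  then show ?thesis using assms near_mono by fastforce
qed

lemma near_pt:
  assumes "length xs < 3" "i \<le> L" "j \<le> L" "i \<le> j + n" "j \<le> i + n"
  shows "near T n (pt b xs i) (pt b xs j)"
proof (cases "i \<le> j")
  case False
  then have "near T n (pt b xs j) (pt b xs i)" using assms by (intro near_pt_le) auto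
  then show ?thesis by (rule near_sym)
qed (use assms near_pt_le in auto)

text \<open>Linear interpolation of \<open>L * \<psi>\<close> along the subdivided edges. The factor
  \<open>L\<close> makes the slope on an edge the difference of \<open>\<psi>\<close> at its ends,
  so integer labels that differ by at most 1 along each original edge give a function that changes
  by at most 1 along each arc.\<close>

fun interp :: "(bool list \<Rightarrow> int) \<Rightarrow> bool list sd_vertex \<Rightarrow> int" where
  "interp \<psi> (Original xs) = int L * \<psi> xs"
| "interp \<psi> (Inner e i) = int L * \<psi> (fst e) + int i * (\<psi> (snd e) - \<psi> (fst e))"

lemma interp_pt:
  "i \<le> L \<Longrightarrow> interp \<psi> (pt b xs i) = int L * \<psi> xs + int i * (\<psi> (b # xs) - \<psi> xs)"
  by (auto simp: pt_conv algebra_simps)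

lemma interp_lipschitz:
  assumes "\<And>b xs. length xs < 3 \<Longrightarrow> \<bar>\<psi> (b # xs) - \<psi> xs\<bar> \<le> 1" "(u, v) \<in> parcs T"
  shows "\<bar>interp \<psi> u - interp \<psi> v\<bar> \<le> 1"
proof -
  from assms(2) obtain b xs i where "length xs < 3" "i < L" and
    uv: "u = pt b xs i \<and> v = pt b xs (Suc i) \<or> v = pt b xs i \<and> u = pt b xs (Suc i)"
    unfolding arcs_iff by blast
  then have "interp \<psi> (pt b xs (Suc i)) - interp \<psi> (pt b xs i) = \<psi> (b # xs) - \<psi> xs"
    by (subst (1 2) interp_pt) (auto simp: algebra_simps)
  with uv \<open>length xs < 3\<close> show ?thesis using assms(1)[of xs b] by auto
qed

lemma interp_near:
  assumes "\<And>b xs. length xs < 3 \<Longrightarrow> \<bar>\<psi> (b # xs) - \<psi> xs\<bar> \<le> 1" "near T n u v"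
  shows "\<bar>interp \<psi> u - interp \<psi> v\<bar> \<le> int n"
  using near_lipschitz[OF assms(2)] interp_lipschitz[OF assms(1)] by blast

lemma interp_may_move:
  assumes "\<And>b xs. length xs < 3 \<Longrightarrow> \<bar>\<psi> (b # xs) - \<psi> xs\<bar> \<le> 1" "may_move T u v"
  shows "\<bar>interp \<psi> u - interp \<psi> v\<bar> \<le> 1"
  using interp_lipschitz[OF assms(1)] assms(2) by (auto simp: may_move_def)

end

section \<open>One cop does not suffice\<close>

text \<open>Here \<open>d k\<close> is the leg in which the cop is deep at time \<open>k\<close>, if
  any, and \<open>m k\<close> is the robber's leg. The robber looks ahead: \<open>nxt k\<close> is
  the first leg that occurs in \<open>d\<close> from time \<open>k\<close> on, and the invariant is
  that \<open>m k\<close> differs from it. A leg is chosen anew only when \<open>d k\<close> or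
  \<open>d (Suc k)\<close> is defined, and then one of the three legs is neither \<open>d k\<close>
  nor the upcoming one.\<close>

lemma avoid_neighbouring_values:
  fixes d :: "nat \<Rightarrow> bool option option"
  assumes "\<And>k x y. d k = Some x \<Longrightarrow> d (Suc k) = Some y \<Longrightarrow> x = y"
  shows "\<exists>m. \<forall>k. d k \<noteq> Some (m k) \<and> d (Suc k) \<noteq> Some (m k) \<and> d k \<noteq> Some (m (Suc k)) \<and>
    (d k = None \<longrightarrow> d (Suc k) = None \<longrightarrow> m (Suc k) = m k)"
proof -
  define nxt where "nxt k = (if \<exists>j. d (k + j) \<noteq> None then d (k + (LEAST j. d (k + j) \<noteq> None)) else None)"
    for k
  have nxt: "nxt k = (if d k = None then nxt (Suc k) else d k)" for k
  proof (cases "d k = None")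
    case True
    show ?thesis
    proof (cases "\<exists>j. d (k + j) \<noteq> None")
      case ex: True
      then obtain j where j: "d (k + j) \<noteq> None" by blast
      have "(LEAST j. d (k + j) \<noteq> None) = Suc (LEAST j. d (k + Suc j) \<noteq> None)"
        by (rule Least_Suc[where P = "\<lambda>j. d (k + j) \<noteq> None", OF j]) (use True in simp)
      moreover have "\<exists>j. d (k + Suc j) \<noteq> None" using j True by (cases j) auto
      ultimately show ?thesis using ex True by (auto simp: nxt_def)
    next
      case False
      then have "d (Suc k + j) = None" for j by (metis add_Suc_shift)
      with False True show ?thesis by (simp add: nxt_def)
    qed
  next
    case False
    then have "\<exists>j. d (k + j) \<noteq> None" by (intro exI[of _ 0]) simp
    moreover have "(LEAST j. d (k + j) \<noteq> None) = 0" by (rule Least_eq_0) (use False in simp)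
    ultimately have "nxt k = d k" by (simp add: nxt_def)
    then show ?thesis using False by auto
  qed
  have third: "\<exists>y. x \<noteq> Some y \<and> z \<noteq> Some y" for x z :: "bool option option"
  proof -
    have "\<exists>y :: bool option. y \<noteq> p \<and> y \<noteq> q" for p q
      by (metis (full_types) option.distinct(1) option.inject)
    then obtain y where "y \<noteq> the x" "y \<noteq> the z" by blast
    then show ?thesis by (intro exI[of _ y]) auto
  qed
  have "\<exists>m. \<forall>k. nxt k \<noteq> Some (m k) \<and>
      (d k \<noteq> Some (m (Suc k)) \<and> (d k = None \<longrightarrow> d (Suc k) = None \<longrightarrow> m (Suc k) = m k))"
  proof (rule dependent_nat_choice)
    show "\<exists>x. nxt 0 \<noteq> Some x" using third by blast
  next
    fix x k assume x: "nxt k \<noteq> Some x"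
    show "\<exists>y. nxt (Suc k) \<noteq> Some y \<and>
        (d k \<noteq> Some y \<and> (d k = None \<longrightarrow> d (Suc k) = None \<longrightarrow> y = x))"
    proof (cases "d k = None \<and> d (Suc k) = None")
      case True
      with x show ?thesis using nxt[of k] by (intro exI[of _ x]) auto
    next
      case False
      then show ?thesis using third[of "nxt (Suc k)" "d k"] by blast
    qed
  qed
  then obtain m where m: "\<And>k. nxt k \<noteq> Some (m k)" "\<And>k. d k \<noteq> Some (m (Suc k))"
      "\<And>k. d k = None \<Longrightarrow> d (Suc k) = None \<Longrightarrow> m (Suc k) = m k"
    by blast
  have a: "d k \<noteq> Some (m k)" for k using m(1)[of k] nxt[of k] by (auto split: if_splits)
  have "d (Suc k) \<noteq> Some (m k)" for k
  proof (cases "d k")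
    case None
    then show ?thesis using m(1)[of k] nxt[of k] nxt[of "Suc k"] by (auto split: if_splits)
  next
    case (Some x)
    then show ?thesis using assms[of k x] a[of k] by auto
  qed
  with a m(2,3) show ?thesis by blast
qed

context subdivided
begin

text \<open>The three legs of the spider with centre \<open>Original (b # xs)\<close>, parametrised by the distance
  from the centre; \<open>None\<close> stands for the leg towards the root.\<close>

fun leg :: "bool \<Rightarrow> bool list \<Rightarrow> bool option \<Rightarrow> nat \<Rightarrow> bool list sd_vertex" where
  "leg b xs None d = pt b xs (L - d)"
| "leg b xs (Some c) d = pt c (b # xs) d"

text \<open>The labels of a signed coordinate: distance from the centre on leg \<open>m\<close>,
  minus that distance on the two other legs, continued as a constant beyond the spider.\<close>

fun leg_sign :: "bool \<Rightarrow> bool list \<Rightarrow> bool option \<Rightarrow> bool list \<Rightarrow> int" where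
  "leg_sign b xs None ys = (if ys = b # xs then 0 else if tl ys = b # xs then -1 else 1)"
| "leg_sign b xs (Some c) ys = (if ys = b # xs then 0 else if ys = c # b # xs then 1 else -1)"

abbreviation coord :: "bool \<Rightarrow> bool list \<Rightarrow> bool option \<Rightarrow> bool list sd_vertex \<Rightarrow> int" where
  "coord b xs m \<equiv> interp (leg_sign b xs m)"

lemma leg_sign_lipschitz:
  assumes "length xs = 1" "length ys < 3"
  shows "\<bar>leg_sign b xs m (c # ys) - leg_sign b xs m ys\<bar> \<le> 1"
  using assms by (cases m; cases ys) auto

lemma leg_0: "leg b xs m 0 = Original (b # xs)"
  by (cases m) simp_all

lemma leg_in_verts: "length xs = 1 \<Longrightarrow> d \<le> L \<Longrightarrow> leg b xs m d \<in> pverts T"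
  by (cases m) (simp_all add: pt_in_verts)

lemma leg_may_move:
  assumes "length xs = 1" "d \<le> L" "d' \<le> L" "d \<le> Suc d'" "d' \<le> Suc d"
  shows "may_move T (leg b xs m d) (leg b xs m d')"
proof -
  have "near T 1 (leg b xs m d) (leg b xs m d')"
    using assms by (cases m) (auto intro!: near_pt)
  then show ?thesis by (simp add: near_Suc)
qed

lemma coord_leg:
  assumes "length xs = 1" "d \<le> L"
  shows "coord b xs m (leg b xs m d) = int d"
proof (cases m)
  case None
  have "tl xs \<noteq> b # xs" using assms by (cases xs) auto
  then show ?thesis using None assms by (simp add: interp_pt of_nat_diff)
next
  case (Some c)
  then show ?thesis using assms by (simp add: interp_pt)
qed

text \<open>A positive coordinate means lying on leg \<open>j\<close> or beyond its end, where the
  other two coordinates are the negative of it. In particular, the cop is deep in at most one leg at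
  a time.\<close>

lemma coord_uminus:
  assumes "length xs = 1" "v \<in> pverts T" "j \<noteq> m" "coord b xs j v \<ge> 1"
  shows "coord b xs m v = - coord b xs j v"
proof (cases "v = Original []")
  case True
  then show ?thesis using assms by (cases j; cases m) (auto split: if_splits)
next
  case False
  then obtain c ys i where v: "length ys < 3" "i < L" "v = pt c ys (Suc i)"
    using assms verts_cases by blast
  have co: "coord b xs k v =
      int L * leg_sign b xs k ys + int (Suc i) * (leg_sign b xs k (c # ys) - leg_sign b xs k ys)" for k
    using v by (simp only: v(3)) (rule interp_pt, simp)
  consider (leaf) "ys = b # xs" | (up) "ys = xs" "c = b" | (other) "ys \<noteq> b # xs" "c # ys \<noteq> b # xs"
    by auto
  then show ?thesis
  proof cases
    case leaf
    then show ?thesis using assms(3,4) unfolding co by (cases j; cases m) (auto split: if_splits)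
  next
    case up
    moreover have "tl xs \<noteq> b # xs" "xs \<noteq> d # b # xs" for d using assms(1) by (cases xs; simp)+
    ultimately show ?thesis using assms(3,4) v(2) unfolding co
      by (cases j; cases m) (auto split: if_splits simp: algebra_simps)
  next
    case other
    have "tl ys \<noteq> b # xs" "ys \<noteq> d # b # xs" for d using v(1) assms(1) by (cases ys; auto)+
    with other show ?thesis using assms(3,4) unfolding co
      by (cases j; cases m) (auto split: if_splits)
  qed
qed

text \<open>The robber hides in a leg that is neither the one that the cop has last entered to depth
  \<open>l + 2\<close> nor the one that he is going to enter to that depth next, and there he mirrors the cop's
  moves at distance \<open>l + 2\<close>. Whenever the cop is so deep inside a leg, the robber is at the centre
  and free to change to another leg.\<close>

lemma evade_one_cop:
  assumes cV: "\<And>k. c k \<in> pverts T" and mv: "\<And>k. may_move T (c k) (c (Suc k))"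
  shows "\<exists>r. robber_walk T r \<and> (\<forall>k. \<not> near T l (c k) (r k) \<and> \<not> near T l (c (Suc k)) (r k))"
proof -
  define xs where "xs = [True]"
  have xs: "length xs = 1" by (simp add: xs_def)
  define s where "s m k = coord True xs m (c k)" for m k
  have s_step: "\<bar>s m k - s m (Suc k)\<bar> \<le> 1" for m k
    unfolding s_def by (rule interp_may_move) (use leg_sign_lipschitz[OF xs] mv in auto)
  have s_neg: "s m k = - s j k" if "j \<noteq> m" "s j k \<ge> 1" for j m k
    using coord_uminus[OF xs cV that[unfolded s_def]] by (simp add: s_def)
  define d where "d k = (if \<exists>j. s j k \<ge> int l + 2 then Some (SOME j. s j k \<ge> int l + 2) else None)" for k
  have dS: "d k = Some j \<longleftrightarrow> s j k \<ge> int l + 2" for k j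
  proof
    assume "d k = Some j"
    then have "\<exists>j. s j k \<ge> int l + 2" "j = (SOME j. s j k \<ge> int l + 2)"
      by (auto simp: d_def split: if_splits)
    then show "s j k \<ge> int l + 2" using someI_ex[of "\<lambda>j. s j k \<ge> int l + 2"] by blast
  next
    assume j: "s j k \<ge> int l + 2"
    then have "s (SOME j. s j k \<ge> int l + 2) k \<ge> int l + 2" by (rule someI)
    moreover from this j have "(SOME j. s j k \<ge> int l + 2) = j"
      using s_neg[of j "SOME j. s j k \<ge> int l + 2" k] by force
    ultimately show "d k = Some j" using j by (auto simp: d_def)
  qed
  have dN: "d k = None \<longleftrightarrow> (\<forall>j. s j k < int l + 2)" for k
    using dS[of k] by (metis linorder_not_less not_None_eq)
  have agree: "x = y" if "d k = Some x" "d (Suc k) = Some y" for k x y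
  proof (rule ccontr)
    assume "x \<noteq> y"
    have "s x k \<ge> int l + 2" "s y (Suc k) \<ge> int l + 2" using that dS by auto
    then show False using s_step[of x k] s_neg[of y x "Suc k"] \<open>x \<noteq> y\<close> by auto
  qed
  obtain m where
    m: "\<And>k. d k \<noteq> Some (m k)" "\<And>k. d (Suc k) \<noteq> Some (m k)" "\<And>k. d k \<noteq> Some (m (Suc k))"
      "\<And>k. d k = None \<Longrightarrow> d (Suc k) = None \<Longrightarrow> m (Suc k) = m k"
    using avoid_neighbouring_values[of d] agree by blast
  \<comment> \<open>The robber's depth is the cop's coordinate on the robber's leg shifted by
    \<open>l + 2\<close> and cut off to the range from 0 to \<open>L\<close>. A shift of
    \<open>l + 2\<close> leaves distance \<open>l + 1\<close> after the cop's next move. If the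
    depth is cut off at \<open>L\<close>, the choice of \<open>m\<close> still keeps the cop at
    coordinate at most \<open>l + 1\<close>; if it is cut off at 0, the cop is at
    \<open>- (l + 2)\<close> or below.\<close>
  define g where "g j k = nat (min (int L) (int l + 2 + s j k))" for j k
  have gL: "g j k \<le> L" for j k by (simp add: g_def)
  define r where "r k = leg True xs (m k) (g (m k) k)" for k
  have "may_move T (r k) (r (Suc k))" for k
  proof (cases "d k = None \<and> d (Suc k) = None")
    case True
    have "g (m k) k \<le> Suc (g (m k) (Suc k))" "g (m k) (Suc k) \<le> Suc (g (m k) k)"
      using s_step[of "m k" k] unfolding g_def by (auto simp: min_def)
    then show ?thesis unfolding r_def using True m(4) leg_may_move[OF xs] gL by simp
  next
    case False
    then obtain z where z: "d k = Some z \<or> d (Suc k) = Some z" by auto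
    then have ne: "z \<noteq> m k" "z \<noteq> m (Suc k)" using m(1-3) by metis+
    \<comment> \<open>The cop is deep in leg \<open>z\<close> at one of the two times. Then the
      robber is at the centre at that time and at most one step from it at the other, so he may
      change legs.\<close>
    have "s z k \<ge> int l + 1" "s z (Suc k) \<ge> int l + 1"
      "s z k \<ge> int l + 2 \<or> s z (Suc k) \<ge> int l + 2"
      using z s_step[of z k] unfolding dS by linarith+
    moreover from this have "s (m k) k = - s z k" "s (m (Suc k)) (Suc k) = - s z (Suc k)"
      using s_neg ne by auto
    ultimately have "g (m k) k \<le> 1" "g (m (Suc k)) (Suc k) \<le> 1"
      "g (m k) k = 0 \<or> g (m (Suc k)) (Suc k) = 0"
      unfolding g_def by auto
    then show ?thesis unfolding r_def
      using leg_may_move[OF xs, of "g (m k) k" 0] leg_may_move[OF xs, of 0 "g (m (Suc k)) (Suc k)"]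
        gL leg_0 by (metis One_nat_def le_0_eq le_SucI zero_le)
  qed
  moreover have "r k \<in> pverts T" for k unfolding r_def using leg_in_verts[OF xs gL] .
  ultimately have "robber_walk T r" by (simp add: robber_walk_def)
  moreover have "\<not> near T l (c j) (r k)" if j: "j = k \<or> j = Suc k" for j k
  proof
    assume near: "near T l (c j) (r k)"
    have "\<bar>coord True xs (m k) (c j) - coord True xs (m k) (r k)\<bar> \<le> int l"
      by (rule interp_near[OF _ near]) (rule leg_sign_lipschitz[OF xs])
    then have "\<bar>s (m k) j - int (g (m k) k)\<bar> \<le> int l"
      using coord_leg[OF xs gL] by (simp add: s_def r_def)
    moreover have "s (m k) j \<le> int l + 1" using m(1,2)[of k] j dS by force
    moreover have "\<bar>s (m k) k - s (m k) j\<bar> \<le> 1" using j s_step[of "m k" k] by auto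
    ultimately show False unfolding g_def L_def using l_ge_1 by (auto simp: min_def split: if_splits)
  qed
  ultimately show ?thesis by blast
qed

lemma cop_number_lower: "winning_strategy l T n \<sigma> \<Longrightarrow> 2 \<le> n"
  using not_winning_0[OF root_in_verts] not_winning_1[OF evade_one_cop]
  by (metis One_nat_def less_2_cases not_less)

end

section \<open>Two cops do not suffice monotonically\<close>

context subdivided
begin

abbreviation tip :: "bool list \<Rightarrow> bool \<Rightarrow> bool list sd_vertex" where
  "tip u d \<equiv> Original (d # u)"

text \<open>The depth inside the leg that ends in \<open>tip u d\<close>, and the distance from the spider below \<open>u\<close>,
  the latter truncated at \<open>L\<close>.\<close>

definition dep :: "bool list \<Rightarrow> bool \<Rightarrow> bool list sd_vertex \<Rightarrow> int" where
  "dep u d = interp (\<lambda>ys. if ys = d # u then 1 else 0)"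

definition far :: "bool list \<Rightarrow> bool list sd_vertex \<Rightarrow> int" where
  "far u = interp (\<lambda>ys. if ys = u \<or> tl ys = u then 0 else 1)"

lemma dep_near: "near T n v w \<Longrightarrow> \<bar>dep u d v - dep u d w\<bar> \<le> int n"
  unfolding dep_def by (rule interp_near) auto

lemma dep_may_move: "may_move T v w \<Longrightarrow> \<bar>dep u d v - dep u d w\<bar> \<le> 1"
  unfolding dep_def by (rule interp_may_move) auto

lemma far_near: "near T n v w \<Longrightarrow> \<bar>far u v - far u w\<bar> \<le> int n"
  unfolding far_def by (rule interp_near) auto

lemma far_may_move: "may_move T v w \<Longrightarrow> \<bar>far u v - far u w\<bar> \<le> 1"
  unfolding far_def by (rule interp_may_move) auto

text \<open>The bound is \<open>L - l\<close>. One move earlier the depth was at least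
  \<open>l + 1\<close>, which still hides everything outside the leg, including the centre.\<close>

lemma dep_see_tip: "near T l p (tip u d) \<Longrightarrow> dep u d p \<ge> int l + 2"
  using dep_near[of l p "tip u d" u d] by (simp add: dep_def L_def)

lemma dep_see: "near T l p v \<Longrightarrow> dep u d p \<ge> int l + 1 \<Longrightarrow> dep u d v \<noteq> 0"
  using dep_near[of l p v u d] by linarith

lemma dep_pos_unique:
  assumes "p \<in> pverts T" "length u = 2" "length u' = 2" "dep u d p \<ge> 1" "dep u' d' p \<ge> 1"
  shows "u = u' \<and> d = d'"
proof (cases p)
  case (Original ys)
  then show ?thesis using assms by (auto simp: dep_def split: if_splits)
next
  case (Inner e i)
  with assms(1) obtain b xs where "e = (xs, b # xs)" "length xs < 3"
    by (auto simp: Inner_in_verts)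
  then show ?thesis using Inner assms by (auto simp: dep_def split: if_splits)
qed

text \<open>A cop on his way into a leg passes depth \<open>l\<close>, where he sees the centre.
  Read backwards: as long as the centre is unseen, nobody has entered a leg from it to search its
  end.\<close>

lemma dep_eq_l:
  assumes "p \<in> pverts T" "length u = 2" "dep u d p = int l"
  shows "near T l p (Original u)"
proof -
  have "p = pt d u l"
  proof (cases p)
    case (Original ys)
    then show ?thesis using assms l_ge_1 by (auto simp: dep_def L_def split: if_splits)
  next
    case (Inner e i)
    with assms(1) obtain b xs where "e = (xs, b # xs)" "length xs < 3" "i < L"
      by (auto simp: Inner_in_verts)
    then show ?thesis using Inner assms l_ge_1 by (auto simp: dep_def pt_conv split: if_splits)
  qed
  moreover have "near T l (pt d u l) (pt d u 0)"
    by (rule near_pt) (use assms(2) in \<open>auto simp: L_def\<close>)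
  ultimately show ?thesis by simp
qed

lemma anc_Original:
  assumes "anc y (Original ys)"
  shows "(\<exists>as zs. y = Original zs \<and> ys = as @ zs) \<or>
    (\<exists>as b zs i. y = Inner (zs, b # zs) i \<and> ys = as @ b # zs)"
proof -
  have "(\<exists>as zs. (parent ^^ n) (Original ys) = Original zs \<and> ys = as @ zs) \<or>
    (\<exists>as b zs i. (parent ^^ n) (Original ys) = Inner (zs, b # zs) i \<and> ys = as @ b # zs)" for n
  proof (induction n)
    case (Suc n)
    then consider as zs where "(parent ^^ n) (Original ys) = Original zs" "ys = as @ zs"
      | as b zs i where "(parent ^^ n) (Original ys) = Inner (zs, b # zs) i" "ys = as @ b # zs"
      by blast
    then show ?case
    proof cases
      case (1 as zs)
      then show ?thesis by (cases zs) auto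
    next
      case (2 as b zs i)
      have "ys = (as @ [b]) @ zs" using 2 by simp
      then show ?thesis using 2 by (cases "i = 1") (auto intro: exI[of _ "as @ [b]"])
    qed
  qed auto
  then show ?thesis using assms unfolding anc_def by metis
qed

lemma anc_tip_cases:
  assumes "anc y (tip u d)" "length u = 2"
  obtains zs where "y = Original zs" "zs \<in> {d # u, u, tl u, []}"
    | b zs i where "y = Inner (zs, b # zs) i" "b # zs \<in> {d # u, u, tl u}"
proof -
  obtain p q where u: "u = [p, q]" using assms(2) by (auto simp: numeral_2_eq_2 length_Suc_conv)
  have suf: "zs \<in> {d # u, u, tl u, []}" if "d # u = as @ zs" for as zs
    using that u by (auto simp: append_eq_Cons_conv Cons_eq_append_conv)
  from anc_Original[OF assms(1)] show ?thesis
  proof (elim disjE exE conjE)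
    fix as zs assume "y = Original zs" "d # u = as @ zs"
    then show ?thesis using that(1) suf by blast
  next
    fix as b zs i assume "y = Inner (zs, b # zs) i" "d # u = as @ b # zs"
    then show ?thesis using that(2)[of zs b i] suf[of as "b # zs"] by blast
  qed
qed

lemma dep_anc_tip:
  assumes "anc y (tip u d)" "length u = 2" "length z = 2" "z \<noteq> u \<or> f \<noteq> d"
  shows "dep z f y = 0"
proof -
  obtain p q where u: "u = [p, q]" using assms(2) by (auto simp: numeral_2_eq_2 length_Suc_conv)
  show ?thesis
    by (rule anc_tip_cases[OF assms(1,2)]) (use assms(3,4) u in \<open>auto simp: dep_def\<close>)
qed

lemma far_anc_tip:
  assumes "anc y (tip u d)" "length u = 2" "length z = 2" "z \<noteq> u"
  shows "far z y = int L"
proof -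
  obtain p q where u: "u = [p, q]" using assms(2) by (auto simp: numeral_2_eq_2 length_Suc_conv)
  show ?thesis
    by (rule anc_tip_cases[OF assms(1,2)]) (use assms(3,4) u in \<open>auto simp: far_def\<close>)
qed

lemma far_between:
  assumes "anc (Original u) y" "anc y (tip u d)" "length u = 2"
  shows "far u y = 0"
proof -
  obtain p q where u: "u = [p, q]" using assms(3) by (auto simp: numeral_2_eq_2 length_Suc_conv)
  have V: "y \<in> pverts T" using anc_in_verts[OF assms(2)] assms(3) by (simp add: Original_in_verts)
  have lev: "2 * L \<le> level y" using anc_height[OF assms(1) V] assms(3) by simp
  have L0: "L > 0" by (simp add: L_def)
  show ?thesis
  proof (rule anc_tip_cases[OF assms(2,3)])
    fix zs assume "y = Original zs" "zs \<in> {d # u, u, tl u, []}"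
    then show ?thesis using lev L0 u by (auto simp: far_def)
  next
    fix b zs i assume y: "y = Inner (zs, b # zs) i" "b # zs \<in> {d # u, u, tl u}"
    then have "i < L" using V by (simp add: Inner_in_verts)
    then show ?thesis using lev y u by (auto simp: far_def)
  qed
qed

lemma anc_chain:
  assumes "anc x v" "v \<in> pverts T" "P x \<noteq> P v"
  shows "\<exists>y. y \<in> pverts T \<and> y \<noteq> Original [] \<and> anc x (parent y) \<and> anc y v \<and> P y \<noteq> P (parent y)"
  using assms
proof (induction "level v" arbitrary: v)
  case 0
  then show ?case using height_0_iff anc_root_iff by metis
next
  case (Suc n)
  then have "v \<noteq> Original []" by auto
  then have par: "anc x (parent v)" "level (parent v) = n" "parent v \<in> pverts T"
    using Suc.prems Suc.hyps(2) anc_par_iff[of v x] height_par[of v] par_in_verts by auto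
  show ?case
  proof (cases "P v = P (parent v)")
    case False
    then show ?thesis using Suc.prems par \<open>v \<noteq> Original []\<close> by (intro exI[of _ v]) auto
  next
    case True
    then show ?thesis
      using Suc.hyps(1)[of "parent v"] par Suc.prems \<open>v \<noteq> Original []\<close> anc_par_iff by metis
  qed
qed

end

text \<open>Here \<open>c b k\<close> is the position of cop \<open>b\<close> after move \<open>k\<close>, and \<open>t v\<close> the first time that \<open>v\<close> is
  in sight. By monotonicity, a vertex that has been in sight is never contaminated again.\<close>

locale monotone_search = subdivided +
  fixes c :: "bool \<Rightarrow> nat \<Rightarrow> bool list sd_vertex" and t :: "bool list sd_vertex \<Rightarrow> nat"
  assumes seen_at: "v \<in> pverts T \<Longrightarrow> \<exists>b. near T l (c b (t v)) v"
    and not_before: "v \<in> pverts T \<Longrightarrow> k < t v \<Longrightarrow> \<not> near T l (c b k) v"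
    and cop_move: "v \<in> pverts T \<Longrightarrow> k < t v \<Longrightarrow> may_move T (c b k) (c b (Suc k))"
    and cop_in_verts: "v \<in> pverts T \<Longrightarrow> k \<le> t v \<Longrightarrow> c b k \<in> pverts T"
    and boundary: "(w, v) \<in> parcs T \<Longrightarrow> t v \<le> k \<Longrightarrow> k < t w \<Longrightarrow>
      \<exists>b. near T l (c b k) v \<or> near T l (c b (Suc k)) v"
begin

abbreviation guards :: "bool \<Rightarrow> nat \<Rightarrow> bool list sd_vertex \<Rightarrow> bool" where
  "guards b k v \<equiv> near T l (c b k) v \<or> near T l (c b (Suc k)) v"

abbreviation in_leg :: "bool \<Rightarrow> nat \<Rightarrow> bool list \<Rightarrow> bool \<Rightarrow> bool" where
  "in_leg b k u d \<equiv> dep u d (c b k) \<ge> int l + 1 \<and> dep u d (c b (Suc k)) \<ge> int l + 1"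

lemma tip_in_verts: "length u = 2 \<Longrightarrow> tip u d \<in> pverts T"
  by (simp add: Original_in_verts)

text \<open>Some arc on the path from \<open>x\<close> down to \<open>v\<close> joins a vertex
  already seen to one not yet seen, and by \<open>boundary\<close> its seen end is guarded.\<close>

lemma chain_guarded:
  assumes "anc x v" "v \<in> pverts T" "(t x \<le> k) \<noteq> (t v \<le> k)"
  shows "\<exists>y b. anc x y \<and> anc y v \<and> guards b k y"
proof -
  from anc_chain[of x v "\<lambda>y. t y \<le> k"] assms obtain y where y: "y \<in> pverts T" "y \<noteq> Original []"
    "anc x (parent y)" "anc y v" "(t y \<le> k) \<noteq> (t (parent y) \<le> k)" by blast
  have "anc (parent y) y" "anc x y" using y anc_par_iff by auto
  then have "anc (parent y) v" using y anc_trans assms(2) by blast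
  have arcs: "(y, parent y) \<in> parcs T" "(parent y, y) \<in> parcs T"
    unfolding arc_iff using y par_in_verts by auto
  show ?thesis
  proof (cases "t y \<le> k")
    case True
    then show ?thesis using boundary[OF arcs(2), of k] y \<open>anc x y\<close> by auto
  next
    case False
    then show ?thesis using boundary[OF arcs(1), of k] y \<open>anc (parent y) v\<close> by auto
  qed
qed

text \<open>The root is an ancestor of both tips. Whether or not it has been seen, its state differs
  from that of one of the tips.\<close>

lemma tip_path_guarded:
  assumes "length u = 2" "length w = 2" "t (tip u d) \<le> k" "k < t (tip w f)"
  shows "\<exists>y b. (anc y (tip u d) \<or> anc y (tip w f)) \<and> guards b k y"
proof (cases "t (Original []) \<le> k")
  case True
  then show ?thesis
    using chain_guarded[of "Original []" "tip w f" k] anc_root tip_in_verts assms by force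
next
  case False
  then show ?thesis
    using chain_guarded[of "Original []" "tip u d" k] anc_root tip_in_verts assms by force
qed

lemma anc_centre_tip: "length u = 2 \<Longrightarrow> anc (Original u) (tip u d)"
proof -
  assume u: "length u = 2"
  have "(parent ^^ n) (pt d u n) = pt d u 0" if "n \<le> L" for n
    using that
  proof (induction n)
    case (Suc n)
    then show ?case using parent_pt[of n d u] by (simp add: funpow_swap1 del: pt_0)
  qed simp
  from this[of L] show ?thesis using u unfolding anc_def by (intro exI[of _ L]) auto
qed

lemma spider_path_guarded:
  assumes "length u = 2" "t (tip u d) \<le> k" "k < t (tip u (\<not> d))"
  shows "\<exists>y f b. anc (Original u) y \<and> anc y (tip u f) \<and> guards b k y"
proof (cases "t (Original u) \<le> k")
  case True
  then show ?thesis
    using chain_guarded[of "Original u" "tip u (\<not> d)" k] anc_centre_tip tip_in_verts assms by fastforce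
next
  case False
  then show ?thesis
    using chain_guarded[of "Original u" "tip u d" k] anc_centre_tip tip_in_verts assms by fastforce
qed

lemma in_leg_of_seen_tip:
  assumes "near T l (c b (Suc k)) (tip u d)" "v \<in> pverts T" "k < t v"
  shows "in_leg b k u d"
  using dep_see_tip[OF assms(1)] dep_may_move[OF cop_move[OF assms(2,3), of b], of u d] by linarith

lemma not_guards_of_in_leg: "in_leg b k u d \<Longrightarrow> dep u d y = 0 \<Longrightarrow> \<not> guards b k y"
  using dep_see by blast

lemma other_guards: "in_leg b k u d \<Longrightarrow> dep u d y = 0 \<Longrightarrow> guards b' k y \<Longrightarrow> b' = (\<not> b)"
  using not_guards_of_in_leg[of u d b k y] by (cases b; cases b') simp_all

lemma none_guards:
  "in_leg b k u d \<Longrightarrow> in_leg (\<not> b) k u' d' \<Longrightarrow> dep u d y = 0 \<Longrightarrow> dep u' d' y = 0 \<Longrightarrow> \<not> guards b' k y"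
  using other_guards not_guards_of_in_leg by blast

text \<open>Seeing a vertex of the spider requires \<open>far\<close> at most \<open>l\<close>,
  seeing one at distance \<open>L\<close> requires at least \<open>l + 2\<close>, and a single move
  does not bridge the gap.\<close>

lemma not_guards_near_and_far:
  assumes "guards b k y" "guards b k y'" "far u y = 0" "far u y' = int L"
    and "v \<in> pverts T" "k < t v"
  shows False
proof -
  have mv: "\<bar>far u (c b k) - far u (c b (Suc k))\<bar> \<le> 1"
    using far_may_move cop_move[OF assms(5,6)] by blast
  have "far u (c b k) \<le> int l \<or> far u (c b (Suc k)) \<le> int l"
    using assms(1,3) far_near[of l _ y u] by force
  moreover have "far u (c b k) \<ge> int l + 2 \<or> far u (c b (Suc k)) \<ge> int l + 2"
    using assms(2,4) far_near[of l _ y' u] unfolding L_def by force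
  ultimately show False using mv by linarith
qed

lemma two_tips_two_cops:
  assumes "near T l (c b k) (tip u d)" "near T l (c b' k) (tip u' d')" "u \<noteq> u' \<or> d \<noteq> d'"
    and "length u = 2" "length u' = 2" "v \<in> pverts T" "k \<le> t v"
  shows "b' = (\<not> b)"
proof (rule ccontr)
  assume "b' \<noteq> (\<not> b)"
  then have "b' = b" by simp
  then have "dep u d (c b k) \<ge> 1" "dep u' d' (c b k) \<ge> 1"
    using dep_see_tip assms(1,2) by force+
  then show False using dep_pos_unique assms(3-5) cop_in_verts[OF assms(6,7)] by blast
qed

lemma third_spider: "\<exists>w :: bool list. length w = 2 \<and> w \<noteq> u \<and> w \<noteq> u'"
proof -
  have "\<exists>w \<in> {[True, True], [True, False], [False, False]}. w \<noteq> u \<and> w \<noteq> u'" by fastforce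
  then show ?thesis by force
qed

section \<open>The first spider with both tips seen\<close>

context
  fixes u1 :: "bool list" and e :: bool and s :: nat
  assumes u1: "length u1 = 2"
    and first: "\<And>u. length u = 2 \<Longrightarrow> s \<le> t (tip u True) \<or> s \<le> t (tip u False)"
    and last_tip: "t (tip u1 e) = s" and first_tip: "t (tip u1 (\<not> e)) \<le> s"
begin

lemma late_tip: "length u = 2 \<Longrightarrow> \<exists>d. s \<le> t (tip u d)"
  using first by blast

text \<open>When the second tip of \<open>u1\<close> comes into sight, one cop is deep in its leg
  and guards nothing outside. Any tip seen before leaves a frontier towards unseen tips that has to
  be guarded, and any tip seen at the same moment binds a cop in its leg. One remaining cop cannot
  meet such demands for both \<open>u1\<close> and \<open>u\<close>.\<close>

lemma other_tips_later:
  assumes u: "length u = 2" "u \<noteq> u1"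
  shows "s < t (tip u d)"
proof (rule ccontr)
  assume "\<not> ?thesis"
  then have tp: "t (tip u d) \<le> s" by simp
  obtain w where w: "length w = 2" "w \<noteq> u" "w \<noteq> u1" using third_spider by blast
  obtain f where f: "s \<le> t (tip w f)" using late_tip[OF w(1)] by blast
  obtain b where b: "near T l (c b s) (tip u1 e)"
    using seen_at[OF tip_in_verts[OF u1], of e] last_tip by auto
  note V = tip_in_verts[OF u1, of e]
  show False
  proof (cases s)
    \<comment> \<open>Without an earlier move to look at, counting suffices: three tips would be in
      sight of two cops.\<close>
    case 0
    obtain b1 b2 where "near T l (c b1 s) (tip u1 (\<not> e))" "near T l (c b2 s) (tip u d)"
      using seen_at[OF tip_in_verts[OF u1]] seen_at[OF tip_in_verts[OF u(1)]] first_tip tp 0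
      by (metis le_0_eq)
    then have "b1 = (\<not> b)" "b2 = (\<not> b)" "b2 = (\<not> b1)"
      using two_tips_two_cops[OF b _ _ u1 u1 V, of b1 "\<not> e"]
        two_tips_two_cops[OF b _ _ u1 u(1) V, of b2 d]
        two_tips_two_cops[of b1 s "\<not> e" u1 b2 d u, OF _ _ _ u1 u(1) V] u 0 by auto
    then show False by simp
  next
    case (Suc k)
    have kt: "k < t (tip u1 e)" using last_tip Suc by simp
    have legb: "in_leg b k u1 e" using in_leg_of_seen_tip[OF _ V kt] b Suc by simp
    have q: "k < t (tip w f)" using f Suc by simp
    have seen_s: "near T l (c (\<not> b) s) (tip u' d') \<and> in_leg (\<not> b) k u' d'"
      if len: "length u' = 2" and time: "t (tip u' d') = s" and ne: "u' \<noteq> u1 \<or> d' \<noteq> e" for u' d'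
    proof -
      obtain b' where b': "near T l (c b' s) (tip u' d')"
        using seen_at[OF tip_in_verts[OF len], of d'] unfolding time by blast
      have "b' = (\<not> b)" using two_tips_two_cops[OF b b' _ u1 len V] ne last_tip by auto
      moreover have "in_leg b' k u' d'" using in_leg_of_seen_tip[OF _ V kt] b' Suc by simp
      ultimately show ?thesis using b' by simp
    qed
    have path1: "\<exists>y b'. (anc y (tip u1 (\<not> e)) \<or> anc y (tip w f)) \<and> guards b' k y"
      if "t (tip u1 (\<not> e)) \<le> k"
      using tip_path_guarded[OF u1 w(1) that q] .
    have path1_dep: "dep u1 e y = 0 \<and> dep u d y = 0 \<and> far u y = int L"
      if "anc y (tip u1 (\<not> e)) \<or> anc y (tip w f)" for y
      using that dep_anc_tip[of y] far_anc_tip[of y] u u1 w by metis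
    have spider: "\<exists>y b'. guards b' k y \<and> far u y = 0 \<and> (\<forall>f. dep u1 f y = 0)"
      if "t (tip u d) \<le> k"
    proof -
      obtain d' where d': "s \<le> t (tip u d')" using late_tip[OF u(1)] by blast
      have "\<not> s \<le> t (tip u d)" using that Suc by simp
      have "d' \<noteq> d"
      proof
        assume "d' = d"
        with d' \<open>\<not> s \<le> t (tip u d)\<close> show False by simp
      qed
      then have "d' = (\<not> d)" by blast
      with d' Suc have "k < t (tip u (\<not> d))" by simp
      from spider_path_guarded[OF u(1) that this] obtain y f b' where
        "anc (Original u) y" "anc y (tip u f)" "guards b' k y" by blast
      then show ?thesis using far_between dep_anc_tip u u1 by metis
    qed
    \<comment> \<open>In the three cases, the other cop would have to guard both a frontier inside
      spider \<open>u\<close> and one between \<open>u1\<close> and \<open>w\<close>; or both cops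
      are deep in legs of \<open>u1\<close> and spider \<open>u\<close> is unguarded; or they are
      deep in legs of \<open>u1\<close> and \<open>u\<close>, and the frontier between
      \<open>u1\<close> and \<open>w\<close> is unguarded.\<close>
    consider "t (tip u d) \<le> k" "t (tip u1 (\<not> e)) \<le> k" | "t (tip u d) \<le> k" "t (tip u1 (\<not> e)) = s"
      | "t (tip u d) = s" using tp first_tip Suc by linarith
    then show False
    proof cases
      case 1
      obtain y b1 where y: "anc y (tip u1 (\<not> e)) \<or> anc y (tip w f)" "guards b1 k y"
        using path1[OF 1(2)] by blast
      obtain y' b2 where y': "guards b2 k y'" "far u y' = 0" "\<forall>f. dep u1 f y' = 0"
        using spider[OF 1(1)] by blast
      have "b1 = (\<not> b)" "b2 = (\<not> b)"
        using other_guards[OF legb _ y(2)] other_guards[OF legb _ y'(1)] y'(3) path1_dep[OF y(1)]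
        by blast+
      then have "b1 = b2" by simp
      then show False
        using not_guards_near_and_far[of b2 k y' y u, OF _ _ _ _ V kt] y y' path1_dep[OF y(1)]
        by blast
    next
      case 2
      obtain y b2 where y: "guards b2 k y" "\<forall>f. dep u1 f y = 0" using spider[OF 2(1)] by blast
      have "in_leg (\<not> b) k u1 (\<not> e)" using seen_s[OF u1 2(2)] by blast
      then show False using none_guards[OF legb] y by blast
    next
      case 3
      have leg: "near T l (c (\<not> b) s) (tip u d)" "in_leg (\<not> b) k u d"
        using seen_s[OF u(1) 3] u by blast+
      have "t (tip u1 (\<not> e)) \<noteq> s"
      proof
        assume "t (tip u1 (\<not> e)) = s"
        then have "near T l (c (\<not> b) s) (tip u1 (\<not> e))" using seen_s[OF u1] by blast
        then show False using two_tips_two_cops[OF _ leg(1) _ u1 u(1) V] u last_tip by auto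
      qed
      then have "t (tip u1 (\<not> e)) \<le> k" using first_tip Suc by simp
      from path1[OF this] obtain y b1 where
        y: "anc y (tip u1 (\<not> e)) \<or> anc y (tip w f)" "guards b1 k y" by blast
      then show False using none_guards[OF legb leg(2)] path1_dep[OF y(1)] by blast
    qed
  qed
qed

lemma contradiction: False
proof -
  obtain u d where u: "length u = 2" "u \<noteq> u1"
    and min: "\<And>u' d'. length u' = 2 \<Longrightarrow> u' \<noteq> u1 \<Longrightarrow> t (tip u d) \<le> t (tip u' d')"
  proof -
    obtain u0 :: "bool list" where u0: "length u0 = 2" "u0 \<noteq> u1" using third_spider by blast
    have "\<exists>x. (length (fst x) = 2 \<and> fst x \<noteq> u1) \<and>
        (\<forall>y. length (fst y) = 2 \<and> fst y \<noteq> u1 \<longrightarrow>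
          t (tip (fst x) (snd x)) \<le> t (tip (fst y) (snd y)))"
      by (rule ex_has_least_nat[of _ "(u0, True)"]) (use u0 in simp)
    then show ?thesis using that by force
  qed
  have "s < t (tip u d)" using other_tips_later u by blast
  then obtain k where k: "t (tip u d) = Suc k" "s \<le> k" by (cases "t (tip u d)") auto
  note V = tip_in_verts[OF u(1), of d]
  have kt: "k < t (tip u d)" using k by simp
  obtain w where w: "length w = 2" "w \<noteq> u" "w \<noteq> u1" using third_spider by blast
  have q: "k < t (tip w True)" "k < t (tip u (\<not> d))" using min w u kt less_le_trans by blast+
  obtain z where z: "near T l (c z (Suc k)) (tip u d)" using seen_at[OF V] k by auto
  have legz: "in_leg z k u d" using in_leg_of_seen_tip[OF z V kt] .
  have path_dep: "dep u1 e y = 0 \<and> dep u d y = 0 \<and> far u y = int L"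
    if "anc y (tip u1 (\<not> e)) \<or> anc y (tip w True)" for y
    using that dep_anc_tip[of y] far_anc_tip[of y] u u1 w by metis
  \<comment> \<open>Otherwise the frontier inside spider \<open>u\<close> and the one between
    \<open>u1\<close> and \<open>w\<close> would both fall to the cop other than
    \<open>z\<close>.\<close>
  have centre: "k < t (Original u)"
  proof (rule ccontr)
    assume "\<not> ?thesis"
    then obtain y b where y: "anc (Original u) y" "anc y (tip u (\<not> d))" "guards b k y"
      using chain_guarded[of "Original u" "tip u (\<not> d)" k] anc_centre_tip tip_in_verts u q by fastforce
    then have "far u y = 0" "dep u d y = 0" using far_between dep_anc_tip u by blast+
    moreover obtain y' b' where
      y': "anc y' (tip u1 (\<not> e)) \<or> anc y' (tip w True)" "guards b' k y'"
      using tip_path_guarded[OF u1 w(1) _ q(1), of "\<not> e"] first_tip k by fastforce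
    ultimately have "b = (\<not> z)" "b' = (\<not> z)"
      using other_guards[OF legz _ y(3)] other_guards[OF legz _ y'(2)] path_dep[OF y'(1)] by blast+
    then have "b = b'" by simp
    then show False
      using not_guards_near_and_far[of b k y y' u, OF _ _ _ _ V kt] y y' path_dep[OF y'(1)]
        \<open>far u y = 0\<close> by blast
  qed
  \<comment> \<open>Backwards in time from \<open>k\<close>: one move before depth
    \<open>l + 1\<close> or more, the depth is at least \<open>l\<close>, and depth \<open>l\<close>
    itself would have shown the centre too early.\<close>
  have stay: "dep u d (c z j) \<ge> int l + 1" if "j \<le> k" for j
    using that
  proof (induction rule: inc_induct)
    case base
    then show ?case using legz by blast
  next
    case (step j)
    have oV: "Original u \<in> pverts T" using u by (simp add: Original_in_verts)
    have "may_move T (c z j) (c z (Suc j))" using cop_move[OF V] step.hyps kt by simp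
    then have "dep u d (c z j) \<ge> int l" using dep_may_move[of "c z j" "c z (Suc j)" u d] step.IH by linarith
    moreover have "dep u d (c z j) \<noteq> int l"
      using dep_eq_l[OF cop_in_verts[OF V] u(1)] not_before[OF oV, of j z] step.hyps kt centre by force
    ultimately show ?case by linarith
  qed
  have other: "near T l (c b s) (tip u1 f) \<Longrightarrow> b = (\<not> z)" for b f
  proof (rule ccontr)
    assume a: "near T l (c b s) (tip u1 f)" "b \<noteq> (\<not> z)"
    then have "dep u1 f (c z s) \<ge> 1" using dep_see_tip[of "c b s" f u1] by auto
    moreover have "dep u d (c z s) \<ge> 1" using stay[OF k(2)] by linarith
    moreover have "c z s \<in> pverts T" using cop_in_verts[OF V] k by simp
    ultimately show False using dep_pos_unique u u1 by blast
  qed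
  obtain b where b: "near T l (c b s) (tip u1 e)"
    using seen_at[OF tip_in_verts[OF u1], of e] last_tip by auto
  note V1 = tip_in_verts[OF u1, of e]
  have ne: "t (tip u1 (\<not> e)) \<noteq> s"
  proof
    assume "t (tip u1 (\<not> e)) = s"
    then obtain b1 where b1: "near T l (c b1 s) (tip u1 (\<not> e))"
      using seen_at[OF tip_in_verts[OF u1], of "\<not> e"] by auto
    have "b1 = (\<not> b)" using two_tips_two_cops[OF b b1 _ u1 u1 V1] last_tip by auto
    then show False using other[OF b] other[OF b1] by simp
  qed
  \<comment> \<open>One move before \<open>s\<close>, both cops are deep in legs, and nobody guards
    the frontier between the tip of \<open>u1\<close> seen by then and the unseen spider
    \<open>w\<close>.\<close>
  then obtain k' where k': "s = Suc k'" "t (tip u1 (\<not> e)) \<le> k'" using first_tip by (cases s) auto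
  have "in_leg (\<not> z) k' u1 e"
    using in_leg_of_seen_tip[OF _ V1, of b k'] b k' last_tip other[OF b] by simp
  moreover have "in_leg z k' u d" using stay[of k'] stay[of s] k k' by simp
  moreover obtain y b' where
    y: "anc y (tip u1 (\<not> e)) \<or> anc y (tip w True)" "guards b' k' y"
    using tip_path_guarded[OF u1 w(1) k'(2), of True] q k k' by fastforce
  ultimately show False
    using none_guards path_dep[OF y(1)] by blast
qed

end

text \<open>The spider \<open>u1\<close> minimises the time \<open>g u1\<close> at which the later
  of its two tips comes into sight; this minimum serves as \<open>s\<close>.\<close>

lemma impossible: False
proof -
  define g where "g u = max (t (tip u True)) (t (tip u False))" for u
  obtain u1 where u1: "length u1 = 2" "\<And>u. length u = 2 \<Longrightarrow> g u1 \<le> g u"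
    using ex_has_least_nat[of "\<lambda>u. length u = 2" "[True, True]" g] by auto
  obtain e where e: "t (tip u1 e) = g u1" "t (tip u1 (\<not> e)) \<le> g u1"
  proof (cases "t (tip u1 True) \<ge> t (tip u1 False)")
    case True
    then show ?thesis using that[of True] by (simp add: g_def)
  next
    case False
    then show ?thesis using that[of False] by (simp add: g_def)
  qed
  have "g u1 \<le> t (tip u True) \<or> g u1 \<le> t (tip u False)" if "length u = 2" for u
    using u1(2)[OF that] unfolding g_def by linarith
  from contradiction[OF u1(1) this e] show False .
qed

end

context subdivided
begin

text \<open>A winning strategy brings every vertex into sight, so times of first sighting exist.
  Moves before \<open>t v\<close> are legal because a robber waiting at \<open>v\<close> is still
  unseen then.\<close>

lemma monotonic_two_cops:
  assumes win: "winning_strategy l T 2 \<sigma>" and mono: "monotonic_strategy l T \<sigma>"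
  shows False
proof -
  let ?Q = "quiet_cops \<sigma>"
  define t where "t v = (LEAST k. visible l T (?Q k) v)" for v
  have vis_t: "visible l T (?Q (t v)) v" if "v \<in> pverts T" for v
    unfolding t_def by (rule LeastI_ex) (rule eventually_visible[OF win mono that])
  have unvis: "\<not> visible l T (?Q k) v" if "k < t v" for k v
    using that not_less_Least unfolding t_def by blast
  have legal: "list_all2 (may_move T) (?Q k) (?Q (Suc k))" if "v \<in> pverts T" "k < t v" for v k
    by (rule legal_while_unseen[OF win mono that(1)]) (use unvis that(2) in auto)
  have Q: "set (?Q k) \<subseteq> pverts T \<and> length (?Q k) = 2" if "v \<in> pverts T" "k \<le> t v" for v k
    using that(2)
  proof (induction k)
    case 0
    then show ?case using win by (simp add: winning_strategy_def legal_strategy_def)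
  next
    case (Suc k)
    then have "list_all2 (may_move T) (?Q k) (?Q (Suc k))" using legal[OF that(1)] by simp
    with Suc show ?case using list_all2_may_move_in_verts by (auto dest: list_all2_lengthD)
  qed
  define c where "c b k = ?Q k ! (if b then 0 else 1)" for b k
  have setQ: "set (?Q k) = {c True k, c False k}" if "v \<in> pverts T" "k \<le> t v" for v k
  proof -
    have "length (?Q k) = 2" using Q[OF that] by blast
    then obtain x y where "?Q k = [x, y]" by (auto simp: numeral_2_eq_2 length_Suc_conv)
    then show ?thesis by (simp add: c_def)
  qed
  have vis: "visible l T (?Q k) x \<longleftrightarrow> (\<exists>b. near T l (c b k) x)" if "v \<in> pverts T" "k \<le> t v" for v k x
    using visible_iff_near[of "?Q k" l x] Q[OF that] setQ[OF that] by (auto) (metis (full_types))+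
  interpret monotone_search l c t
  proof
    fix v k b
    assume v: "v \<in> pverts T"
    show "\<exists>b. near T l (c b (t v)) v" using vis_t[OF v] vis[OF v] by simp
    { assume "k \<le> t v"
      then show "c b k \<in> pverts T" using Q[OF v] setQ[OF v] by (cases b) auto }
    assume k: "k < t v"
    show "\<not> near T l (c b k) v" using unvis[OF k] vis[OF v, of k v] k by auto
    show "may_move T (c b k) (c b (Suc k))"
      using legal[OF v k] Q[OF v, of k] k by (auto simp: c_def list_all2_conv_all_nth)
  next
    fix w v k
    assume a: "(w, v) \<in> parcs T" "t v \<le> k" "k < t w"
    then have V: "w \<in> pverts T" "v \<in> pverts T" by (auto dest: in_arcsD1 in_arcsD2)
    have "visible l T (?Q k) v \<or> visible l T (?Q (Suc k)) v"
      by (rule boundary_visible[OF win mono a(1) _ a(2) vis_t[OF V(2)]]) (use unvis a(3) in auto)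
    then show "\<exists>b. near T l (c b k) v \<or> near T l (c b (Suc k)) v"
      using vis[OF V(1), of k v] vis[OF V(1), of "Suc k" v] a(3) by auto
  qed
  show False by (rule impossible)
qed

end

section \<open>Clearing the tree\<close>

text \<open>The loop at the final state prolongs a finite run to the infinite schedule that
  \<open>pursue\<close> expects.\<close>

lemma rtranclp_sequence:
  assumes "R\<^sup>*\<^sup>* x y" "R y y"
  obtains f N where "f (0::nat) = x" "f N = y" "\<And>k. R (f k) (f (Suc k))"
proof -
  obtain n where "(R ^^ n) x y" using assms(1) by (auto simp: rtranclp_power)
  then obtain f where f: "f 0 = x" "f n = y" "\<And>i. i < n \<Longrightarrow> R (f i) (f (Suc i))"
    by (auto simp: relpowp_fun_conv)
  define g where "g i = f (min i n)" for i
  have "R (g k) (g (Suc k))" for k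
    using f assms(2) by (cases "k < n") (auto simp: g_def min_def)
  moreover have "g 0 = x" "g n = y" using f by (auto simp: g_def)
  ultimately show ?thesis using that by blast
qed

context sighted_tree
begin

text \<open>In a state \<open>(C, D)\<close> the cops are at \<open>C\<close> and a robber who has not been seen is in \<open>D\<close>.\<close>

definition clear_step :: "'a list \<times> 'a set \<Rightarrow> 'a list \<times> 'a set \<Rightarrow> bool" where
  "clear_step = (\<lambda>(C, D) (C', D'). list_all2 (may_move G) C C' \<and>
     (\<forall>v \<in> D - seen C'. \<forall>w. may_move G v w \<longrightarrow> w \<in> D' \<union> seen C'))"

definition mono_step :: "'a list \<times> 'a set \<Rightarrow> 'a list \<times> 'a set \<Rightarrow> bool" where
  "mono_step = (\<lambda>(C, D) (C', D'). clear_step (C, D) (C', D') \<and> D' = D - seen C')"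

text \<open>The set \<open>D\<close> cannot spread while the cops stay put. This invariant lets the
  cops move one at a time.\<close>

definition stable :: "'a list \<Rightarrow> 'a set \<Rightarrow> bool" where
  "stable C D \<longleftrightarrow> set C \<subseteq> pverts G \<and> D \<subseteq> pverts G \<and> D \<inter> seen C = {} \<and>
     (\<forall>v \<in> D. \<forall>w. may_move G v w \<longrightarrow> w \<in> D \<union> seen C)"

lemma clear_step_iff: "clear_step (C, D) (C', D') \<longleftrightarrow> list_all2 (may_move G) C C' \<and>
     (\<forall>v w. v \<in> D \<longrightarrow> v \<notin> seen C' \<longrightarrow> may_move G v w \<longrightarrow> w \<notin> seen C' \<longrightarrow> w \<in> D')"
  by (auto simp: clear_step_def)

lemma mono_step_iff:
  "mono_step (C, D) (C', D') \<longleftrightarrow> clear_step (C, D) (C', D') \<and> D' = D - seen C'"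
  by (simp add: mono_step_def)

lemma mono_step_le: "mono_step \<le> clear_step"
  by (auto simp: mono_step_def)

lemma mono_step_empty: "mono_step (C, {}) (C, {})"
  by (auto simp: mono_step_def clear_step_def intro: list_all2_refl)

lemma stable_start: "set C \<subseteq> pverts G \<Longrightarrow> stable C (pverts G - seen C)"
  by (auto simp: stable_def intro: may_move_in_verts)

lemma clear_wins:
  assumes "clear_step\<^sup>*\<^sup>* (C, pverts G - seen C) (C', {})" "set C \<subseteq> pverts G" "C \<noteq> []"
  shows "\<exists>\<sigma>. winning_strategy l G (length C) \<sigma>"
proof -
  have "clear_step (C', {}) (C', {})" using mono_step_empty mono_step_le by blast
  from rtranclp_sequence[OF assms(1) this] obtain f N where
    f: "f 0 = (C, pverts G - seen C)" "f N = (C', {})" "\<And>k. clear_step (f k) (f (Suc k))" by blast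
  have s: "clear_step (fst (f k), snd (f k)) (fst (f (Suc k)), snd (f (Suc k)))" for k using f(3) by simp
  have "winning_strategy l G (length C) (pursue towards (\<lambda>k. fst (f k)))"
    by (rule pursue_wins[where D = "\<lambda>k. snd (f k)" and N = N])
      (use f(1,2) assms s[unfolded clear_step_iff] in auto)
  then show ?thesis by blast
qed

text \<open>Along monotone steps, \<open>D\<close> is exactly the set of vertices never seen so far,
  and its confinement is the assumption \<open>closed\<close> of
  \<open>pursue_monotonic\<close>.\<close>

lemma mono_wins:
  assumes "mono_step\<^sup>*\<^sup>* (C, pverts G - seen C) (C', {})" "set C \<subseteq> pverts G" "C \<noteq> []"
  shows "\<exists>\<sigma>. winning_strategy l G (length C) \<sigma> \<and> monotonic_strategy l G \<sigma>"
proof -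
  from rtranclp_sequence[OF assms(1) mono_step_empty] obtain f N where
    f: "f 0 = (C, pverts G - seen C)" "f N = (C', {})" "\<And>k. mono_step (f k) (f (Suc k))" by blast
  have m: "mono_step (fst (f k), snd (f k)) (fst (f (Suc k)), snd (f (Suc k)))" for k using f(3) by simp
  then have s: "clear_step (fst (f k), snd (f k)) (fst (f (Suc k)), snd (f (Suc k)))" for k
    using mono_step_le by blast
  have D: "snd (f k) = pverts G - (\<Union>j\<le>k. seen (fst (f j)))" for k
  proof (induction k)
    case (Suc k)
    have "snd (f (Suc k)) = snd (f k) - seen (fst (f (Suc k)))" using m[of k] unfolding mono_step_iff by blast
    with Suc show ?case by (auto simp: atMost_Suc)
  qed (use f in auto)
  have "winning_strategy l G (length C) (pursue towards (\<lambda>k. fst (f k)))"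
    by (rule pursue_wins[where D = "\<lambda>k. snd (f k)" and N = N])
      (use f(1,2) assms s[unfolded clear_step_iff] in auto)
  moreover have "monotonic_strategy l G (pursue towards (\<lambda>k. fst (f k)))"
  proof (rule pursue_monotonic)
    fix k v w
    assume v: "v \<in> pverts G - (\<Union>j\<le>k. seen (fst (f j)))" and vw: "may_move G v w"
      and w: "w \<notin> seen (fst (f k))"
    show "w \<notin> (\<Union>j\<le>k. seen (fst (f j)))"
    proof (cases k)
      case (Suc i)
      then have "v \<in> snd (f i)" "v \<notin> seen (fst (f (Suc i)))" using v D by auto
      then have "w \<in> snd (f (Suc i))"
        using s[of i] vw w Suc unfolding clear_step_iff by blast
      then show ?thesis using D Suc by auto
    qed (use w in auto)
  qed (use f(1) assms s[unfolded clear_step_iff] in auto)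
  ultimately show ?thesis by blast
qed

section \<open>Single moves that keep the search monotone\<close>

lemma move_one_cop:
  assumes st: "stable C D" and i: "i < length C" and mv: "may_move G (C ! i) q"
    and free: "\<And>v w. w \<in> D \<Longrightarrow> may_move G w v \<Longrightarrow> v \<notin> D \<Longrightarrow>
      near G l (C ! i) v \<Longrightarrow> \<not> near G l q v \<Longrightarrow> v \<in> seen (C[i := q])"
  shows "mono_step (C, D) (C[i := q], D - seen (C[i := q]))"
    and "stable (C[i := q]) (D - seen (C[i := q]))"
proof -
  let ?C = "C[i := q]"
  have CV: "set C \<subseteq> pverts G" using st by (simp add: stable_def)
  have all: "list_all2 (may_move G) C ?C"
    unfolding list_all2_conv_all_nth
  proof (intro conjI allI impI)
    fix j assume "j < length C"
    then show "may_move G (C ! j) (?C ! j)" using mv by (cases "j = i") auto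
  qed simp
  have closed: "v \<in> D - seen ?C \<or> v \<in> seen ?C" if w: "w \<in> D" "may_move G w v" for v w
  proof (cases "v \<in> D")
    case False
    then have "v \<in> seen C" using st w unfolding stable_def by blast
    then obtain j where j: "j < length C" "near G l (C ! j) v"
      by (auto simp: seen_def in_set_conv_nth)
    show ?thesis
    proof (cases "j = i")
      case True
      have "q \<in> set ?C" using i by (simp add: set_update_memI)
      then show ?thesis using free[OF w False] j True by (auto simp: seen_def)
    next
      case False
      then have "C ! j \<in> set ?C" using j by (metis nth_list_update_neq length_list_update nth_mem)
      then show ?thesis using j by (auto simp: seen_def)
    qed
  qed blast
  show "mono_step (C, D) (?C, D - seen ?C)"
    unfolding mono_step_def clear_step_def using all closed by blast
  show "stable ?C (D - seen ?C)"
    unfolding stable_def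
    using closed st list_all2_may_move_in_verts[OF all CV] by (auto simp: stable_def)
qed

text \<open>When cop \<open>i\<close> descends to \<open>q\<close>, a boundary vertex that gets out of his sight has to be in sight of
  the other cop, who is at \<open>par g\<close>.\<close>

definition free_below :: "'a list \<Rightarrow> nat \<Rightarrow> 'a set \<Rightarrow> 'a \<Rightarrow> bool" where
  "free_below C i D q \<longleftrightarrow> (\<forall>x \<in> D. anc q x) \<or>
     (\<exists>j g. j < length C \<and> j \<noteq> i \<and> g \<in> pverts G \<and> g \<noteq> root \<and> par g = C ! j \<and> anc g q \<and>
       (\<forall>x \<in> D. anc g x \<longrightarrow> anc q x))"

lemma near_1_l: "may_move G u v \<Longrightarrow> near G l u v"
  using near_mono[of G 1 u v l] l_pos by (simp add: near_Suc)

text \<open>The cop gets closer to everything below \<open>q\<close>, so a vertex that he loses from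
  sight lies outside that subtree. If it borders on \<open>D\<close>, neither it nor its neighbour
  in \<open>D\<close> is below \<open>g\<close>; a walk from the cop to it passes the guard at
  \<open>par g\<close>, who therefore sees it as well.\<close>

lemma move_down:
  assumes st: "stable C D" and i: "i < length C"
    and q: "q \<in> pverts G" "q \<noteq> root" "par q = C ! i" and free: "free_below C i D q"
  shows "mono_step (C, D) (C[i := q], D - seen (C[i := q]))"
    and "stable (C[i := q]) (D - seen (C[i := q]))"
proof -
  let ?p = "C ! i"
  obtain n where n: "l = Suc n" using l_pos by (cases l) auto
  have pV: "?p \<in> pverts G" using q par_in_verts by metis
  have mv: "may_move G ?p q" using q pV by (auto simp: may_move_def arc_iff)
  have nq: "\<not> anc q ?p" using anc_height[of q ?p] height_par[OF q(1,2)] q(3) pV by auto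
  have "v \<in> seen (C[i := q])"
    if w: "w \<in> D" "may_move G w v" "v \<notin> D" "near G l ?p v" "\<not> near G l q v" for v w
  proof -
    have wV: "w \<in> pverts G" using st w by (auto simp: stable_def)
    have vq: "\<not> anc q v"
    proof
      assume "anc q v"
      then have "near G n q v" using near_enter_subtree[of n ?p v q] w(4) pV nq n by auto
      then show False using w(5) near_mono n by fastforce
    qed
    have "\<not> anc q w"
    proof
      assume "anc q w"
      then have "v = ?p" using anc_arc[OF w(2) wV] vq q by auto
      then show False using w(5) near_1_l mv may_move_sym by blast
    qed
    then obtain j g where j: "j < length C" "j \<noteq> i" and g: "g \<in> pverts G" "g \<noteq> root"
      "par g = C ! j" "anc g q" "\<not> anc g w"
      using free w(1) unfolding free_below_def by blast
    have gs: "C ! j \<in> seen C" using in_seen j by simp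
    have "\<not> anc g v"
    proof
      assume "anc g v"
      then have "w = par g"
        using anc_arc[of v w g] g w(2) wV may_move_sym may_move_in_verts by blast
      then show False using gs g w(1) st unfolding stable_def by auto
    qed
    have "near G l (C ! j) v"
    proof (cases "anc g ?p")
      case True
      then have "near G n (par g) v"
        using near_leave_subtree[of n ?p v g] w(4) n pV \<open>\<not> anc g v\<close> by auto
      then show ?thesis using g(3) near_mono n by fastforce
    next
      case False
      then have "g = q" using g(4) anc_par_iff[OF q(1,2)] q(3) by auto
      then show ?thesis using g(3) q(3) w(4) by simp
    qed
    moreover have "C ! j \<in> set (C[i := q])"
      using j by (metis nth_list_update_neq length_list_update nth_mem)
    ultimately show ?thesis by (auto simp: seen_def)
  qed
  then show "mono_step (C, D) (C[i := q], D - seen (C[i := q]))"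
    and "stable (C[i := q]) (D - seen (C[i := q]))"
    using move_one_cop[OF st i mv] by blast+
qed

text \<open>A climbing cop loses sight only of vertices below his old position. As \<open>D\<close>
  is disjoint from that subtree, the only one of them that can border on \<open>D\<close> is the old
  position itself, and it stays in view.\<close>

lemma move_up:
  assumes st: "stable C D" and i: "i < length C" and nr: "C ! i \<noteq> root"
    and clean: "\<And>x. x \<in> D \<Longrightarrow> \<not> anc (C ! i) x"
  shows "mono_step (C, D) (C[i := par (C ! i)], D - seen (C[i := par (C ! i)]))"
    and "stable (C[i := par (C ! i)]) (D - seen (C[i := par (C ! i)]))"
proof -
  let ?p = "C ! i"
  obtain n where n: "l = Suc n" using l_pos by (cases l) auto
  have pV: "?p \<in> pverts G" using st i by (auto simp: stable_def)
  have mv: "may_move G ?p (par ?p)" using nr pV par_in_verts by (auto simp: may_move_def arc_iff)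
  have False
    if w: "w \<in> D" "may_move G w v" "v \<notin> D" "near G l ?p v" "\<not> near G l (par ?p) v" for v w
  proof -
    have wV: "w \<in> pverts G" using st w by (auto simp: stable_def)
    have "anc ?p v"
    proof (rule ccontr)
      assume "\<not> anc ?p v"
      then have "near G n (par ?p) v" using near_leave_subtree[of n ?p v ?p] w(4) pV n by auto
      then show False using w(5) near_mono n by fastforce
    qed
    then have "v = ?p"
      using anc_arc[of v w ?p] clean[OF w(1)] w(2) wV may_move_sym may_move_in_verts by blast
    then show False using w(5) near_1_l mv may_move_sym by blast
  qed
  then show "mono_step (C, D) (C[i := par ?p], D - seen (C[i := par ?p]))"
    and "stable (C[i := par ?p]) (D - seen (C[i := par ?p]))"
    using move_one_cop[OF st i mv] by blast+
qed

definition clears_to :: "'a list \<Rightarrow> 'a set \<Rightarrow> 'a list \<Rightarrow> 'a set \<Rightarrow> bool" where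
  "clears_to C D C' D' \<longleftrightarrow> mono_step\<^sup>*\<^sup>* (C, D) (C', D') \<and> stable C' D' \<and> D' \<subseteq> D"

lemma clears_to_refl: "stable C D \<Longrightarrow> clears_to C D C D"
  by (simp add: clears_to_def)

lemma clears_to_trans: "clears_to C D C' D' \<Longrightarrow> clears_to C' D' C'' D'' \<Longrightarrow> clears_to C D C'' D''"
  unfolding clears_to_def by (auto intro: rtranclp_trans)

lemma clears_to_down:
  assumes "stable C D" "i < length C" "q \<in> pverts G" "q \<noteq> root" "par q = C ! i" "free_below C i D q"
  shows "clears_to C D (C[i := q]) (D - seen (C[i := q]))"
  using move_down[OF assms] by (auto simp: clears_to_def)

lemma clears_to_up:
  assumes "stable C D" "i < length C" "C ! i \<noteq> root" "\<And>x. x \<in> D \<Longrightarrow> \<not> anc (C ! i) x"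
  shows "clears_to C D (C[i := par (C ! i)]) (D - seen (C[i := par (C ! i)]))"
  using move_up[OF assms] by (auto simp: clears_to_def)

end

context subdivided
begin

section \<open>Moving cops along subdivided edges\<close>

definition branch :: "bool \<Rightarrow> bool list \<Rightarrow> bool list sd_vertex set" where
  "branch b xs = {x. anc (pt b xs 1) x}"

lemma pt_inner_inj:
  assumes "pt b' ys i = pt b xs d" "0 < d" "d < L"
  shows "b' = b \<and> ys = xs \<and> i = d"
  using assms by (auto simp: pt_conv split: if_splits)

lemma pt_start_inj: "pt b ys i = Original u \<Longrightarrow> i < L \<Longrightarrow> i = 0 \<and> ys = u"
  by (auto simp: pt_conv split: if_splits)

lemma anc_pt_Suc:
  assumes "anc (pt b xs d) x" "x \<noteq> pt b xs d" "x \<in> pverts T" "0 < d" "d < L"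
  shows "anc (pt b xs (Suc d)) x"
proof -
  obtain c' where c': "c' \<in> pverts T" "c' \<noteq> Original []" "parent c' = pt b xs d" "anc c' x"
    using child_towards[OF assms(1) _ assms(3)] assms(2) by blast
  obtain b' ys i where "i < L" "c' = pt b' ys (Suc i)" using verts_cases[OF c'(1,2)] by metis
  then have "c' = pt b xs (Suc d)" using pt_inner_inj[of b' ys i b xs d] parent_pt c'(3) assms by auto
  then show ?thesis using c' by simp
qed

lemma anc_Original_child:
  assumes "anc (Original u) x" "x \<noteq> Original u" "x \<in> pverts T"
  shows "\<exists>b. x \<in> branch b u \<and> length u < 3"
proof -
  obtain c' where c': "c' \<in> pverts T" "c' \<noteq> Original []" "parent c' = Original u" "anc c' x"
    using child_towards[OF assms(1) _ assms(3)] assms(2) by blast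
  obtain b' ys i where i: "i < L" "c' = pt b' ys (Suc i)" "length ys < 3"
    using verts_cases[OF c'(1,2)] by metis
  then have "i = 0 \<and> ys = u" using pt_start_inj[of b' ys i u] parent_pt c'(3) by auto
  then show ?thesis using c' i by (auto simp: branch_def)
qed

lemma anc_leaf: "anc (Original ys) x \<Longrightarrow> length ys = 3 \<Longrightarrow> x \<in> pverts T \<Longrightarrow> x = Original ys"
  using anc_Original_child by fastforce

lemma anc_pt_pt: "length xs < 3 \<Longrightarrow> i \<le> j \<Longrightarrow> j \<le> L \<Longrightarrow> anc (pt b xs i) (pt b xs j)"
proof (induction j)
  case (Suc j)
  show ?case
  proof (cases "i = Suc j")
    case False
    then have "anc (pt b xs i) (parent (pt b xs (Suc j)))" using Suc parent_pt by simp
    then show ?thesis using anc_par_iff pt_in_verts pt_Suc_neq_root Suc.prems by blast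
  qed simp
qed simp

text \<open>Whatever remains dirty in the branch lies below the cop at every point of the descent,
  so the condition \<open>free_below\<close> at the first point of the edge carries over to each
  later one.\<close>

lemma descend:
  assumes xs: "length xs < 3" and st: "stable C D" and i: "i < length C"
    and Ci: "C ! i = Original xs" and free: "free_below C i D (pt b xs 1)"
    and C': "C' = C[i := Original (b # xs)]"
  shows "\<exists>D'. clears_to C D C' D' \<and>
    (\<forall>x \<in> D'. x \<in> branch b xs \<longrightarrow> anc (Original (b # xs)) x \<and> x \<noteq> Original (b # xs))"
proof -
  have "\<exists>D'. clears_to C D (C[i := pt b xs d]) D' \<and>
    (\<forall>x \<in> D'. x \<in> branch b xs \<longrightarrow> anc (pt b xs d) x \<and> x \<noteq> pt b xs d)"
    if "1 \<le> d" "d \<le> L" for d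
    using that
  proof (induction d rule: dec_induct)
    case base
    have "clears_to C D (C[i := pt b xs 1]) (D - seen (C[i := pt b xs 1]))"
      by (rule clears_to_down[OF st i _ _ _ free])
        (use xs Ci parent_pt[of 0] pt_in_verts[of xs 1] pt_Suc_neq_root[of b xs 0] base in auto)
    moreover have "pt b xs 1 \<in> seen (C[i := pt b xs 1])"
      using i by (intro in_seen) (simp add: set_update_memI)
    ultimately show ?case by (fastforce simp: branch_def)
  next
    case (step d)
    then obtain D1 where D1: "clears_to C D (C[i := pt b xs d]) D1"
      "\<And>x. x \<in> D1 \<Longrightarrow> x \<in> branch b xs \<Longrightarrow> anc (pt b xs d) x \<and> x \<noteq> pt b xs d" by auto
    let ?C = "C[i := pt b xs d]" and ?q = "pt b xs (Suc d)"
    have st1: "stable ?C D1" and sub: "D1 \<subseteq> D" using D1(1) by (auto simp: clears_to_def)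
    have br: "anc ?q x" if "x \<in> D1" "anc (pt b xs 1) x" for x
      using anc_pt_Suc[of b xs d x] D1(2)[of x] that st1 step.hyps step.prems
      by (auto simp: branch_def stable_def)
    have free': "free_below ?C i D1 ?q"
      using free unfolding free_below_def
    proof (elim disjE exE conjE)
      assume "\<forall>x \<in> D. anc (pt b xs 1) x"
      then show "(\<forall>x \<in> D1. anc ?q x) \<or> (\<exists>j g. j < length ?C \<and> j \<noteq> i \<and> g \<in> pverts T \<and>
          g \<noteq> Original [] \<and> parent g = ?C ! j \<and> anc g ?q \<and> (\<forall>x \<in> D1. anc g x \<longrightarrow> anc ?q x))"
        using br sub by blast
    next
      fix j g
      assume j: "j < length C" "j \<noteq> i" "g \<in> pverts T" "g \<noteq> Original []" "parent g = C ! j"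
        "anc g (pt b xs 1)" "\<forall>x \<in> D. anc g x \<longrightarrow> anc (pt b xs 1) x"
      moreover have "anc g ?q"
        using anc_trans[OF j(6) anc_pt_pt[OF xs, of 1 "Suc d"]] step pt_in_verts[OF xs] by simp
      ultimately show "(\<forall>x \<in> D1. anc ?q x) \<or> (\<exists>j g. j < length ?C \<and> j \<noteq> i \<and> g \<in> pverts T \<and>
          g \<noteq> Original [] \<and> parent g = ?C ! j \<and> anc g ?q \<and> (\<forall>x \<in> D1. anc g x \<longrightarrow> anc ?q x))"
        using br sub by (intro disjI2 exI[of _ j] exI[of _ g]) auto
    qed
    have c: "clears_to ?C D1 (?C[i := ?q]) (D1 - seen (?C[i := ?q]))"
      by (rule clears_to_down[OF st1 _ _ _ _ free'])
        (use i xs step parent_pt pt_in_verts pt_Suc_neq_root in auto)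
    have "?q \<in> seen (?C[i := ?q])" using i by (intro in_seen) (simp add: set_update_memI)
    then show ?case
      using clears_to_trans[OF D1(1) c] br by (fastforce simp: branch_def)
  qed
  from this[of L] show ?thesis using C' L_gt by simp
qed

text \<open>The subtree below the cop is clean at the start and grows only by vertices that he has
  just seen, so it stays clean during the climb.\<close>

lemma ascend:
  assumes xs: "length xs < 3" and st: "stable C D" and i: "i < length C"
    and Ci: "C ! i = Original (b # xs)" and clean: "\<And>x. x \<in> D \<Longrightarrow> \<not> anc (Original (b # xs)) x"
    and C': "C' = C[i := Original xs]"
  shows "\<exists>D'. clears_to C D C' D' \<and> D' \<inter> branch b xs = {}"
proof -
  have L0: "0 < L" by (simp add: L_def)
  have start: "\<exists>D'. clears_to C D (C[i := pt b xs d]) D' \<and> (\<forall>x \<in> D'. \<not> anc (pt b xs d) x)"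
    if "d \<le> L" "1 \<le> d" for d
    using that
  proof (induction d rule: inc_induct)
    case base
    have "C[i := pt b xs L] = C" using Ci by (metis list_update_id pt_L)
    then show ?case using clears_to_refl[OF st] clean by auto
  next
    case (step d)
    then obtain D1 where D1: "clears_to C D (C[i := pt b xs (Suc d)]) D1"
      "\<And>x. x \<in> D1 \<Longrightarrow> \<not> anc (pt b xs (Suc d)) x" by auto
    let ?C = "C[i := pt b xs (Suc d)]"
    have st1: "stable ?C D1" using D1(1) by (auto simp: clears_to_def)
    have "clears_to ?C D1 (?C[i := parent (?C ! i)]) (D1 - seen (?C[i := parent (?C ! i)]))"
      by (rule clears_to_up[OF st1]) (use i D1(2) pt_Suc_neq_root in auto)
    then have c: "clears_to ?C D1 (C[i := pt b xs d]) (D1 - seen (C[i := pt b xs d]))"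
      using i parent_pt step.hyps by simp
    have seen: "pt b xs d \<in> seen (C[i := pt b xs d])"
      using i by (intro in_seen) (simp add: set_update_memI)
    have "\<not> anc (pt b xs d) x" if "x \<in> D1 - seen (C[i := pt b xs d])" for x
      using anc_pt_Suc[of b xs d x] D1(2)[of x] st1 seen that step by (auto simp: stable_def)
    then show ?case using clears_to_trans[OF D1(1) c] by blast
  qed
  from this[of 1] L0 obtain D1 where D1: "clears_to C D (C[i := pt b xs 1]) D1"
      "\<And>x. x \<in> D1 \<Longrightarrow> \<not> anc (pt b xs 1) x" by auto
  let ?C = "C[i := pt b xs 1]"
  have st1: "stable ?C D1" using D1(1) by (auto simp: clears_to_def)
  have "clears_to ?C D1 (?C[i := parent (?C ! i)]) (D1 - seen (?C[i := parent (?C ! i)]))"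
    by (rule clears_to_up[OF st1]) (use i D1(2) pt_Suc_neq_root[of b xs 0] in auto)
  then have "clears_to ?C D1 C' (D1 - seen C')"
    using i parent_pt[OF L0] C' by simp
  then show ?thesis using clears_to_trans[OF D1(1)] D1(2) by (auto simp: branch_def)
qed

lemma free_below_guard:
  assumes "length xs < 3" "j < length C" "j \<noteq> i" "C ! j = Original xs"
  shows "free_below C i D (pt b xs 1)"
  unfolding free_below_def
  using assms pt_in_verts[of xs 1 b] pt_Suc_neq_root[of b xs 0] parent_pt[of 0 b xs]
  by (intro disjI2 exI[of _ j] exI[of _ "pt b xs 1"]) (auto simp: L_def)

lemma rtranclp_mono_step: "clears_to C D C' D' \<Longrightarrow> mono_step \<le> R \<Longrightarrow> R\<^sup>*\<^sup>* (C, D) (C', D')"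
  using rtranclp_mono[of mono_step R] unfolding clears_to_def by blast

text \<open>The cops travel one after another, and \<open>k\<close> counts those who have arrived.
  Each journey yields \<open>Q\<close>, which is therefore claimed from the first arrival
  on.\<close>

lemma move_all:
  assumes step: "\<And>C D i. stable C D \<Longrightarrow> D \<subseteq> D0 \<Longrightarrow> i < length C \<Longrightarrow> C ! i = x \<Longrightarrow>
      \<exists>D'. clears_to C D (C[i := y]) D' \<and> Q D'"
    and mono: "\<And>D D'. Q D \<Longrightarrow> D' \<subseteq> D \<Longrightarrow> Q D'"
    and st: "stable (replicate n x) D0" and n: "0 < n"
  shows "\<exists>D'. clears_to (replicate n x) D0 (replicate n y) D' \<and> Q D'"
proof -
  have "\<exists>D'. clears_to (replicate n x) D0 (replicate k y @ replicate (n - k) x) D' \<and> (k = 0 \<or> Q D')"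
    if "k \<le> n" for k
    using that
  proof (induction k)
    case 0
    then show ?case using clears_to_refl[OF st] by auto
  next
    case (Suc k)
    let ?C = "replicate k y @ replicate (n - k) x"
    obtain D1 where D1: "clears_to (replicate n x) D0 ?C D1" using Suc by auto
    have nk: "replicate (n - k) x = x # replicate (n - Suc k) x"
      using Suc.prems by (metis Suc_diff_Suc Suc_le_lessD replicate_Suc)
    have C: "?C ! k = x" "?C[k := y] = replicate (Suc k) y @ replicate (n - Suc k) x"
      unfolding nk by (simp_all add: nth_append list_update_append replicate_app_Cons_same)
    have "\<exists>D'. clears_to ?C D1 (?C[k := y]) D' \<and> Q D'"
      by (rule step) (use D1 C Suc.prems in \<open>auto simp: clears_to_def\<close>)
    then show ?case using clears_to_trans[OF D1] C by fastforce
  qed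
  from this[of n] show ?thesis using n by simp
qed

text \<open>The common frame of both upper bounds, with \<open>R\<close> instantiated by
  \<open>clear_step\<close> or \<open>mono_step\<close>. The passage through the root can be made by
  all cops without leaving a guard: nothing dirty is left below the child that they come from, and
  everything still dirty lies below the child that they go to.\<close>

lemma sweep:
  assumes R: "mono_step \<le> R" and n: "0 < n"
    and clear_branch: "\<And>xs b D. length xs = 1 \<Longrightarrow> stable (replicate n (Original xs)) D \<Longrightarrow>
      \<exists>D'. R\<^sup>*\<^sup>* (replicate n (Original xs), D) (replicate n (Original xs), D') \<and>
        stable (replicate n (Original xs)) D' \<and> D' \<subseteq> D \<and> D' \<inter> branch b xs = {}"
  shows "\<exists>C C'. set C \<subseteq> pverts T \<and> length C = n \<and> R\<^sup>*\<^sup>* (C, pverts T - seen C) (C', {})"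
proof -
  let ?C = "\<lambda>xs. replicate n (Original xs :: bool list sd_vertex)"
  have V: "set (?C xs) \<subseteq> pverts T" if "length xs \<le> 3" for xs :: "bool list"
    using that by (auto simp: Original_in_verts)
  have nin: "Original xs \<notin> D" if "stable (?C xs) D" for xs D
    using that in_seen[of "Original xs" "?C xs"] n by (auto simp: stable_def)
  have both: "\<exists>D'. R\<^sup>*\<^sup>* (?C xs, D) (?C xs, D') \<and> stable (?C xs) D' \<and> D' \<subseteq> D \<and>
      (\<forall>x \<in> D'. \<not> anc (Original xs) x)"
    if xs: "length xs = 1" and st: "stable (?C xs) D" for xs D
  proof -
    obtain D1 where D1: "R\<^sup>*\<^sup>* (?C xs, D) (?C xs, D1)" "stable (?C xs) D1" "D1 \<subseteq> D"
      "D1 \<inter> branch True xs = {}"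
      using clear_branch[OF xs st] by blast
    obtain D2 where D2: "R\<^sup>*\<^sup>* (?C xs, D1) (?C xs, D2)" "stable (?C xs) D2" "D2 \<subseteq> D1"
      "D2 \<inter> branch False xs = {}"
      using clear_branch[OF xs D1(2)] by blast
    have "\<not> anc (Original xs) x" if "x \<in> D2" for x
    proof
      assume "anc (Original xs) x"
      moreover have "x \<noteq> Original xs" "x \<in> pverts T"
        using that nin[OF D2(2)] D2(2) by (auto simp: stable_def)
      ultimately obtain b where "x \<in> branch b xs" using anc_Original_child by blast
      then show False using that D1(4) D2(3,4) by (cases b) auto
    qed
    then show ?thesis using D1 D2 by (meson order_trans rtranclp_trans)
  qed
  let ?D0 = "pverts T - seen (?C [False])"
  obtain D1 where D1: "R\<^sup>*\<^sup>* (?C [False], ?D0) (?C [False], D1)" "stable (?C [False]) D1"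
    "\<And>x. x \<in> D1 \<Longrightarrow> \<not> anc (Original [False]) x"
    using both[of "[False]" ?D0] stable_start[OF V[of "[False]"]] by fastforce
  have "\<exists>D'. clears_to (?C [False]) D1 (?C []) D' \<and> D' \<inter> branch False [] = {}"
    by (rule move_all[OF _ _ D1(2) n]) (use D1(3) in \<open>auto intro!: ascend\<close>)
  then obtain D2 where D2: "clears_to (?C [False]) D1 (?C []) D2" "D2 \<inter> branch False [] = {}" by blast
  then have st2: "stable (?C []) D2" by (simp add: clears_to_def)
  have br: "x \<in> branch True []" if "x \<in> D2" for x
  proof -
    have "x \<noteq> Original []" "x \<in> pverts T" using that nin[OF st2] st2 by (auto simp: stable_def)
    then obtain b where "x \<in> branch b []" using anc_Original_child anc_root by blast
    then show ?thesis using that D2(2) by (cases b) auto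
  qed
  let ?Q = "\<lambda>D. \<forall>x \<in> D. x \<in> branch True [] \<longrightarrow> anc (Original [True]) x \<and> x \<noteq> Original [True]"
  have "\<exists>D'. clears_to (?C []) D2 (?C [True]) D' \<and> ?Q D'"
  proof (rule move_all[OF _ _ st2 n])
    fix C D i
    assume "stable C D" "D \<subseteq> D2" "i < length C" "C ! i = Original []"
    then show "\<exists>D'. clears_to C D (C[i := Original [True]]) D' \<and> ?Q D'"
      by (intro descend) (use br in \<open>auto simp: free_below_def branch_def\<close>)
  qed blast
  then obtain D3 where D3: "clears_to (?C []) D2 (?C [True]) D3" "?Q D3" by blast
  then have st3: "stable (?C [True]) D3" by (simp add: clears_to_def)
  obtain D4 where D4: "R\<^sup>*\<^sup>* (?C [True], D3) (?C [True], D4)" "D4 \<subseteq> D3"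
    "\<And>x. x \<in> D4 \<Longrightarrow> \<not> anc (Original [True]) x"
    using both[OF _ st3] by auto
  have "D4 = {}" using D4(2,3) D3 br unfolding clears_to_def by blast
  moreover have "R\<^sup>*\<^sup>* (?C [False], ?D0) (?C [True], D4)"
    using D1(1) rtranclp_mono_step[OF D2(1) R] rtranclp_mono_step[OF D3(1) R] D4(1)
    by (meson rtranclp_trans)
  ultimately show ?thesis using V[of "[False]"] by fastforce
qed

text \<open>One cop remains at \<open>Original xs\<close>, one holds the centre of the spider, and
  the third descends into each leg in turn. The centre is never given up, so nothing escapes from
  the leg not yet cleared.\<close>

lemma clear_branch_three:
  assumes xs: "length xs = 1" and st: "stable (replicate 3 (Original xs)) D"
  shows "\<exists>D'. mono_step\<^sup>*\<^sup>* (replicate 3 (Original xs), D) (replicate 3 (Original xs), D') \<and>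
    stable (replicate 3 (Original xs)) D' \<and> D' \<subseteq> D \<and> D' \<inter> branch b xs = {}"
proof -
  let ?a = "Original xs" and ?u = "b # xs"
  let ?U = "Original ?u"
  have rep: "replicate 3 ?a = [?a, ?a, ?a]" by (simp add: numeral_3_eq_3)
  have stc: "stable C' D'" "D' \<subseteq> D1" if "clears_to C D1 C' D'" for C C' D1 D'
    using that by (auto simp: clears_to_def)
  obtain D1 where D1: "clears_to [?a, ?a, ?a] D [?a, ?a, ?U] D1"
    using descend[of xs "[?a, ?a, ?a]" D 2 b "[?a, ?a, ?U]"] free_below_guard[of xs 0 "[?a, ?a, ?a]" 2 D b]
      st xs unfolding rep by (auto simp: numeral_2_eq_2)
  obtain D2 where D2: "clears_to [?a, ?a, ?U] D1 [?a, ?U, ?U] D2"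
    "\<And>x. x \<in> D2 \<Longrightarrow> x \<in> branch b xs \<Longrightarrow> anc ?U x \<and> x \<noteq> ?U"
    using descend[of xs "[?a, ?a, ?U]" D1 1 b "[?a, ?U, ?U]"] free_below_guard[of xs 0 "[?a, ?a, ?U]" 1 D1 b]
      stc[OF D1] xs by auto
  have leg: "\<exists>D'. clears_to [?a, ?U, ?U] D1 [?a, ?U, ?U] D' \<and> D' \<inter> branch c ?u = {}"
    if st1: "stable [?a, ?U, ?U] D1" for D1 c
  proof -
    obtain D2 where D2: "clears_to [?a, ?U, ?U] D1 [?a, Original (c # ?u), ?U] D2"
      "\<And>x. x \<in> D2 \<Longrightarrow> x \<in> branch c ?u \<Longrightarrow> anc (Original (c # ?u)) x \<and> x \<noteq> Original (c # ?u)"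
      using descend[of ?u "[?a, ?U, ?U]" D1 1 c "[?a, Original (c # ?u), ?U]"]
        free_below_guard[of ?u 2 "[?a, ?U, ?U]" 1 D1 c] st1 xs by (auto simp: numeral_2_eq_2)
    have "\<not> anc (Original (c # ?u)) x" if "x \<in> D2" for x
    proof
      assume a: "anc (Original (c # ?u)) x"
      have x: "x \<in> pverts T" using that stc[OF D2(1)] by (auto simp: stable_def)
      have "anc (pt c ?u 1) (Original (c # ?u))"
        using anc_pt_pt[of ?u 1 L c] xs L_gt by simp
      then have "x \<in> branch c ?u" unfolding branch_def using anc_trans[OF _ a x] by blast
      then show False using D2(2)[OF that] anc_leaf[OF a _ x] xs by simp
    qed
    then obtain D3 where D3: "clears_to [?a, Original (c # ?u), ?U] D2 [?a, ?U, ?U] D3"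
      "D3 \<inter> branch c ?u = {}"
      using ascend[of ?u "[?a, Original (c # ?u), ?U]" D2 1 c "[?a, ?U, ?U]"] stc[OF D2(1)] xs by auto
    then show ?thesis using clears_to_trans[OF D2(1)] by blast
  qed
  obtain D3 where D3: "clears_to [?a, ?U, ?U] D2 [?a, ?U, ?U] D3" "D3 \<inter> branch True ?u = {}"
    using leg stc[OF D2(1)] by blast
  obtain D4 where D4: "clears_to [?a, ?U, ?U] D3 [?a, ?U, ?U] D4" "D4 \<inter> branch False ?u = {}"
    using leg stc[OF D3(1)] by blast
  have clean: "\<not> anc ?U x" if "x \<in> D4" for x
  proof
    assume a: "anc ?U x"
    have x: "x \<in> pverts T" using that stc[OF D4(1)] by (auto simp: stable_def)
    have "anc (pt b xs 1) ?U" using anc_pt_pt[of xs 1 L b] xs L_gt by simp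
    then have "x \<in> branch b xs" unfolding branch_def using anc_trans[OF _ a x] by blast
    then have "x \<noteq> ?U" using D2(2)[of x] that stc[OF D3(1)] stc[OF D4(1)] by blast
    then obtain c where "x \<in> branch c ?u" using anc_Original_child[OF a _ x] by blast
    then show False using D3(2) D4(2) that stc(2)[OF D4(1)] by (cases c) auto
  qed
  obtain D5 where D5: "clears_to [?a, ?U, ?U] D4 [?a, ?a, ?U] D5"
    using ascend[of xs "[?a, ?U, ?U]" D4 1 b "[?a, ?a, ?U]"] stc[OF D4(1)] xs clean by auto
  obtain D6 where D6: "clears_to [?a, ?a, ?U] D5 [?a, ?a, ?a] D6" "D6 \<inter> branch b xs = {}"
    using ascend[of xs "[?a, ?a, ?U]" D5 2 b "[?a, ?a, ?a]"] stc[OF D5] xs clean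
    by (auto simp: numeral_2_eq_2)
  have "clears_to [?a, ?a, ?a] D [?a, ?a, ?a] D6"
    using D1 D2(1) D3(1) D4(1) D5 D6(1) by (meson clears_to_trans)
  then show ?thesis unfolding rep clears_to_def using D6(2) by blast
qed

lemma monotonic_three_cops: "\<exists>\<sigma>. winning_strategy l T 3 \<sigma> \<and> monotonic_strategy l T \<sigma>"
proof -
  obtain C C' where C: "set C \<subseteq> pverts T" "length C = 3"
    "mono_step\<^sup>*\<^sup>* (C, pverts T - seen C) (C', {})"
    using sweep[OF order_refl, of 3] clear_branch_three by auto
  then have "C \<noteq> []" by auto
  from mono_wins[OF C(3,1) this] C(2) show ?thesis by simp
qed

section \<open>Two cops clear a spider\<close>

lemma near_leg_same:
  assumes "length xs = 1" "s \<le> L" "d \<le> L" "s \<le> d + n" "d \<le> s + n"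
  shows "near T n (leg b xs m s) (leg b xs m d)"
proof (cases m)
  case None
  have "near T n (pt b xs (L - s)) (pt b xs (L - d))"
    by (rule near_pt) (use assms in linarith)+
  then show ?thesis using None by simp
next
  case (Some c)
  have "near T n (pt c (b # xs) s) (pt c (b # xs) d)"
    by (rule near_pt) (use assms in simp_all)
  then show ?thesis using Some by simp
qed

lemma near_leg:
  assumes "length xs = 1" "s \<le> L" "d \<le> L" "s + d \<le> n"
  shows "near T n (leg b xs m s) (leg b xs m' d)"
proof -
  have "near T s (leg b xs m s) (leg b xs m 0)"
    by (rule near_leg_same) (use assms in simp_all)
  moreover have "near T d (leg b xs m 0) (leg b xs m' d)"
    unfolding leg_0[of b xs m] leg_0[of b xs m', symmetric]
    by (rule near_leg_same) (use assms in simp_all)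
  ultimately have "near T (s + d) (leg b xs m s) (leg b xs m' d)" by (rule near_trans)
  then show ?thesis using assms(4) by (rule near_mono)
qed

lemma leg_neighbours:
  assumes "length xs = 1" "d \<le> L" "may_move T (leg b xs m d) w"
  shows "w = leg b xs m d \<or> 0 < d \<and> w = leg b xs m (d - 1) \<or> d < L \<and> w = leg b xs m (Suc d) \<or>
    d = 0 \<and> (\<exists>m'. w = leg b xs m' 1) \<or> m = None \<and> d = L"
proof (cases "w = leg b xs m d \<or> m = None \<and> d = L")
  case False
  then have "(leg b xs m d, w) \<in> parcs T" using assms(3) by (auto simp: may_move_def)
  then obtain c ys i where i: "length ys < 3" "i < L" and
    e: "leg b xs m d = pt c ys i \<and> w = pt c ys (Suc i) \<or> w = pt c ys i \<and> leg b xs m d = pt c ys (Suc i)"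
    unfolding arcs_iff by blast
  show ?thesis
  proof (cases "d = 0")
    case True
    have up: "c = b \<and> ys = xs \<and> i = L - 1" if "Original (b # xs) = pt c ys (Suc i)"
      using that i(2) by (auto simp: pt_conv split: if_splits)
    have "\<exists>m'. w = leg b xs m' 1"
      using e
    proof
      assume a: "leg b xs m d = pt c ys i \<and> w = pt c ys (Suc i)"
      then have "i = 0 \<and> ys = b # xs" using pt_start_inj[of c ys i "b # xs"] i True leg_0 by simp
      then show ?thesis using a by (intro exI[of _ "Some c"]) simp
    next
      assume a: "w = pt c ys i \<and> leg b xs m d = pt c ys (Suc i)"
      then show ?thesis using up True leg_0 by (intro exI[of _ None]) simp
    qed
    then show ?thesis using True by blast
  next
    case d: False
    show ?thesis
    proof (cases m)
      case None
      then have dL: "0 < L - d" "L - d < L" using False d assms(2) by auto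
      show ?thesis using e
      proof
        assume a: "leg b xs m d = pt c ys i \<and> w = pt c ys (Suc i)"
        then have "c = b \<and> ys = xs \<and> i = L - d" using pt_inner_inj[of c ys i b xs, OF _ dL] None by simp
        moreover from this have "Suc i = L - (d - 1)" using d assms(2) by simp
        ultimately show ?thesis using a None d by simp
      next
        assume a: "w = pt c ys i \<and> leg b xs m d = pt c ys (Suc i)"
        then have "c = b \<and> ys = xs \<and> Suc i = L - d"
          using pt_inner_inj[of c ys "Suc i" b xs, OF _ dL] None by simp
        moreover from this have "i = L - Suc d" "d < L" by auto
        ultimately show ?thesis using a None by simp
      qed
    next
      case (Some f)
      show ?thesis
      proof (cases "d = L")
        case True
        then have o: "leg b xs m d = Original (f # b # xs)" using Some by simp
        show ?thesis using e
        proof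
          assume "leg b xs m d = pt c ys i \<and> w = pt c ys (Suc i)"
          then have "ys = f # b # xs" using pt_start_inj[of c ys i] o i by simp
          then show ?thesis using i assms(1) by simp
        next
          assume a: "w = pt c ys i \<and> leg b xs m d = pt c ys (Suc i)"
          then have "c = f \<and> ys = b # xs \<and> i = L - 1"
            using o i by (auto simp: pt_conv split: if_splits)
          then show ?thesis using a True Some d by simp
        qed
      next
        case dL: False
        then have dL: "0 < d" "d < L" using d assms(2) by auto
        show ?thesis using e
        proof
          assume a: "leg b xs m d = pt c ys i \<and> w = pt c ys (Suc i)"
          then have "c = f \<and> ys = b # xs \<and> i = d"
            using pt_inner_inj[of c ys i f "b # xs", OF _ dL] Some by simp
          then show ?thesis using a Some dL by simp
        next
          assume a: "w = pt c ys i \<and> leg b xs m d = pt c ys (Suc i)"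
          then have "c = f \<and> ys = b # xs \<and> Suc i = d"
            using pt_inner_inj[of c ys "Suc i" f "b # xs", OF _ dL] Some by simp
          then show ?thesis using a Some by auto
        qed
      qed
    qed
  qed
qed auto

lemma anc_centre_cases:
  assumes u: "length u = 2" and x: "x \<in> pverts T" and a: "anc (Original u) x"
  shows "\<exists>c d. d \<le> L \<and> x = pt c u d"
proof (cases "x = Original u")
  case True
  then show ?thesis by (intro exI[of _ True] exI[of _ 0]) simp
next
  case False
  then obtain c where c: "anc (pt c u 1) x" using anc_Original_child[OF a _ x] by (auto simp: branch_def)
  have "(\<exists>d \<le> L. x = pt c u d) \<or> anc (pt c u d) x" if "1 \<le> d" "d \<le> L" for d
    using that
  proof (induction d rule: dec_induct)
    case (step d)
    show ?case
    proof (cases "x = pt c u d")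
      case True
      then show ?thesis using step.prems by (intro disjI1 exI[of _ d]) simp
    next
      case False
      then show ?thesis using anc_pt_Suc[OF _ False x] step by force
    qed
  qed (use c in simp)
  from this[of L] have "(\<exists>d \<le> L. x = pt c u d) \<or> anc (Original (c # u)) x"
    using L_gt by simp
  then show ?thesis using anc_leaf[OF _ _ x, of "c # u"] u by (metis length_Cons numeral_2_eq_2 numeral_3_eq_3 order_refl pt_L)
qed

text \<open>The vertices of the spider that are certainly in sight when one cop is at \<open>Original xs\<close> and the
  other one at distance \<open>s\<close> from the centre on leg \<open>m0\<close>.\<close>

definition in_view :: "bool option \<Rightarrow> nat \<Rightarrow> bool option \<Rightarrow> nat \<Rightarrow> bool" where
  "in_view m0 s m d \<longleftrightarrow> m = m0 \<and> d \<le> s + l \<and> s \<le> d + l \<or> s + d \<le> l \<or> m = None \<and> l + 2 \<le> d"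

lemma in_view_seen:
  assumes "length xs = 1" "s \<le> L" "d \<le> L" "in_view m0 s m d"
  shows "leg b xs m d \<in> seen [Original xs, leg b xs m0 s]"
proof -
  consider "m = m0" "d \<le> s + l" "s \<le> d + l" | "s + d \<le> l" | "m = None" "l + 2 \<le> d"
    using assms(4) by (auto simp: in_view_def)
  then show ?thesis
  proof cases
    case 1
    then show ?thesis using near_leg_same assms by (auto simp: seen_def)
  next
    case 2
    then show ?thesis using near_leg assms by (auto simp: seen_def)
  next
    case 3
    have "near T l (pt b xs 0) (pt b xs (L - d))"
      by (rule near_pt) (use 3 assms in \<open>auto simp: L_def\<close>)
    then show ?thesis using 3 by (auto simp: seen_def)
  qed
qed

context
  fixes xs :: "bool list" and b :: bool and D1 :: "bool list sd_vertex set"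
  assumes xs: "length xs = 1" and st: "stable [Original xs, Original (b # xs)] D1"
begin

definition outside :: "bool list sd_vertex set" where
  "outside = {x \<in> D1. x \<notin> branch b xs}"

definition dirty :: "(bool option \<Rightarrow> nat \<Rightarrow> bool) \<Rightarrow> bool list sd_vertex set" where
  "dirty P = outside \<union> {leg b xs m d | m d. d \<le> L \<and> P m d}"

text \<open>Whatever a cop at the centre sees outside the branch lies behind
  \<open>Original xs\<close> and is seen from there too. The guard alone contains this part, which
  frees the other cop to move.\<close>

lemma outside_closed:
  assumes v: "v \<in> outside" and vw: "may_move T v w"
  shows "w \<in> outside \<or> near T l (Original xs) w"
proof -
  let ?g = "pt b xs 1"
  have g: "?g \<in> pverts T" "?g \<noteq> Original []" "parent ?g = Original xs"
    using pt_in_verts[of xs 1 b] pt_Suc_neq_root[of b xs 0] parent_pt[of 0 b xs] xs by (auto simp: L_def)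
  have v1: "v \<in> D1" "\<not> anc ?g v" "v \<in> pverts T"
    using v st by (auto simp: outside_def branch_def stable_def)
  have wV: "w \<in> pverts T" using may_move_in_verts vw v1 by blast
  have "Original xs \<in> seen [Original xs, Original (b # xs)]" by (rule in_seen) simp
  then have "v \<noteq> Original xs" using v1 st by (auto simp: stable_def)
  then have nw: "\<not> anc ?g w"
    using anc_arc[of w v ?g] wV vw v1 may_move_sym g by metis
  have "w \<in> D1 \<or> near T l (Original xs) w \<or> near T l (Original (b # xs)) w"
    using st v1 vw by (auto simp: stable_def seen_def)
  moreover have "near T l (Original xs) w" if "near T l (Original (b # xs)) w"
  proof -
    obtain n where n: "l = Suc n" using l_ge_1 by (cases l) auto
    have "anc ?g (Original (b # xs))" using anc_pt_pt[of xs 1 L b] xs L_gt by simp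
    moreover have "near T (Suc n) (Original (b # xs)) w" by (subst n[symmetric]) (rule that)
    moreover have "Original (b # xs) \<in> pverts T" using xs by (simp add: Original_in_verts)
    ultimately have "near T n (parent ?g) w" using near_leave_subtree nw by blast
    then show ?thesis unfolding g(3) by (rule near_mono) (use n in simp)
  qed
  ultimately show ?thesis using nw by (auto simp: outside_def branch_def)
qed

text \<open>Reduces a step of the search to arithmetic on legs and depths. The robber stays, moves
  inwards or outwards, or crosses the centre; the end of the leg towards the root is always in view
  of the guard, so he cannot leave the spider there.\<close>

lemma spider_step:
  assumes s: "s \<le> L" and mv: "may_move T y (leg b xs m0 s)"
    and stay: "\<And>m d. d \<le> L \<Longrightarrow> P m d \<Longrightarrow> \<not> in_view m0 s m d \<Longrightarrow> P' m d"
    and inwards: "\<And>m d. Suc d \<le> L \<Longrightarrow> P m (Suc d) \<Longrightarrow> \<not> in_view m0 s m (Suc d) \<Longrightarrow>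
      \<not> in_view m0 s m d \<Longrightarrow> P' m d"
    and outwards: "\<And>m d. Suc d \<le> L \<Longrightarrow> P m d \<Longrightarrow> \<not> in_view m0 s m d \<Longrightarrow>
      \<not> in_view m0 s m (Suc d) \<Longrightarrow> P' m (Suc d)"
    and across: "\<And>m m'. P m 0 \<Longrightarrow> \<not> in_view m0 s m 0 \<Longrightarrow> \<not> in_view m0 s m' 1 \<Longrightarrow> P' m' 1"
  shows "clear_step ([Original xs, y], dirty P) ([Original xs, leg b xs m0 s], dirty P')"
  unfolding clear_step_iff
proof (intro conjI allI impI)
  show "list_all2 (may_move T) [Original xs, y] [Original xs, leg b xs m0 s]" using mv by simp
next
  fix v w
  let ?C = "[Original xs, leg b xs m0 s]"
  assume v: "v \<in> dirty P" "v \<notin> seen ?C" and vw: "may_move T v w" and w: "w \<notin> seen ?C"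
  have unseen: "\<not> in_view m0 s m d" if "d \<le> L" "leg b xs m d \<notin> seen ?C" for m d
    using in_view_seen[OF xs s that(1)] that(2) by blast
  have dirtyI: "leg b xs m d \<in> dirty P'" if "d \<le> L" "P' m d" for m d
    using that by (auto simp: dirty_def)
  from v(1) consider "v \<in> outside" | m d where "v = leg b xs m d" "d \<le> L" "P m d"
    by (auto simp: dirty_def)
  then show "w \<in> dirty P'"
  proof cases
    case 1
    then show ?thesis using outside_closed[OF _ vw] w by (auto simp: dirty_def seen_def)
  next
    case (2 m d)
    have nv: "\<not> in_view m0 s m d" using unseen 2 v(2) by blast
    have "may_move T (leg b xs m d) w" using vw 2(1) by simp
    from leg_neighbours[OF xs 2(2) this] show ?thesis
    proof (elim disjE conjE exE)
      assume "w = leg b xs m d"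
      then show ?thesis using stay[OF 2(2,3) nv] dirtyI 2(2) by simp
    next
      assume k: "0 < d" "w = leg b xs m (d - 1)"
      then obtain e where e: "d = Suc e" by (cases d) auto
      then have "P' m e" using inwards[of e m] 2 nv unseen[of e m] w k by simp
      then show ?thesis using dirtyI[of e m] 2(2) k e by simp
    next
      assume k: "d < L" "w = leg b xs m (Suc d)"
      then have "P' m (Suc d)" using outwards[of d m] 2 nv unseen[of "Suc d" m] w by simp
      then show ?thesis using dirtyI[of "Suc d" m] k by simp
    next
      fix m' assume k: "d = 0" "w = leg b xs m' 1"
      then have "P' m' 1" using across[of m m'] 2 nv unseen[of 1 m'] w L_gt by simp
      then show ?thesis using dirtyI[of 1 m'] k L_gt by simp
    next
      assume "m = None" "d = L"
      then show ?thesis using nv by (simp add: in_view_def L_def)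
    qed
  qed
qed

text \<open>The cop is at depth \<open>s\<close> of leg \<open>Some True\<close>. The other leg
  becomes dirty up to depth \<open>l + 1 - s\<close> from the centre, as the robber follows the
  receding view.\<close>

definition advancing :: "nat \<Rightarrow> bool option \<Rightarrow> nat \<Rightarrow> bool" where
  "advancing s m d \<longleftrightarrow> m = Some True \<and> l + s < d \<or> m = Some False \<and> l < d + s"

text \<open>The cop is at depth \<open>l + 2\<close> and sees the tip, but not depth 1 behind him.
  On the leg towards the root the bound is generous: everything out of the guard's view, which
  begins at depth \<open>l + 2\<close>.\<close>

definition turning :: "bool option \<Rightarrow> nat \<Rightarrow> bool" where
  "turning m d \<longleftrightarrow> m = Some True \<and> d = 1 \<or> m = Some False \<or> m = None \<and> d < l + 2"

text \<open>The cop is back at depth \<open>s\<close> of the cleared leg and drives the dirt out of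
  the two others. At \<open>s = 0\<close> the leg towards the root keeps only depth
  \<open>l + 1\<close>, the midpoint of its edge.\<close>

definition returning :: "nat \<Rightarrow> bool option \<Rightarrow> nat \<Rightarrow> bool" where
  "returning s m d \<longleftrightarrow> m = Some False \<and> l < d + s \<or> m = None \<and> l < d + s \<and> d < l + 2"

text \<open>One cop stays at \<open>Original xs\<close> while the other one clears a leg of the spider. When he is in
  depth \<open>l + 2\<close>, the robber can leave the other leg towards \<open>Original xs\<close>, which is what breaks
  monotonicity, but he gets caught between the two cops.\<close>

lemma clear_first_leg:
  "clear_step\<^sup>*\<^sup>* ([Original xs, Original (b # xs)], dirty (advancing 0))
     ([Original xs, Original (b # xs)], dirty (\<lambda>m d. m = Some False \<and> l < d))"
proof -
  let ?S = "\<lambda>m s P. ([Original xs, leg b xs m s], dirty P)"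
  let ?T = "Some True"
  have adv: "clear_step\<^sup>*\<^sup>* (?S ?T 0 (advancing 0)) (?S ?T s (advancing s))" if "s \<le> l + 1" for s
    using that
  proof (induction s)
    case (Suc s)
    have "clear_step (?S ?T s (advancing s)) (?S ?T (Suc s) (advancing (Suc s)))"
      by (rule spider_step[OF _ leg_may_move]) (use Suc.prems xs in \<open>auto simp: advancing_def in_view_def L_def\<close>)
    then show ?case using Suc by simp
  qed simp
  have turn: "clear_step (?S ?T (l + 1) (advancing (l + 1))) (?S ?T (l + 2) turning)"
    by (rule spider_step[OF _ leg_may_move]) (use xs in \<open>auto simp: advancing_def turning_def in_view_def L_def\<close>)
  have turned: "clear_step (?S ?T (l + 2) turning) (?S ?T (l + 1) (returning (l + 1)))"
    by (rule spider_step[OF _ leg_may_move]) (use xs in \<open>auto simp: returning_def turning_def in_view_def L_def\<close>)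
  have ret: "clear_step\<^sup>*\<^sup>* (?S ?T (l + 1) (returning (l + 1))) (?S ?T s (returning s))"
    if "s \<le> l + 1" for s
    using that
  proof (induction s rule: inc_induct)
    case (step s)
    have "clear_step (?S ?T (Suc s) (returning (Suc s))) (?S ?T s (returning s))"
      by (rule spider_step[OF _ leg_may_move]) (use step.hyps xs in \<open>auto simp: returning_def in_view_def L_def\<close>)
    then show ?case using step.IH by simp
  qed simp
  \<comment> \<open>One step up the leg towards the root exposes its midpoint, the only vertex there
    that neither cop sees from his end.\<close>
  have up: "clear_step (?S None 0 (returning 0)) (?S None 1 (\<lambda>m d. m = Some False \<and> l < d + 1))"
    by (rule spider_step[OF _ leg_may_move]) (use xs in \<open>auto simp: returning_def in_view_def L_def\<close>)
  have down: "clear_step (?S None 1 (\<lambda>m d. m = Some False \<and> l < d + 1))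
      (?S None 0 (\<lambda>m d. m = Some False \<and> l < d))"
    by (rule spider_step[OF _ leg_may_move]) (use xs l_ge_1 in \<open>auto simp: in_view_def L_def\<close>)
  have "clear_step\<^sup>*\<^sup>* (?S ?T 0 (advancing 0)) (?S ?T (l + 2) turning)"
    using adv[of "l + 1"] turn by simp
  moreover have "clear_step\<^sup>*\<^sup>* (?S ?T (l + 2) turning) (?S ?T 0 (returning 0))"
    using turned ret[of 0] by (simp add: converse_rtranclp_into_rtranclp)
  moreover have "clear_step\<^sup>*\<^sup>* (?S None 0 (returning 0)) (?S None 0 (\<lambda>m d. m = Some False \<and> l < d))"
    using up down by simp
  ultimately show ?thesis unfolding leg_0 by (meson rtranclp_trans)
qed

text \<open>The dirt left in the spider lies in one leg, where the cop at the centre sees all depths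
  up to \<open>l\<close> and hence its frontier. From here on, monotone steps suffice.\<close>

lemma stable_second_leg:
  "clear_step ([Original xs, Original (b # xs)], dirty (\<lambda>m d. m = Some False \<and> l < d))
     ([Original xs, Original (b # xs)],
      dirty (\<lambda>m d. m = Some False \<and> l < d) - seen [Original xs, Original (b # xs)])"
  "stable [Original xs, Original (b # xs)]
     (dirty (\<lambda>m d. m = Some False \<and> l < d) - seen [Original xs, Original (b # xs)])"
proof -
  let ?P = "\<lambda>m d. m = Some False \<and> l < d"
  have "clear_step ([Original xs, leg b xs None 0], dirty ?P) ([Original xs, leg b xs None 0], dirty ?P)"
    by (rule spider_step) (auto simp: in_view_def)
  then have closed: "\<And>v w. v \<in> dirty ?P \<Longrightarrow> v \<notin> seen [Original xs, Original (b # xs)] \<Longrightarrow> may_move T v w \<Longrightarrow>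
      w \<notin> seen [Original xs, Original (b # xs)] \<Longrightarrow> w \<in> dirty ?P"
    unfolding clear_step_iff leg_0 by blast
  then show "clear_step ([Original xs, Original (b # xs)], dirty ?P)
      ([Original xs, Original (b # xs)], dirty ?P - seen [Original xs, Original (b # xs)])"
    unfolding clear_step_iff by (auto simp: list_all2_Cons)
  have "dirty ?P \<subseteq> pverts T"
    using st xs pt_in_verts[of "b # xs"] by (auto simp: dirty_def outside_def stable_def)
  then show "stable [Original xs, Original (b # xs)]
      (dirty ?P - seen [Original xs, Original (b # xs)])"
    using st closed unfolding stable_def by blast
qed

end

text \<open>Only the first leg requires the detour that is not monotone. Afterwards the dirt of the
  branch lies in a single leg, so the guard at \<open>Original xs\<close> satisfies
  \<open>free_below\<close> through \<open>?g\<close> and the other cop may give up the centre. In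
  the end only \<open>outside\<close> can be dirty, which restores
  \<open>D' \<subseteq> D\<close>.\<close>

lemma clear_branch_two:
  assumes xs: "length xs = 1" and st: "stable (replicate 2 (Original xs)) D"
  shows "\<exists>D'. clear_step\<^sup>*\<^sup>* (replicate 2 (Original xs), D) (replicate 2 (Original xs), D') \<and>
    stable (replicate 2 (Original xs)) D' \<and> D' \<subseteq> D \<and> D' \<inter> branch b xs = {}"
proof -
  let ?a = "Original xs" and ?u = "b # xs"
  let ?U = "Original ?u" and ?F = "Original (False # ?u)" and ?g = "pt b xs 1"
  have rep: "replicate 2 ?a = [?a, ?a]" by (simp add: numeral_2_eq_2)
  have stc: "stable C' D'" "D' \<subseteq> D1" if "clears_to C D1 C' D'" for C C' D1 D'
    using that by (auto simp: clears_to_def)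
  have cs: "clear_step\<^sup>*\<^sup>* (C, D1) (C', D')" if "clears_to C D1 C' D'" for C C' D1 D'
    using rtranclp_mono_step[OF that mono_step_le] .
  obtain D1 where D1: "clears_to [?a, ?a] D [?a, ?U] D1"
    "\<And>x. x \<in> D1 \<Longrightarrow> x \<in> branch b xs \<Longrightarrow> anc ?U x \<and> x \<noteq> ?U"
    using descend[of xs "[?a, ?a]" D 1 b "[?a, ?U]"] free_below_guard[of xs 0 "[?a, ?a]" 1 D b]
      st xs unfolding rep by auto
  note st1 = stc(1)[OF D1(1)]
  note defs = dirty_def[OF xs st1] outside_def[OF xs st1]
  have sub: "D1 \<subseteq> dirty xs b D1 (advancing 0)"
  proof
    fix x assume x: "x \<in> D1"
    show "x \<in> dirty xs b D1 (advancing 0)"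
    proof (cases "x \<in> branch b xs")
      case True
      have "x \<in> pverts T" using x st1 by (auto simp: stable_def)
      then obtain c d where c: "d \<le> L" "x = pt c ?u d"
        using anc_centre_cases[of ?u x] D1(2)[OF x True] xs by auto
      have "l < d"
      proof (rule ccontr)
        assume "\<not> l < d"
        then have "x \<in> seen [?a, leg b xs (Some c) 0]"
          using in_view_seen[OF xs _ c(1), of 0 "Some c" "Some c" b] c by (simp add: in_view_def)
        then show False using x st1 unfolding leg_0 stable_def by auto
      qed
      then have "x = leg b xs (Some c) d \<and> advancing 0 (Some c) d"
        using c by (cases c) (auto simp: advancing_def[OF xs st1])
      then show ?thesis using c unfolding defs by blast
    qed (use x in \<open>auto simp: defs\<close>)
  qed
  let ?P = "\<lambda>m d. m = Some False \<and> l < d"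
  let ?D3 = "dirty xs b D1 ?P - seen [?a, ?U]"
  have "clear_step ([?a, ?U], D1) ([?a, ?U], dirty xs b D1 (advancing 0))"
    using sub st1 unfolding clear_step_iff stable_def by (intro conjI) (simp, blast)
  moreover have "clear_step\<^sup>*\<^sup>* ([?a, ?U], dirty xs b D1 (advancing 0)) ([?a, ?U], dirty xs b D1 ?P)"
    by (rule clear_first_leg[OF xs st1])
  moreover note stable_second_leg(1)[OF xs st1]
  ultimately have to3: "clear_step\<^sup>*\<^sup>* ([?a, ?U], D1) ([?a, ?U], ?D3)"
    by (meson converse_rtranclp_into_rtranclp rtranclp.rtrancl_into_rtrancl)
  note st3 = stable_second_leg(2)[OF xs st1]
  have D3: "x \<in> outside xs b D1 \<or> x \<in> branch False ?u" if "x \<in> ?D3" for x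
  proof -
    have "x \<in> outside xs b D1 \<or> (\<exists>d \<le> L. l < d \<and> x = pt False ?u d)"
      using that by (auto simp: dirty_def[OF xs st1])
    then show ?thesis using anc_pt_pt[of ?u 1 _ False] xs by (auto simp: branch_def)
  qed
  have gU: "anc ?g ?U" using anc_pt_pt[of xs 1 L b] xs L_gt by simp
  have UF: "anc ?U (pt False ?u d)" if "d \<le> L" for d using anc_pt_pt[of ?u 0 d False] xs that by simp
  have "free_below [?a, ?U] 1 ?D3 (pt False ?u 1)"
    unfolding free_below_def
  proof (intro disjI2 exI[of _ 0] exI[of _ ?g] conjI ballI impI)
    show "?g \<in> pverts T" "?g \<noteq> Original []" "parent ?g = [?a, ?U] ! 0"
      using pt_in_verts[of xs 1 b] pt_Suc_neq_root[of b xs 0] parent_pt[of 0 b xs] xs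
      by (auto simp: L_def)
    show "anc ?g (pt False ?u 1)"
      using anc_trans[OF gU UF[of 1]] pt_in_verts[of ?u 1 False] xs by (simp add: L_def)
    fix x assume "x \<in> ?D3" "anc ?g x"
    then show "anc (pt False ?u 1) x" using D3[of x] by (auto simp: defs branch_def)
  qed simp_all
  then obtain D4 where D4: "clears_to [?a, ?U] ?D3 [?a, ?F] D4"
    "\<And>x. x \<in> D4 \<Longrightarrow> x \<in> branch False ?u \<Longrightarrow> anc ?F x \<and> x \<noteq> ?F"
    using descend[of ?u "[?a, ?U]" ?D3 1 False "[?a, ?F]"] st3 xs by auto
  have out: "x \<in> outside xs b D1" if "x \<in> D4" for x
  proof -
    have "x \<in> ?D3" "x \<in> pverts T" using that stc[OF D4(1)] by (auto simp: stable_def)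
    then show ?thesis using D3[of x] D4(2)[OF that] anc_leaf[of "False # ?u" x] xs by auto
  qed
  have notU: "\<not> anc ?U x" if "x \<in> D4" for x
    using out[OF that] anc_trans[OF gU] st1 by (auto simp: defs branch_def stable_def)
  have "\<not> anc ?F x" if "x \<in> D4" for x
    using notU[OF that] anc_trans[of ?U ?F x] UF[of L] out[OF that] st1 by (auto simp: defs stable_def)
  then obtain D5 where D5: "clears_to [?a, ?F] D4 [?a, ?U] D5"
    using ascend[of ?u "[?a, ?F]" D4 1 False "[?a, ?U]"] stc[OF D4(1)] xs by auto
  then obtain D6 where D6: "clears_to [?a, ?U] D5 [?a, ?a] D6" "D6 \<inter> branch b xs = {}"
    using ascend[of xs "[?a, ?U]" D5 1 b "[?a, ?a]"] stc[OF D5] xs notU by auto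
  have "D6 \<subseteq> D"
    using stc(2)[OF D5] stc(2)[OF D6(1)] stc(2)[OF D1(1)] out by (auto simp: defs)
  moreover have "clear_step\<^sup>*\<^sup>* ([?a, ?a], D) ([?a, ?a], D6)"
    using cs[OF D1(1)] to3 cs[OF D4(1)] cs[OF D5] cs[OF D6(1)] by (meson rtranclp_trans)
  ultimately show ?thesis unfolding rep using stc(1)[OF D6(1)] D6(2) by blast
qed

lemma two_cops: "\<exists>\<sigma>. winning_strategy l T 2 \<sigma>"
proof -
  obtain C C' where C: "set C \<subseteq> pverts T" "length C = 2"
    "clear_step\<^sup>*\<^sup>* (C, pverts T - seen C) (C', {})"
    using sweep[OF mono_step_le, of 2] clear_branch_two by auto
  then have "C \<noteq> []" by auto
  from clear_wins[OF C(3,1) this] C(2) show ?thesis by simp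
qed

end

theorem theorem3p1:
  fixes l :: nat
  assumes "1 \<le> l"
  shows "cop_number l (subdivided_tree l) = 2 \<and> mono_cop_number l (subdivided_tree l) = 3"
proof -
  interpret subdivided l by unfold_locales (rule assms)
  have "cop_number l T = 2"
    unfolding cop_number_def
    by (rule Least_equality) (use two_cops cop_number_lower in blast)+
  moreover have "mono_cop_number l T = 3"
    unfolding mono_cop_number_def
  proof (rule Least_equality)
    show "\<exists>\<sigma>. winning_strategy l T 3 \<sigma> \<and> monotonic_strategy l T \<sigma>" by (rule monotonic_three_cops)
  next
    fix n assume "\<exists>\<sigma>. winning_strategy l T n \<sigma> \<and> monotonic_strategy l T \<sigma>"
    then obtain \<sigma> where \<sigma>: "winning_strategy l T n \<sigma>" "monotonic_strategy l T \<sigma>" by blast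
    then have "n \<noteq> 2" using monotonic_two_cops by blast
    then show "3 \<le> n" using cop_number_lower[OF \<sigma>(1)] by simp
  qed
  ultimately show ?thesis ..
qed

end
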